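(* Let $f:U\to H^3$ and $g:U\to S^3_1$ be the dual flat fronts described below and $p$ a non-degenerate singular point of both $f$ and $g$. Let $\gamma(t)$ be a singular curve through $p=\gamma(0)$. Assume that $f$ at $p$ is a cuspidal edge and $\kappa_t^h(p)=0$ (resp. $g$ at $p$ is a cuspidal edge and $\kappa_t^d(p)=0$). Then $g$ (resp. $f$) is a swallowtail at $p$ if and only if $\left.\frac{d}{dt}\kappa_t^h\right|_{t=0}\neq0$ (resp. $\left.\frac{d}{dt}\kappa_t^d\right|_{t=0}\neq0$).
   Context: Let $U\subset\boldsymbol{C}$ be a domain, $\alpha,\beta:U\to\boldsymbol{C}\setminus\{0\}$ holomorphic, $A:U\to SL(2,\boldsymbol{C})$ a solution of $A'=AD$ with $D=\begin{pmatrix}0&\alpha\\ \beta&0\end{pmatrix}$, and, identifying Lorentz–Minkowski 4-space with $2\times2$ Hermitian matrices, $f=AA^*:U\to H^3$ (hyperbolic 3-space) and $g=Ae_3A^*:U\to S^3_1$ (de Sitter 3-space), $e_3=\mathrm{diag}(1,-1)$. These are flat fronts, each a $\Delta_1$-dual (unit normal) of the other, with $\Sigma(f)=\Sigma(g)=\{\alpha\overline{\alpha}-\beta\overline{\beta}=0\}$. $\kappa_t^h$ denotes the cuspidal torsion of $f$ along the singular curve and $\kappa_t^d$ that of $g$; in terms of $\lambda=\alpha\overline\alpha-\beta\overline\beta$ they are $\kappa_t^h=\operatorname{Re}\left(\sqrt{\alpha\beta}\,\lambda_{\overline z}\right)/\operatorname{Im}\left(\sqrt{\alpha\beta}\,\lambda_{\overline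 z}\right)$ and $\kappa_t^d=-\operatorname{Im}\left(\sqrt{\alpha\beta}\,\lambda_{\overline z}\right)/\operatorname{Re}\left(\sqrt{\alpha\beta}\,\lambda_{\overline z}\right)$ along the singular curve. *)

theory Defs
  imports "HOL-Analysis.Analysis" "HOL-Complex_Analysis.Complex_Analysis"
begin

fun Ck :: "nat \<Rightarrow> 'a::real_normed_vector set \<Rightarrow> ('a \<Rightarrow> 'b::real_normed_vector) \<Rightarrow> bool" where
  "Ck 0 S f \<longleftrightarrow> continuous_on S f"
| "Ck (Suc n) S f \<longleftrightarrow> continuous_on S f \<and> (\<forall>x\<in>S. f differentiable (at x))
      \<and> (\<forall>v. Ck n S (\<lambda>x. frechet_derivative f (at x) v))"

definition smooth_on :: "'a::real_normed_vector set \<Rightarrow> ('a \<Rightarrow> 'b::real_normed_vector) \<Rightarrow> bool" where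
  "smooth_on S f \<longleftrightarrow> (\<forall>n. Ck n S f)"

definition diffeo_on :: "('a::real_normed_vector \<Rightarrow> 'b::real_normed_vector) \<Rightarrow> 'a set \<Rightarrow> 'b set \<Rightarrow> bool" where
  "diffeo_on \<phi> W V \<longleftrightarrow> open W \<and> open V \<and> bij_betw \<phi> W V \<and> smooth_on W \<phi>
      \<and> smooth_on V (inv_into W \<phi>)"

text \<open>The germ of \<open>f\<close> at \<open>p\<close> (source a domain in C = R^2), regarded as a map into
  \<open>N\<close>, is A-equivalent to the germ at 0 of the model \<open>h\<close> (into R^3):
  there are a diffeomorphism germ \<open>\<phi>\<close> of (R^2,0) onto (U,p) and a local chart \<open>\<Psi>|N\<close>
  of \<open>N\<close> around \<open>f p\<close> (restriction of a smooth ambient map, with smooth inverse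
  \<open>\<theta>\<close>) sending \<open>f p\<close> to 0, with \<open>\<Psi> \<circ> f \<circ> \<phi> = h\<close> near 0.\<close>
definition germ_A_equiv ::
  "'m::real_normed_vector set \<Rightarrow> (complex \<Rightarrow> 'm) \<Rightarrow> complex set \<Rightarrow> complex \<Rightarrow> (complex \<Rightarrow> real^3) \<Rightarrow> bool" where
  "germ_A_equiv N f U p h \<longleftrightarrow>
    (\<exists>V W \<phi> Ob \<Psi> \<theta>. open V \<and> p \<in> V \<and> V \<subseteq> U \<and> open W \<and> 0 \<in> W \<and> diffeo_on \<phi> W V \<and> \<phi> 0 = p
      \<and> open Ob \<and> f p \<in> Ob \<and> smooth_on Ob \<Psi> \<and> inj_on \<Psi> (N \<inter> Ob) \<and> open (\<Psi> ` (N \<inter> Ob))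
      \<and> smooth_on (\<Psi> ` (N \<inter> Ob)) \<theta> \<and> (\<forall>y\<in>N \<inter> Ob. \<theta> (\<Psi> y) = y) \<and> \<Psi> (f p) = 0
      \<and> (\<forall>w\<in>W. f (\<phi> w) \<in> N \<inter> Ob \<and> \<Psi> (f (\<phi> w)) = h w))"

definition cuspidal_edge_model :: "complex \<Rightarrow> real^3" where
  "cuspidal_edge_model z = vector [Re z, (Im z)^2, (Im z)^3]"

definition swallowtail_model :: "complex \<Rightarrow> real^3" where
  "swallowtail_model z = vector [Re z, -4 * (Im z)^3 - 2 * Re z * Im z, 3 * (Im z)^4 + Re z * (Im z)^2]"

definition is_cuspidal_edge where
  "is_cuspidal_edge N f U p \<longleftrightarrow> germ_A_equiv N f U p cuspidal_edge_model"

definition is_swallowtail where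
  "is_swallowtail N f U p \<longleftrightarrow> germ_A_equiv N f U p swallowtail_model"

section \<open>Lorentz-Minkowski 4-space as 2x2 Hermitian matrices\<close>

definition adjm :: "complex^2^2 \<Rightarrow> complex^2^2" where
  "adjm X = (\<chi> i j. cnj (X $ j $ i))"

definition hyperbolic3 :: "(complex^2^2) set" where
  "hyperbolic3 = {X. adjm X = X \<and> det X = 1 \<and> Re (X $ 1 $ 1 + X $ 2 $ 2) > 0}"

definition deSitter3 :: "(complex^2^2) set" where
  "deSitter3 = {X. adjm X = X \<and> det X = -1}"

definition e3 :: "complex^2^2" where
  "e3 = (\<chi> i j. if i = j then (if i = 1 then 1 else -1) else 0)"

definition Dmat :: "complex \<Rightarrow> complex \<Rightarrow> complex^2^2" where
  "Dmat a b = (\<chi> i j. if i = 1 \<and> j = 2 then a else if i = 2 \<and> j = 1 then b else 0)"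

definition hyp_front :: "(complex \<Rightarrow> complex^2^2) \<Rightarrow> complex \<Rightarrow> complex^2^2" where
  "hyp_front A z = A z ** adjm (A z)"

definition dS_front :: "(complex \<Rightarrow> complex^2^2) \<Rightarrow> complex \<Rightarrow> complex^2^2" where
  "dS_front A z = A z ** e3 ** adjm (A z)"

definition lam :: "(complex \<Rightarrow> complex) \<Rightarrow> (complex \<Rightarrow> complex) \<Rightarrow> complex \<Rightarrow> real" where
  "lam \<alpha> \<beta> z = (cmod (\<alpha> z))^2 - (cmod (\<beta> z))^2"

definition dzbar :: "(complex \<Rightarrow> real) \<Rightarrow> complex \<Rightarrow> complex" where
  "dzbar h z = (complex_of_real (frechet_derivative h (at z) 1)
                 + \<i> * complex_of_real (frechet_derivative h (at z) \<i>)) / 2"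

definition kappa_h :: "(complex \<Rightarrow> complex) \<Rightarrow> (complex \<Rightarrow> complex) \<Rightarrow> complex \<Rightarrow> real" where
  "kappa_h \<alpha> \<beta> z = Re (csqrt (\<alpha> z * \<beta> z) * dzbar (lam \<alpha> \<beta>) z)
                   / Im (csqrt (\<alpha> z * \<beta> z) * dzbar (lam \<alpha> \<beta>) z)"

definition kappa_d :: "(complex \<Rightarrow> complex) \<Rightarrow> (complex \<Rightarrow> complex) \<Rightarrow> complex \<Rightarrow> real" where
  "kappa_d \<alpha> \<beta> z = - Im (csqrt (\<alpha> z * \<beta> z) * dzbar (lam \<alpha> \<beta>) z)
                   / Re (csqrt (\<alpha> z * \<beta> z) * dzbar (lam \<alpha> \<beta>) z)"

end

theory Submission
  imports Defs
begin

text \<open>The fronts \<open>f\<close> and \<open>g\<close> are \<open>A diag(1, \<epsilon>) A*\<close> with \<open>\<epsilon> = 1\<close> and \<open>\<epsilon> = -1\<close>. Their null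
  direction along \<open>\<lambda> = 0\<close> is \<open>1 / r\<close> with \<open>r\<^sup>2 = -\<epsilon> \<alpha> \<beta>\<close>; writing \<open>\<Xi> = d\<lambda>(1 / r)\<close>, the cuspidal torsions are
  the quotients of the two functions \<open>\<Xi>\<close>. Since differentials of fronts and their kernels are transported by equivalences
  of germs, a cuspidal edge has \<open>\<Xi> \<noteq> 0\<close>, and a swallowtail has \<open>\<Xi> = 0\<close> with \<open>\<Xi>\<close> changing sign to first
  order along the singular curve.

  Conversely, \<open>X \<mapsto> a\<^sub>1* adj(X) a\<^sub>1 - \<epsilon>\<close>, with \<open>a\<^sub>1\<close> the first column of \<open>A\<close>, is a
  generating family of horospheres: the front is the envelope of its zero sets. The data being
  holomorphic, the family extends to complex parameters. One nondegenerate real parameter is eliminated,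
  and the Weierstrass preparation theorem (division by a quartic with the Cauchy integral, the
  coefficients being found with the implicit function theorem) turns the remaining one-parameter family
  into the versal unfolding of \<open>w\<^sup>4\<close>, whose discriminant is the standard swallowtail. The order of
  the unfolding is four exactly if \<open>\<Xi>\<close> has a simple zero along the singular curve.\<close>

section \<open>Calculus of smooth maps\<close>

text \<open>The obstacle is that \<open>germ_A_equiv\<close> asks for actual diffeomorphisms, so the
  source and target coordinates of a swallowtail have to be constructed. For smooth families this
  would need the Malgrange preparation theorem. Here the generating function involves conjugates of
  holomorphic functions of \<open>z\<close>; polarisation makes it holomorphic in two independent
  coordinates of the source, and Cauchy integrals suffice. The dependence on the point of the space
  form stays merely smooth.

  The family has two source coordinates while the unfolding of \<open>w^4\<close> has one. In the
  coordinates \<open>z = p + e (s + \<i> t)\<close> with \<open>e = 1 / r p\<close> the Hessian at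
  \<open>p\<close> is diagonal with null direction \<open>s\<close>. So \<open>t\<close> can be
  eliminated, and along the front the second derivative of the reduced family is the Hessian
  determinant over its \<open>tt\<close> entry, which is \<lambda> times a factor that is nonzero at
  \<open>p\<close>.

  A cuspidal edge never has to be constructed: it is only a hypothesis, and it enters through the
  kernel of the differential.\<close>

lemma Ck_imp_continuous_on: "Ck n S f \<Longrightarrow> continuous_on S f"
  by (cases n) auto

lemma Ck_SucD:
  assumes "Ck (Suc n) S f"
  shows "x \<in> S \<Longrightarrow> (f has_derivative frechet_derivative f (at x)) (at x)"
    and "Ck n S (\<lambda>x. frechet_derivative f (at x) v)"
  using assms frechet_derivative_works by auto

lemma Ck_mono: "Ck n S f \<Longrightarrow> T \<subseteq> S \<Longrightarrow> Ck n T f"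
  by (induction n arbitrary: f) (auto intro: continuous_on_subset)

lemma Ck_Suc_imp_Ck: "Ck (Suc n) S f \<Longrightarrow> Ck n S f"
  by (induction n arbitrary: f) auto

lemma Ck_cong:
  assumes "open S" and "\<And>x. x \<in> S \<Longrightarrow> f x = g x" and "Ck n S f"
  shows "Ck n S g"
  using assms(2,3)
proof (induction n arbitrary: f g)
  case 0
  then show ?case by (auto cong: continuous_on_cong)
next
  case (Suc n)
  have d: "(g has_derivative frechet_derivative f (at x)) (at x)" if "x \<in> S" for x
    using Ck_SucD(1)[OF Suc.prems(2) that] has_derivative_transform_within_open assms(1) that Suc.prems(1)
    by blast
  then have e: "frechet_derivative g (at x) = frechet_derivative f (at x)" if "x \<in> S" for x
    using that by (metis frechet_derivative_at)
  have "continuous_on S g"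
    using Suc.prems by (auto cong: continuous_on_cong)
  moreover have "Ck n S (\<lambda>x. frechet_derivative g (at x) v)" for v
    by (rule Suc.IH[of "\<lambda>x. frechet_derivative f (at x) v"]) (use Suc.prems(2) e in auto)
  ultimately show ?case
    using d by (auto simp: differentiable_def)
qed

text \<open>Uniqueness of the derivative replaces \<open>frechet_derivative\<close> by any explicit
  candidate; most inductive steps below rest on this rule.\<close>

lemma Ck_SucI:
  assumes "open S" and "\<And>x. x \<in> S \<Longrightarrow> (f has_derivative f' x) (at x)"
    and "\<And>v. Ck n S (\<lambda>x. f' x v)"
  shows "Ck (Suc n) S f"
proof -
  have e: "frechet_derivative f (at x) = f' x" if "x \<in> S" for x
    using assms(2)[OF that] by (metis frechet_derivative_at)
  have "continuous_on S f"
    using assms(2) by (meson continuous_at_imp_continuous_on has_derivative_continuous)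
  moreover have "Ck n S (\<lambda>x. frechet_derivative f (at x) v)" for v
    by (rule Ck_cong[OF assms(1) _ assms(3)]) (use e in auto)
  ultimately show ?thesis
    using assms(2) by (auto simp: differentiable_def)
qed

lemma Ck_const: "open S \<Longrightarrow> Ck n S (\<lambda>x. c)"
proof (induction n arbitrary: c)
  case (Suc n)
  show ?case
    by (rule Ck_SucI[of _ _ "\<lambda>x v. 0"]) (use Suc in auto)
qed auto

lemma Ck_bounded_linear_compose:
  assumes "bounded_linear L" and "open S" and "Ck n S f"
  shows "Ck n S (\<lambda>x. L (f x))"
  using assms(3)
proof (induction n arbitrary: f)
  case 0
  then show ?case
    using assms(1) by (simp add: bounded_linear.continuous_on)
next
  case (Suc n)
  show ?case
    by (rule Ck_SucI[OF assms(2), of _ "\<lambda>x v. L (frechet_derivative f (at x) v)"])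
      (intro bounded_linear.has_derivative[OF assms(1)] Ck_SucD(1)[OF Suc.prems] Suc.IH Ck_SucD(2)[OF Suc.prems]; assumption)+
qed

lemma Ck_ident: "open S \<Longrightarrow> Ck n S (\<lambda>x. x)"
proof (cases n)
  case (Suc m)
  assume "open S"
  then show ?thesis unfolding Suc
    by (intro Ck_SucI[of _ _ "\<lambda>x v. v"]) (auto intro: Ck_const)
qed auto

lemma Ck_add:
  assumes "open S" and "Ck n S f" and "Ck n S g"
  shows "Ck n S (\<lambda>x. f x + g x)"
  using assms(2,3)
proof (induction n arbitrary: f g)
  case 0
  then show ?case by (auto intro: continuous_intros)
next
  case (Suc n)
  show ?case
    by (rule Ck_SucI[OF assms(1), of _ "\<lambda>x v. frechet_derivative f (at x) v + frechet_derivative g (at x) v"])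
      (intro has_derivative_add Ck_SucD(1)[OF Suc.prems(1)] Ck_SucD(1)[OF Suc.prems(2)] Suc.IH
        Ck_SucD(2)[OF Suc.prems(1)] Ck_SucD(2)[OF Suc.prems(2)]; assumption)+
qed

lemma Ck_sum:
  assumes "open S" and "\<And>i. i \<in> I \<Longrightarrow> Ck n S (f i)"
  shows "Ck n S (\<lambda>x. \<Sum>i\<in>I. f i x)"
  using assms(2) by (induction I rule: infinite_finite_induct) (auto intro!: Ck_add Ck_const assms(1))

lemma Ck_bilinear:
  assumes "bounded_bilinear B" and "open S" and "Ck n S f" and "Ck n S g"
  shows "Ck n S (\<lambda>x. B (f x) (g x))"
  using assms(3,4)
proof (induction n arbitrary: f g)
  case 0
  then show ?case
    using assms(1) by (auto simp: bounded_bilinear.continuous_on)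
next
  case (Suc n)
  have n: "Ck n S f" "Ck n S g"
    using Suc.prems Ck_Suc_imp_Ck by blast+
  show ?case
  proof (rule Ck_SucI[OF assms(2)])
    show "((\<lambda>x. B (f x) (g x)) has_derivative
       (\<lambda>v. B (f x) (frechet_derivative g (at x) v) + B (frechet_derivative f (at x) v) (g x))) (at x)"
      if "x \<in> S" for x
      using that Suc.prems by (intro bounded_bilinear.FDERIV[OF assms(1)] Ck_SucD(1))
    show "Ck n S (\<lambda>x. B (f x) (frechet_derivative g (at x) v) + B (frechet_derivative f (at x) v) (g x))" for v
      using n Suc.prems by (intro Ck_add Suc.IH assms(2) Ck_SucD(2))
  qed
qed

text \<open>In the chain rule both the base point and the direction of the outer derivative vary
  with \<open>x\<close>. Expanding the direction over \<open>Basis\<close> leaves products of a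
  scalar function and a derivative in a fixed direction, to which the induction hypothesis applies;
  this is where the middle space has to be Euclidean.\<close>

lemma Ck_compose:
  fixes f :: "'b::euclidean_space \<Rightarrow> 'c::real_normed_vector"
  assumes "open S" and "open T" and "Ck n T f" and "Ck n S g" and "g ` S \<subseteq> T"
  shows "Ck n S (\<lambda>x. f (g x))"
  using assms(3,4)
proof (induction n arbitrary: f)
  case 0
  then show ?case
    using assms(5) by (auto intro: continuous_on_compose2)
next
  case (Suc n)
  have n: "Ck n S g"
    using Suc.prems Ck_Suc_imp_Ck by blast
  show ?case
  proof (rule Ck_SucI[OF assms(1)])
    show "((\<lambda>x. f (g x)) has_derivative
       (\<lambda>v. \<Sum>b\<in>Basis. (frechet_derivative g (at x) v \<bullet> b) *\<^sub>R frechet_derivative f (at (g x)) b)) (at x)"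
      if x: "x \<in> S" for x
    proof -
      have df: "(f has_derivative frechet_derivative f (at (g x))) (at (g x))"
        using x assms(5) Suc.prems by (intro Ck_SucD(1)) auto
      have d1: "((\<lambda>x. f (g x)) has_derivative (\<lambda>v. frechet_derivative f (at (g x)) (frechet_derivative g (at x) v))) (at x)"
        by (rule has_derivative_compose[OF Ck_SucD(1)[OF Suc.prems(2) x] df])
      have eq: "frechet_derivative f (at (g x)) u
          = (\<Sum>b\<in>Basis. (u \<bullet> b) *\<^sub>R frechet_derivative f (at (g x)) b)" for u
      proof -
        interpret linear "frechet_derivative f (at (g x))"
          using df has_derivative_linear by blast
        have "frechet_derivative f (at (g x)) (\<Sum>b\<in>Basis. (u \<bullet> b) *\<^sub>R b)
          = (\<Sum>b\<in>Basis. (u \<bullet> b) *\<^sub>R frechet_derivative f (at (g x)) b)"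
          by (simp only: sum scale)
        then show ?thesis
          by (simp only: euclidean_representation)
      qed
      have d2: "(\<lambda>v. frechet_derivative f (at (g x)) (frechet_derivative g (at x) v))
          = (\<lambda>v. \<Sum>b\<in>Basis. (frechet_derivative g (at x) v \<bullet> b) *\<^sub>R frechet_derivative f (at (g x)) b)"
        by (intro ext eq)
      show ?thesis
        using d1 unfolding d2 .
    qed
    show "Ck n S (\<lambda>x. \<Sum>b\<in>Basis. (frechet_derivative g (at x) v \<bullet> b) *\<^sub>R frechet_derivative f (at (g x)) b)" for v
      by (intro Ck_sum Ck_bilinear[OF bounded_bilinear_scaleR] assms(1)
          Ck_bounded_linear_compose[OF bounded_linear_inner_left] Suc.IH Ck_SucD(2)[OF Suc.prems(1)]
          Ck_SucD(2)[OF Suc.prems(2)] n)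
  qed
qed

lemma Ck_inverse:
  fixes f :: "'a::real_normed_vector \<Rightarrow> 'b::real_normed_field"
  assumes "open S" and "Ck n S f" and "\<And>x. x \<in> S \<Longrightarrow> f x \<noteq> 0"
  shows "Ck n S (\<lambda>x. inverse (f x))"
  using assms(2)
proof (induction n)
  case 0
  then show ?case using assms(3) by (auto intro: continuous_intros)
next
  case (Suc n)
  then have IH: "Ck n S (\<lambda>x. inverse (f x))"
    using Ck_Suc_imp_Ck by blast
  show ?case
  proof (rule Ck_SucI[OF assms(1)])
    show "((\<lambda>x. inverse (f x)) has_derivative
       (\<lambda>v. (- 1) * (inverse (f x) * frechet_derivative f (at x) v * inverse (f x)))) (at x)" if "x \<in> S" for x
      using Deriv.has_derivative_inverse[OF assms(3)[OF that] Ck_SucD(1)[OF Suc.prems that]] by simp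
    show "Ck n S (\<lambda>x. (- 1) * (inverse (f x) * frechet_derivative f (at x) v * inverse (f x)))" for v
      by (intro Ck_bilinear[OF bounded_bilinear_mult] Ck_const assms(1) IH Ck_SucD(2)[OF Suc.prems])
  qed
qed

lemma Ck_holomorphic:
  assumes "open S" and "f holomorphic_on S"
  shows "Ck n S f"
  using assms(2)
proof (induction n arbitrary: f)
  case 0
  then show ?case by (simp add: holomorphic_on_imp_continuous_on)
next
  case (Suc n)
  show ?case
  proof (rule Ck_SucI[OF assms(1)])
    show "(f has_derivative (\<lambda>v. deriv f x * v)) (at x)" if "x \<in> S" for x
      using holomorphic_derivI[OF Suc.prems assms(1) that] by (simp add: has_field_derivative_def)
    show "Ck n S (\<lambda>x. deriv f x * v)" for v
      using Suc assms(1) by (intro Suc.IH holomorphic_intros holomorphic_deriv)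
  qed
qed

section \<open>Closure properties of infinitely differentiable maps\<close>

lemma smooth_on_imp_continuous_on: "smooth_on S f \<Longrightarrow> continuous_on S f"
  by (rule Ck_imp_continuous_on[of 0]) (simp only: smooth_on_def)

lemma smooth_on_has_derivative:
  "smooth_on S f \<Longrightarrow> x \<in> S \<Longrightarrow> (f has_derivative frechet_derivative f (at x)) (at x)"
  by (rule Ck_SucD(1)[of 0 S]) (simp only: smooth_on_def)

lemma smooth_on_frechet: "smooth_on S f \<Longrightarrow> smooth_on S (\<lambda>x. frechet_derivative f (at x) v)"
  unfolding smooth_on_def by (rule allI, rule Ck_SucD(2)) simp

lemma smooth_on_subset: "smooth_on S f \<Longrightarrow> T \<subseteq> S \<Longrightarrow> smooth_on T f"
  unfolding smooth_on_def by (rule allI, rule Ck_mono[of _ S]) auto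

lemma smooth_on_cong: "smooth_on S f \<Longrightarrow> open S \<Longrightarrow> (\<And>x. x \<in> S \<Longrightarrow> f x = g x) \<Longrightarrow> smooth_on S g"
  unfolding smooth_on_def using Ck_cong[of S f g] by simp

lemma smooth_on_compose:
  fixes f :: "'b::euclidean_space \<Rightarrow> 'c::real_normed_vector"
  shows "smooth_on T f \<Longrightarrow> open T \<Longrightarrow> open S \<Longrightarrow> smooth_on S g \<Longrightarrow> (\<And>x. x \<in> S \<Longrightarrow> g x \<in> T)
    \<Longrightarrow> smooth_on S (\<lambda>x. f (g x))"
  unfolding smooth_on_def by (rule allI, rule Ck_compose[of S T _ f]) auto

lemma smooth_on_bounded_linear:
  "bounded_linear L \<Longrightarrow> open S \<Longrightarrow> smooth_on S f \<Longrightarrow> smooth_on S (\<lambda>x. L (f x))"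
  unfolding smooth_on_def by (rule allI, rule Ck_bounded_linear_compose) auto

lemma smooth_on_bilinear:
  "bounded_bilinear B \<Longrightarrow> open S \<Longrightarrow> smooth_on S f \<Longrightarrow> smooth_on S g \<Longrightarrow> smooth_on S (\<lambda>x. B (f x) (g x))"
  unfolding smooth_on_def by (rule allI, rule Ck_bilinear) auto

lemma smooth_on_holomorphic: "f holomorphic_on S \<Longrightarrow> open S \<Longrightarrow> smooth_on S f"
  unfolding smooth_on_def by (rule allI, rule Ck_holomorphic) auto

named_theorems smooth_intros

lemma smooth_on_const [smooth_intros]: "open S \<Longrightarrow> smooth_on S (\<lambda>x. c)"
  unfolding smooth_on_def by (rule allI, rule Ck_const) auto

lemma smooth_on_ident [smooth_intros]: "open S \<Longrightarrow> smooth_on S (\<lambda>x. x)"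
  unfolding smooth_on_def by (rule allI, rule Ck_ident) auto

lemma smooth_on_add [smooth_intros]:
  "open S \<Longrightarrow> smooth_on S f \<Longrightarrow> smooth_on S g \<Longrightarrow> smooth_on S (\<lambda>x. f x + g x)"
  unfolding smooth_on_def by (rule allI, rule Ck_add) auto

lemma smooth_on_sum [smooth_intros]:
  "open S \<Longrightarrow> (\<And>i. i \<in> I \<Longrightarrow> smooth_on S (f i)) \<Longrightarrow> smooth_on S (\<lambda>x. \<Sum>i\<in>I. f i x)"
  unfolding smooth_on_def by (rule allI, rule Ck_sum) auto

lemma smooth_on_minus [smooth_intros]:
  "open S \<Longrightarrow> smooth_on S f \<Longrightarrow> smooth_on S (\<lambda>x. - f x)"
  by (rule smooth_on_bounded_linear[OF bounded_linear_minus[OF bounded_linear_ident]])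

lemma smooth_on_diff [smooth_intros]:
  "open S \<Longrightarrow> smooth_on S f \<Longrightarrow> smooth_on S g \<Longrightarrow> smooth_on S (\<lambda>x. f x - g x)"
  using smooth_on_add[of S f "\<lambda>x. - g x"] smooth_on_minus[of S g] by simp

lemma smooth_on_mult [smooth_intros]:
  fixes f g :: "_ \<Rightarrow> 'a::real_normed_algebra"
  shows "open S \<Longrightarrow> smooth_on S f \<Longrightarrow> smooth_on S g \<Longrightarrow> smooth_on S (\<lambda>x. f x * g x)"
  using smooth_on_bilinear[OF bounded_bilinear_mult] .

lemma smooth_on_scaleR [smooth_intros]:
  "open S \<Longrightarrow> smooth_on S f \<Longrightarrow> smooth_on S g \<Longrightarrow> smooth_on S (\<lambda>x. f x *\<^sub>R g x)"
  using smooth_on_bilinear[OF bounded_bilinear_scaleR] .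

lemma smooth_on_power [smooth_intros]:
  fixes f :: "_ \<Rightarrow> 'a::real_normed_algebra_1"
  shows "open S \<Longrightarrow> smooth_on S f \<Longrightarrow> smooth_on S (\<lambda>x. f x ^ n)"
  by (induction n) (simp_all add: smooth_on_const smooth_on_mult)

lemma smooth_on_inverse [smooth_intros]:
  fixes f :: "'a::real_normed_vector \<Rightarrow> 'b::real_normed_field"
  shows "open S \<Longrightarrow> smooth_on S f \<Longrightarrow> (\<And>x. x \<in> S \<Longrightarrow> f x \<noteq> 0) \<Longrightarrow> smooth_on S (\<lambda>x. inverse (f x))"
  unfolding smooth_on_def by (rule allI, rule Ck_inverse) auto

lemma smooth_on_divide [smooth_intros]:
  fixes f g :: "'a::real_normed_vector \<Rightarrow> 'b::real_normed_field"
  shows "open S \<Longrightarrow> smooth_on S f \<Longrightarrow> smooth_on S g \<Longrightarrow> (\<And>x. x \<in> S \<Longrightarrow> g x \<noteq> 0) \<Longrightarrow> smooth_on S (\<lambda>x. f x / g x)"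
  unfolding divide_inverse by (intro smooth_intros)

lemmas smooth_on_fst [smooth_intros] = smooth_on_bounded_linear[OF bounded_linear_fst]
lemmas smooth_on_snd [smooth_intros] = smooth_on_bounded_linear[OF bounded_linear_snd]
lemmas smooth_on_Re [smooth_intros] = smooth_on_bounded_linear[OF bounded_linear_Re]
lemmas smooth_on_cnj [smooth_intros] = smooth_on_bounded_linear[OF bounded_linear_cnj]
lemmas smooth_on_of_real [smooth_intros] = smooth_on_bounded_linear[OF bounded_linear_of_real]

lemma smooth_on_Pair [smooth_intros]:
  assumes "open S" "smooth_on S f" "smooth_on S g"
  shows "smooth_on S (\<lambda>x. (f x, g x))"
proof -
  have 1: "bounded_linear (\<lambda>x::'b. (x, 0::'c))" and 2: "bounded_linear (\<lambda>x::'c. (0::'b, x))"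
    by (auto intro!: bounded_linear_intros)
  have "smooth_on S (\<lambda>x. (f x, 0) + (0, g x))"
    by (intro smooth_on_add smooth_on_bounded_linear[OF 1] smooth_on_bounded_linear[OF 2] assms)
  then show ?thesis by simp
qed

lemma smooth_on_Complex [smooth_intros]:
  assumes "open S" "smooth_on S f" "smooth_on S g"
  shows "smooth_on S (\<lambda>x. Complex (f x) (g x))"
  unfolding Complex_eq by (intro smooth_intros assms)

section \<open>Smooth inverses\<close>

lemma linear_eq_sum_Basis:
  fixes L :: "'a::euclidean_space \<Rightarrow> 'b::real_vector"
  assumes "linear L"
  shows "L u = (\<Sum>b\<in>Basis. (u \<bullet> b) *\<^sub>R L b)"
proof -
  have "L (\<Sum>b\<in>Basis. (u \<bullet> b) *\<^sub>R b) = (\<Sum>b\<in>Basis. (u \<bullet> b) *\<^sub>R L b)"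
    by (simp only: linear_sum[OF assms] linear_scale[OF assms])
  then show ?thesis
    by (simp only: euclidean_representation)
qed

text \<open>Near a zero of \<open>f\<close> the error \<open>(c y - c x) *\<^sub>R f y\<close> is a
  null factor times a term of order \<open>norm (y - x)\<close>, so mere continuity of
  \<open>c\<close> is enough. The factor will come from an inverse operator whose differentiability
  is still to be shown.\<close>

lemma has_derivative_scaleR_vanishing:
  fixes f :: "'a::real_normed_vector \<Rightarrow> 'b::real_normed_vector"
  assumes c: "continuous (at x) c" and f: "(f has_derivative f') (at x)" and "f x = 0"
  shows "((\<lambda>y. c y *\<^sub>R f y) has_derivative (\<lambda>v. c x *\<^sub>R f' v)) (at x)"
proof -
  have 1: "((\<lambda>y. c x *\<^sub>R f y) has_derivative (\<lambda>v. c x *\<^sub>R f' v)) (at x)"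
    using f by (auto intro!: derivative_eq_intros)
  have "((\<lambda>y. (c y - c x) *\<^sub>R f y) has_derivative (\<lambda>v. 0)) (at x)"
  proof -
    obtain K where K: "K > 0" "\<And>v. norm (f' v) \<le> norm v * K"
      using f has_derivative_bounded_linear bounded_linear.pos_bounded by metis
    have "((\<lambda>y. norm (f y - f x - f' (y - x)) / norm (y - x)) \<longlongrightarrow> 0) (at x)"
      using f by (simp add: has_derivative_iff_norm)
    then have lim: "((\<lambda>y. norm (c y - c x) * (norm (f y - f x - f' (y - x)) / norm (y - x) + K)) \<longlongrightarrow> 0 * (0 + K)) (at x)"
      using c by (intro tendsto_mult tendsto_add tendsto_const tendsto_norm_zero) (simp_all add: continuous_at LIM_zero)
    have "((\<lambda>y. norm ((c y - c x) *\<^sub>R f y) / norm (y - x)) \<longlongrightarrow> 0) (at x)"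
    proof (rule tendsto_sandwich[OF _ _ tendsto_const])
      show "eventually (\<lambda>y. norm ((c y - c x) *\<^sub>R f y) / norm (y - x)
         \<le> norm (c y - c x) * (norm (f y - f x - f' (y - x)) / norm (y - x) + K)) (at x)"
      proof (rule eventually_mono[OF eventually_at_ball'[OF zero_less_one]])
        fix y assume "y \<in> ball x 1 \<and> y \<noteq> x \<and> y \<in> UNIV"
        then have y: "norm (y - x) > 0" by auto
        have "norm (f y) \<le> norm (f y - f x - f' (y - x)) + norm (f' (y - x))"
          using norm_triangle_ineq[of "f y - f x - f' (y - x)" "f' (y - x)"] assms(3) by simp
        also have "\<dots> \<le> norm (f y - f x - f' (y - x)) + norm (y - x) * K"
          using K by simp
        also have "\<dots> = (norm (f y - f x - f' (y - x)) / norm (y - x) + K) * norm (y - x)"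
          using y by (simp add: field_simps)
        finally have "norm (f y) / norm (y - x) \<le> norm (f y - f x - f' (y - x)) / norm (y - x) + K"
          using y by (simp add: divide_le_eq)
        then have "norm (c y - c x) * (norm (f y) / norm (y - x))
          \<le> norm (c y - c x) * (norm (f y - f x - f' (y - x)) / norm (y - x) + K)"
          by (intro mult_left_mono) auto
        then show "norm ((c y - c x) *\<^sub>R f y) / norm (y - x)
         \<le> norm (c y - c x) * (norm (f y - f x - f' (y - x)) / norm (y - x) + K)"
          by simp
      qed
      show "((\<lambda>y. norm (c y - c x) * (norm (f y - f x - f' (y - x)) / norm (y - x) + K)) \<longlongrightarrow> 0) (at x)"
        using lim by simp
    qed auto
    then show ?thesis
      using assms(3) by (simp add: has_derivative_iff_norm)
  qed
  from has_derivative_add[OF 1 this] show ?thesis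
    by (simp add: algebra_simps)
qed


text \<open>Rests on the resolvent identity \<open>m y - m x = m x (L x - L y) m y\<close>, which
  bounds the change of \<open>m y v\<close> by a constant times \<open>norm (m y v)\<close> times
  the small quantity \<open>d y\<close>.\<close>

lemma linear_family_inverse_continuous:
  fixes L m :: "'y::real_normed_vector \<Rightarrow> 'a::euclidean_space \<Rightarrow> 'a"
  assumes S: "open S" "x \<in> S" and lin: "\<And>y. y \<in> S \<Longrightarrow> linear (L y)" and linm: "linear (m x)"
    and Lm: "\<And>y v. y \<in> S \<Longrightarrow> L y (m y v) = v" and mL: "\<And>v. m x (L x v) = v"
    and cont: "\<And>b. continuous (at x) (\<lambda>y. L y b)"
  shows "continuous (at x) (\<lambda>y. m y v)"
proof -
  define d where "d y = (\<Sum>b\<in>Basis. norm (L y b - L x b))" for y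
  have d_bound: "norm (L y u - L x u) \<le> norm u * d y" if "y \<in> S" for y u
  proof -
    have "L y u - L x u = (\<Sum>b\<in>Basis. (u \<bullet> b) *\<^sub>R (L y b - L x b))"
      using linear_eq_sum_Basis[OF lin[OF that], of u] linear_eq_sum_Basis[OF lin[OF S(2)], of u]
      by (simp add: scaleR_diff_right sum_subtractf)
    also have "norm \<dots> \<le> (\<Sum>b\<in>Basis. norm u * norm (L y b - L x b))"
      by (intro sum_norm_le) (auto intro!: mult_right_mono Basis_le_norm)
    finally show ?thesis
      by (simp add: d_def sum_distrib_left)
  qed
  have "(d \<longlongrightarrow> (\<Sum>b\<in>(Basis::'a set). 0)) (at x)"
    unfolding d_def
    by (intro tendsto_sum tendsto_norm_zero LIM_zero) (use cont in \<open>auto simp: continuous_at\<close>)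
  then have d0: "(d \<longlongrightarrow> 0) (at x)" by simp
  obtain K where K: "K > 0" "\<And>v. norm (m x v) \<le> norm v * K"
    using linm linear_conv_bounded_linear bounded_linear.pos_bounded by metis
  have step: "norm (m y v - m x v) \<le> K * (norm (m y v) * d y)" if "y \<in> S" for y
  proof -
    have "m y v - m x v = m x (L x (m y v) - L y (m y v))"
      using mL Lm[OF that] by (simp add: linear_diff[OF linm])
    also have "norm \<dots> \<le> norm (L x (m y v) - L y (m y v)) * K"
      by (rule K)
    also have "\<dots> \<le> (norm (m y v) * d y) * K"
      using d_bound[OF that, of "m y v"] K(1) by (intro mult_right_mono) (auto simp: norm_minus_commute)
    finally show ?thesis by (simp add: mult.commute)
  qed
  \<comment> \<open>The threshold \<open>1 / (2 * K)\<close> lets half of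
    \<open>norm (m y v)\<close> be absorbed, so that it is at most twice
    \<open>norm (m x v)\<close>; no bound on \<open>m y\<close> has to be known beforehand.\<close>
  have ev: "eventually (\<lambda>y. y \<in> S \<and> d y < 1 / (2 * K)) (at x)"
  proof (rule eventually_conj)
    show "eventually (\<lambda>y. y \<in> S) (at x)"
      using S eventually_at_in_open' by blast
    show "eventually (\<lambda>y. d y < 1 / (2 * K)) (at x)"
      using d0 K(1) by (intro order_tendstoD(2)) auto
  qed
  have "((\<lambda>y. m y v - m x v) \<longlongrightarrow> 0) (at x)"
  proof (rule Lim_null_comparison)
    show "eventually (\<lambda>y. norm (m y v - m x v) \<le> K * (2 * norm (m x v) * d y)) (at x)"
      using ev
    proof (rule eventually_mono)
      fix y assume y: "y \<in> S \<and> d y < 1 / (2 * K)"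
      have dpos: "d y \<ge> 0" by (simp add: d_def sum_nonneg)
      have "K * d y \<le> 1 / 2"
        using y K(1) by (simp add: field_simps)
      then have "norm (m y v) * (K * d y) \<le> norm (m y v) * (1 / 2)"
        by (intro mult_left_mono) auto
      moreover have "norm (m y v) \<le> norm (m x v) + norm (m y v - m x v)"
        using norm_triangle_ineq[of "m x v" "m y v - m x v"] by simp
      ultimately have "norm (m y v) \<le> 2 * norm (m x v)"
        using step[of y] y by (simp add: mult.left_commute)
      then have "K * (norm (m y v) * d y) \<le> K * (2 * norm (m x v) * d y)"
        using K(1) dpos by (intro mult_left_mono mult_right_mono) auto
      then show "norm (m y v - m x v) \<le> K * (2 * norm (m x v) * d y)"
        using step[of y] y by auto
    qed
    have "((\<lambda>y. K * (2 * norm (m x v) * d y)) \<longlongrightarrow> K * (2 * norm (m x v) * 0)) (at x)"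
      by (intro tendsto_intros d0)
    then show "((\<lambda>y. K * (2 * norm (m x v) * d y)) \<longlongrightarrow> 0) (at x)" by simp
  qed
  then show ?thesis
    by (simp add: continuous_at LIM_zero_iff)
qed

text \<open>The resolvent identity turns \<open>m y v\<close> into a constant minus terms whose
  factor \<open>L y b - L x b\<close> vanishes at \<open>x\<close>. The other factor,
  \<open>m y v\<close> itself, is only known to be continuous, which
  \<open>has_derivative_scaleR_vanishing\<close> allows.\<close>

lemma linear_family_inverse_has_derivative:
  fixes L m :: "'y::real_normed_vector \<Rightarrow> 'a::euclidean_space \<Rightarrow> 'a"
  assumes S: "open S" "x \<in> S" and lin: "\<And>y. y \<in> S \<Longrightarrow> linear (L y)" and linm: "linear (m x)"
    and Lm: "\<And>y v. y \<in> S \<Longrightarrow> L y (m y v) = v" and mL: "\<And>v. m x (L x v) = v"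
    and der: "\<And>b. ((\<lambda>y. L y b) has_derivative L' b) (at x)"
  shows "((\<lambda>y. m y v) has_derivative (\<lambda>w. - (\<Sum>b\<in>Basis. (m x v \<bullet> b) *\<^sub>R m x (L' b w)))) (at x)"
proof -
  have cont: "continuous (at x) (\<lambda>y. m y v)"
    by (rule linear_family_inverse_continuous[where L = L and m = m, OF S lin linm Lm mL])
      (auto intro: has_derivative_continuous[OF der])
  have bm: "bounded_linear (m x)"
    using linm by (simp add: linear_conv_bounded_linear)
  have eq: "m x v - (\<Sum>b\<in>Basis. (m y v \<bullet> b) *\<^sub>R m x (L y b - L x b)) = m y v" if "y \<in> S" for y
  proof -
    have "(\<Sum>b\<in>Basis. (m y v \<bullet> b) *\<^sub>R m x (L y b - L x b))
      = m x ((\<Sum>b\<in>Basis. (m y v \<bullet> b) *\<^sub>R L y b) - (\<Sum>b\<in>Basis. (m y v \<bullet> b) *\<^sub>R L x b))"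
      by (simp only: linear_sum[OF linm] linear_scale[OF linm] linear_diff[OF linm] scaleR_diff_right sum_subtractf)
    also have "\<dots> = m x (L y (m y v) - L x (m y v))"
      using linear_eq_sum_Basis[OF lin[OF that], of "m y v"] linear_eq_sum_Basis[OF lin[OF S(2)], of "m y v"]
      by simp
    also have "\<dots> = m x v - m y v"
      using Lm[OF that] mL by (simp add: linear_diff[OF linm])
    finally show ?thesis by simp
  qed
  have "((\<lambda>y. m x v - (\<Sum>b\<in>Basis. (m y v \<bullet> b) *\<^sub>R m x (L y b - L x b))) has_derivative
      (\<lambda>w. 0 - (\<Sum>b\<in>Basis. (m x v \<bullet> b) *\<^sub>R m x (L' b w)))) (at x)"
  proof (intro has_derivative_diff has_derivative_const has_derivative_sum has_derivative_scaleR_vanishing)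
    show "continuous (at x) (\<lambda>y. m y v \<bullet> b)" for b
      using cont by (intro continuous_intros)
    show "((\<lambda>y. m x (L y b - L x b)) has_derivative (\<lambda>w. m x (L' b w))) (at x)" for b
      using has_derivative_diff[OF der[of b] has_derivative_const, of "L x b"]
      by (intro bounded_linear.has_derivative[OF bm]) simp
    show "m x (L x b - L x b) = 0" for b
      using linear_0[OF linm] by simp
  qed
  then have "((\<lambda>y. m y v) has_derivative (\<lambda>w. 0 - (\<Sum>b\<in>Basis. (m x v \<bullet> b) *\<^sub>R m x (L' b w)))) (at x)"
    by (rule has_derivative_transform_within_open[OF _ S]) (rule eq)
  then show ?thesis by simp
qed

lemma Ck_linear_family_inverse:
  fixes L m :: "'y::real_normed_vector \<Rightarrow> 'a::euclidean_space \<Rightarrow> 'a"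
  assumes S: "open S" and lin: "\<And>y. y \<in> S \<Longrightarrow> linear (L y)" and linm: "\<And>y. y \<in> S \<Longrightarrow> linear (m y)"
    and Lm: "\<And>y v. y \<in> S \<Longrightarrow> L y (m y v) = v" and mL: "\<And>y v. y \<in> S \<Longrightarrow> m y (L y v) = v"
    and Ck: "\<And>b. Ck n S (\<lambda>y. L y b)"
  shows "Ck n S (\<lambda>y. m y v)"
  using Ck
proof (induction n arbitrary: v)
  case 0
  have "continuous (at x) (\<lambda>y. m y v)" if "x \<in> S" for x
    by (rule linear_family_inverse_continuous[where L = L and m = m, OF S that lin linm[OF that] Lm mL[OF that]])
      (use 0 that S in \<open>auto simp: continuous_on_eq_continuous_at\<close>)
  then show ?case by (simp add: continuous_at_imp_continuous_on)
next
  case (Suc n)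
  let ?L' = "\<lambda>y b. frechet_derivative (\<lambda>y. L y b) (at y)"
  have IH: "Ck n S (\<lambda>y. m y v)" for v
    by (rule Suc.IH) (rule Ck_Suc_imp_Ck[OF Suc.prems])
  show ?case
  proof (rule Ck_SucI[OF S])
    show "((\<lambda>y. m y v) has_derivative (\<lambda>w. - (\<Sum>b\<in>Basis. (m x v \<bullet> b) *\<^sub>R m x (?L' x b w)))) (at x)"
      if "x \<in> S" for x
      by (rule linear_family_inverse_has_derivative[where L = L and m = m, OF S that lin linm[OF that] Lm mL[OF that]])
        (use Ck_SucD(1)[OF Suc.prems that] in auto)
    fix w
    \<comment> \<open>The argument of the outer \<open>m y\<close> moves with \<open>y\<close>;
      expanding it over \<open>Basis\<close> leaves only values at fixed vectors, as the induction
      hypothesis wants.\<close>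
    have "Ck n S (\<lambda>y. - (\<Sum>b\<in>Basis. (m y v \<bullet> b) *\<^sub>R (\<Sum>c\<in>Basis. (?L' y b w \<bullet> c) *\<^sub>R m y c)))"
      by (intro Ck_bounded_linear_compose[OF bounded_linear_minus[OF bounded_linear_ident]] Ck_sum S
          Ck_bilinear[OF bounded_bilinear_scaleR] Ck_bounded_linear_compose[OF bounded_linear_inner_left]
          IH Ck_SucD(2)[OF Suc.prems])
    then show "Ck n S (\<lambda>y. - (\<Sum>b\<in>Basis. (m y v \<bullet> b) *\<^sub>R m y (?L' y b w)))"
    proof (rule Ck_cong[OF S, rotated])
      fix y assume "y \<in> S"
      then show "- (\<Sum>b\<in>Basis. (m y v \<bullet> b) *\<^sub>R (\<Sum>c\<in>Basis. (?L' y b w \<bullet> c) *\<^sub>R m y c))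
          = - (\<Sum>b\<in>Basis. (m y v \<bullet> b) *\<^sub>R m y (?L' y b w))"
        by (simp add: linear_eq_sum_Basis[OF linm, symmetric])
    qed
  qed
qed

text \<open>The C1 inverse function theorem supplies \<open>g\<close> and its derivative, the
  inverse of the derivative of \<open>f\<close> at \<open>g y\<close>. If \<open>g\<close> is of
  class \<open>n\<close>, so is that family of linear maps and with it the family of inverses, so
  \<open>g\<close> gains an order at each step.\<close>

theorem smooth_local_inverse:
  fixes f :: "'a::euclidean_space \<Rightarrow> 'a"
  assumes S: "open S" and f: "smooth_on S f" and x0: "x0 \<in> S"
    and inj: "\<And>v. frechet_derivative f (at x0) v = 0 \<Longrightarrow> v = 0"
  obtains W V g where "open W" "x0 \<in> W" "W \<subseteq> S" "open V" "f x0 \<in> V" "homeomorphism W V f g" "smooth_on V g"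
proof -
  define f' where "f' x = Blinfun (frechet_derivative f (at x))" for x
  have der: "(f has_derivative frechet_derivative f (at x)) (at x)" if "x \<in> S" for x
    by (rule smooth_on_has_derivative[OF f that])
  have ap: "blinfun_apply (f' x) = frechet_derivative f (at x)" if "x \<in> S" for x
    unfolding f'_def using has_derivative_bounded_linear[OF der[OF that]]
    by (simp add: bounded_linear_Blinfun_apply)
  have cf: "continuous_on S f'"
  proof (rule continuous_on_blinfun_componentwise)
    fix b :: 'a
    show "continuous_on S (\<lambda>x. blinfun_apply (f' x) b)"
      using smooth_on_imp_continuous_on[OF smooth_on_frechet[OF f, of b]]
      by (simp add: ap cong: continuous_on_cong)
  qed
  have l0: "linear (frechet_derivative f (at x0))"
    using der[OF x0] has_derivative_linear by blast
  have "inj (frechet_derivative f (at x0))"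
    using l0 inj by (simp add: linear_injective_0)
  then obtain h where h: "linear h" "\<And>v. h (frechet_derivative f (at x0) v) = v"
    using linear_injective_left_inverse[OF l0] by (metis comp_apply id_apply)
  have bh: "blinfun_apply (Blinfun h) = h"
    using h(1) by (simp add: bounded_linear_Blinfun_apply linear_conv_bounded_linear)
  have inv: "Blinfun h o\<^sub>L f' x0 = id_blinfun"
    by (rule blinfun_eqI) (simp add: bh ap[OF x0] h(2))
  obtain U V g g' where U: "open U" "U \<subseteq> S" "x0 \<in> U" and V: "open V" "f x0 \<in> V"
    and hom: "homeomorphism U V f g"
    and derg: "\<And>y. y \<in> V \<Longrightarrow> (g has_derivative (g' y)) (at y)"
    and g': "\<And>y. y \<in> V \<Longrightarrow> g' y = Hilbert_Choice.inv (blinfun_apply (f' (g y)))"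
    and bij: "\<And>y. y \<in> V \<Longrightarrow> bij (blinfun_apply (f' (g y)))"
  proof (rule inverse_function_theorem[OF S _ cf x0 inv])
    show "(f has_derivative blinfun_apply (f' x)) (at x)" if "x \<in> S" for x
      using der that by (simp add: ap)
  qed blast
  have gU: "g y \<in> U" "g y \<in> S" if "y \<in> V" for y
    using hom that U(2) by (auto simp: homeomorphism_def)
  let ?L = "\<lambda>y. frechet_derivative f (at (g y))"
  have apV: "blinfun_apply (f' (g y)) = ?L y" if "y \<in> V" for y
    using ap gU that by blast
  have Lg: "?L y (g' y v) = v" "g' y (?L y v) = v" if "y \<in> V" for y v
    using bij[OF that] g'[OF that] apV[OF that]
    by (auto simp: bij_is_surj surj_f_inv_f bij_is_inj)
  have "Ck n V g" for n
  proof (induction n)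
    case 0
    then show ?case using hom by (auto simp: homeomorphism_def)
  next
    case (Suc n)
    show ?case
    proof (rule Ck_SucI[OF V(1) derg])
      fix v
      show "Ck n V (\<lambda>y. g' y v)"
      proof (rule Ck_linear_family_inverse[where L = ?L and m = g', OF V(1)])
        show "linear (?L y)" if "y \<in> V" for y
          using der gU that has_derivative_linear by blast
        show "linear (g' y)" if "y \<in> V" for y
          by (rule has_derivative_linear[OF derg[OF that]])
        show "Ck n V (\<lambda>y. frechet_derivative f (at (g y)) b)" for b
        proof (rule Ck_compose[where f = "\<lambda>x. frechet_derivative f (at x) b" and g = g, OF V(1) S])
          show "Ck n S (\<lambda>x. frechet_derivative f (at x) b)"
            using smooth_on_frechet[OF f] by (simp add: smooth_on_def)
          show "g ` V \<subseteq> S" using gU by blast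
        qed (rule Suc)
      qed (use Lg in auto)
    qed
  qed
  then have "smooth_on V g" by (simp add: smooth_on_def)
  then show ?thesis
    using that U V hom by blast
qed

lemma homeomorphism_smooth_imp_diffeo_on:
  assumes "open W" "open V" "homeomorphism W V f g" "smooth_on W f" "smooth_on V g"
  shows "diffeo_on f W V"
proof -
  have fg: "\<And>x. x \<in> W \<Longrightarrow> g (f x) = x" "f ` W = V" "g ` V = W" "\<And>y. y \<in> V \<Longrightarrow> f (g y) = y"
    using assms(3) by (auto simp: homeomorphism_def)
  have bij: "bij_betw f W V"
    using fg by (metis bij_betw_def inj_on_inverseI)
  have "smooth_on V (inv_into W f)"
  proof (rule smooth_on_cong[OF assms(5,2)])
    fix y assume "y \<in> V"
    then show "g y = inv_into W f y"
      using fg bij by (metis bij_betw_inv_into_left image_eqI)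
  qed
  then show ?thesis
    using assms bij by (auto simp: diffeo_on_def)
qed

text \<open>The map \<open>(x, y) \<mapsto> (G (x, y), y)\<close> is locally invertible, and
  \<open>h\<close> is the first component of its inverse on the slice \<open>G = 0\<close>.\<close>

theorem smooth_implicit_function:
  fixes G :: "'a::euclidean_space \<times> 'b::euclidean_space \<Rightarrow> 'a"
  assumes S: "open S" and G: "smooth_on S G" and x0: "(x0, y0) \<in> S" "G (x0, y0) = 0"
    and inj: "\<And>v. frechet_derivative G (at (x0, y0)) (v, 0) = 0 \<Longrightarrow> v = 0"
  obtains A B h where "open A" "x0 \<in> A" "open B" "y0 \<in> B" "A \<times> B \<subseteq> S" "smooth_on B h" "h y0 = x0"
    "\<And>y. y \<in> B \<Longrightarrow> h y \<in> A \<and> G (h y, y) = 0"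
    "\<And>x y. x \<in> A \<Longrightarrow> y \<in> B \<Longrightarrow> G (x, y) = 0 \<Longrightarrow> x = h y"
proof -
  define f where "f z = (G z, snd z)" for z
  have sf: "smooth_on S f"
    unfolding f_def by (intro smooth_intros S G)
  have dG: "(G has_derivative frechet_derivative G (at (x0, y0))) (at (x0, y0))"
    by (rule smooth_on_has_derivative[OF G x0(1)])
  have "(f has_derivative (\<lambda>v. (frechet_derivative G (at (x0, y0)) v, snd v))) (at (x0, y0))"
    unfolding f_def by (intro has_derivative_Pair dG bounded_linear.has_derivative[OF bounded_linear_snd] has_derivative_ident)
  then have df: "frechet_derivative f (at (x0, y0)) = (\<lambda>v. (frechet_derivative G (at (x0, y0)) v, snd v))"
    by (metis frechet_derivative_at)
  have "v = 0" if "frechet_derivative f (at (x0, y0)) v = 0" for v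
    using that inj[of "fst v"] by (cases v) (auto simp: df zero_prod_def)
  from smooth_local_inverse[OF S sf x0(1) this]
  obtain W V g where W: "open W" "(x0, y0) \<in> W" "W \<subseteq> S" and V: "open V" "f (x0, y0) \<in> V"
    and hom: "homeomorphism W V f g" and g: "smooth_on V g" by blast
  have gf: "g (f x) = x" if "x \<in> W" for x
    using hom that by (auto simp: homeomorphism_def)
  have fg: "f (g y) = y" "g y \<in> W" if "y \<in> V" for y
    using hom that by (auto simp: homeomorphism_def)
  obtain A B1 where A: "open A" "x0 \<in> A" and B1: "open B1" "y0 \<in> B1" and AB: "A \<times> B1 \<subseteq> W"
    using open_prod_elim[OF W(1,2)] by (metis mem_Sigma_iff)
  define h where "h y = fst (g (0, y))" for y
  define B2 where "B2 = {y. (0, y) \<in> V}"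
  have B2: "open B2"
  proof -
    have "open ((\<lambda>y. (0, y)) -` V)"
      by (intro open_vimage V(1) continuous_intros)
    then show ?thesis by (simp add: B2_def vimage_def)
  qed
  have sh: "smooth_on B2 h"
    unfolding h_def
    by (intro smooth_on_fst B2 smooth_on_compose[OF g V(1) B2] smooth_intros) (auto simp: B2_def)
  have y0: "y0 \<in> B2" "h y0 = x0"
    using V(2) gf[OF W(2)] x0(2) by (auto simp: B2_def h_def f_def)
  \<comment> \<open>\<open>B1\<close> keeps the box inside \<open>W\<close>, where \<open>f\<close>
    is injective, which gives uniqueness of the root; the preimage of \<open>A\<close> makes the
    root found by \<open>h\<close> lie in the same box.\<close>
  define B where "B = B1 \<inter> (h -` A \<inter> B2)"
  have B: "open B" "y0 \<in> B"
    unfolding B_def using A B1 B2 y0 continuous_on_open_vimage[OF B2, of h] smooth_on_imp_continuous_on[OF sh]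
    by auto
  have gy: "g (0, y) = (h y, y) \<and> G (h y, y) = 0" if "y \<in> B2" for y
    using fg(1)[of "(0, y)"] that by (cases "g (0, y)") (auto simp: B2_def h_def f_def)
  show ?thesis
  proof (rule that[OF A B])
    show "A \<times> B \<subseteq> S" using AB W(3) by (auto simp: B_def)
    show "smooth_on B h" by (rule smooth_on_subset[OF sh]) (auto simp: B_def)
    show "h y0 = x0" by (rule y0)
    show "h y \<in> A \<and> G (h y, y) = 0" if "y \<in> B" for y
      using that gy by (auto simp: B_def)
    show "x = h y" if "x \<in> A" "y \<in> B" "G (x, y) = 0" for x y
    proof -
      have "(x, y) \<in> W" using that AB by (auto simp: B_def)
      from gf[OF this] that(3) show ?thesis by (simp add: f_def h_def)
    qed
  qed
qed

section \<open>Parametric integrals\<close>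

text \<open>Differentiation under the integral sign, repeated. \<open>W\<close> is an open
  neighbourhood because \<open>Ck\<close> uses full derivatives, also at the endpoints
  \<open>a\<close> and \<open>b\<close>.\<close>

lemma Ck_integral:
  fixes K :: "real \<times> 'y::euclidean_space \<Rightarrow> 'c::banach"
  assumes W: "open W" and S: "open S" and sub: "{a..b} \<times> S \<subseteq> W" and K: "Ck n W K"
  shows "Ck n S (\<lambda>y. integral {a..b} (\<lambda>t. K (t, y)))"
  using K
proof (induction n arbitrary: K)
  case 0
  then have cK: "continuous_on W K"
    by simp
  have "continuous_on (S \<times> cbox a b) (\<lambda>(y, t). K (t, y))"
    unfolding split_beta
    by (rule continuous_on_compose2[OF cK]) (use sub in \<open>auto intro!: continuous_intros\<close>)
  from integral_continuous_on_param[OF this] show ?case by simp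
next
  case (Suc n)
  let ?D = "\<lambda>p v. frechet_derivative K (at p) (0, v)"
  have cK: "continuous_on W K"
    using Suc.prems by simp
  have dK: "((\<lambda>y. K (t, y)) has_derivative ?D (t, y)) (at y within T)" if "t \<in> {a..b}" "y \<in> S" for t y T
  proof -
    have "(K has_derivative frechet_derivative K (at (t, y))) (at (t, y))"
      using that sub by (intro Ck_SucD(1)[OF Suc.prems]) auto
    from has_derivative_compose[OF has_derivative_Pair[OF has_derivative_const has_derivative_ident] this]
    show ?thesis .
  qed
  have "Ck n S (\<lambda>y. integral {a..b} (\<lambda>t. ?D (t, y) v))" for v
    by (rule Suc.IH) (rule Ck_SucD(2)[OF Suc.prems])
  moreover have "((\<lambda>y. integral {a..b} (\<lambda>t. K (t, y))) has_derivative
      (\<lambda>v. integral {a..b} (\<lambda>t. ?D (t, y) v))) (at y)" if y: "y \<in> S" for y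
  proof -
    \<comment> \<open>Leibniz' rule is applied on a convex set, hence on a ball.\<close>
    obtain e where e: "e > 0" "ball y e \<subseteq> S"
      using S y open_contains_ball by blast
    define fx where "fx z t = Blinfun (?D (t, z))" for z t
    have ap: "blinfun_apply (fx z t) = ?D (t, z)" if "t \<in> {a..b}" "z \<in> S" for t z
      unfolding fx_def using has_derivative_bounded_linear[OF dK[OF that, of UNIV]]
      by (simp add: bounded_linear_Blinfun_apply)
    have cfx: "continuous_on (S \<times> cbox a b) (\<lambda>(z, t). fx z t)"
    proof (rule continuous_on_blinfun_componentwise)
      fix i :: 'y
      have cD: "continuous_on W (\<lambda>p. ?D p i)"
        using Ck_SucD(2)[OF Suc.prems] by (rule Ck_imp_continuous_on)
      have "continuous_on (S \<times> cbox a b) (\<lambda>p. ?D (snd p, fst p) i)"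
        by (rule continuous_on_compose2[OF cD]) (use sub in \<open>auto intro!: continuous_intros\<close>)
      then show "continuous_on (S \<times> cbox a b) (\<lambda>p. blinfun_apply (case p of (z, t) \<Rightarrow> fx z t) i)"
        by (rule continuous_on_eq) (auto simp: ap)
    qed
    have cfx1: "continuous_on (cbox a b) (fx y)"
    proof -
      have "continuous_on (cbox a b) (\<lambda>t. (y, t))"
        by (intro continuous_intros)
      from continuous_on_compose2[OF cfx this] y show ?thesis by auto
    qed
    have "((\<lambda>z. integral (cbox a b) (\<lambda>t. K (t, z))) has_derivative integral (cbox a b) (fx y)) (at y within ball y e)"
    proof (rule leibniz_rule[where f = "\<lambda>z t. K (t, z)"])
      show "((\<lambda>z. K (t, z)) has_derivative blinfun_apply (fx z t)) (at z within ball y e)"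
        if "z \<in> ball y e" "t \<in> cbox a b" for z t
        using dK[of t z] ap[of t z] that e by auto
      show "(\<lambda>t. K (t, z)) integrable_on cbox a b" if "z \<in> ball y e" for z
        by (intro integrable_continuous continuous_on_compose2[OF cK])
          (use that e sub in \<open>auto intro!: continuous_intros\<close>)
      show "continuous_on (ball y e \<times> cbox a b) (\<lambda>(z, t). fx z t)"
        using e by (intro continuous_on_subset[OF cfx]) auto
    qed (use e in auto)
    then have "((\<lambda>z. integral (cbox a b) (\<lambda>t. K (t, z))) has_derivative integral (cbox a b) (fx y)) (at y)"
      using at_within_open[of y "ball y e"] e by auto
    moreover have "blinfun_apply (integral (cbox a b) (fx y)) v = integral {a..b} (\<lambda>t. ?D (t, y) v)" for v
    proof -
      have "blinfun_apply (integral (cbox a b) (fx y)) v = integral (cbox a b) (\<lambda>t. blinfun_apply (fx y t) v)"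
        by (rule blinfun_apply_integral) (rule integrable_continuous[OF cfx1])
      also have "\<dots> = integral {a..b} (\<lambda>t. ?D (t, y) v)"
        unfolding cbox_interval by (rule integral_cong) (use ap y in auto)
      finally show ?thesis .
    qed
    then have "blinfun_apply (integral (cbox a b) (fx y)) = (\<lambda>v. integral {a..b} (\<lambda>t. ?D (t, y) v))"
      by (intro ext)
    ultimately show ?thesis by simp
  qed
  ultimately show ?case
    by (intro Ck_SucI[OF S])
qed

lemma smooth_on_integral:
  fixes K :: "real \<times> 'y::euclidean_space \<Rightarrow> 'c::banach"
  assumes "open W" and "open S" and "{a..b} \<times> S \<subseteq> W" and "smooth_on W K"
  shows "smooth_on S (\<lambda>y. integral {a..b} (\<lambda>t. K (t, y)))"
  using assms Ck_integral unfolding smooth_on_def by metis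

section \<open>Smooth families of holomorphic functions\<close>

text \<open>Cauchy integrals need a complex first argument; the parameters stay real, and only
  smoothness is available in them.\<close>

definition hol_family :: "complex set \<Rightarrow> 'x::euclidean_space set \<Rightarrow> (complex \<times> 'x \<Rightarrow> complex) \<Rightarrow> bool" where
  "hol_family D B F \<longleftrightarrow> open D \<and> open B \<and> smooth_on (D \<times> B) F \<and> (\<forall>x\<in>B. (\<lambda>s. F (s, x)) holomorphic_on D)"

text \<open>The real derivative in direction 1 is the complex derivative where \<open>F\<close> is
  holomorphic; taken in this form, its joint smoothness with the parameters comes for free.\<close>

definition pds :: "(complex \<times> 'x::euclidean_space \<Rightarrow> complex) \<Rightarrow> complex \<times> 'x \<Rightarrow> complex" where
  "pds F y = frechet_derivative F (at y) (1, 0)"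

lemma hol_family_DERIV:
  assumes "hol_family D B F" "s \<in> D" "x \<in> B"
  shows "((\<lambda>s. F (s, x)) has_field_derivative pds F (s, x)) (at s)"
proof -
  have D: "open D" "open B" and hol: "(\<lambda>s. F (s, x)) holomorphic_on D" and F: "smooth_on (D \<times> B) F"
    using assms by (auto simp: hol_family_def)
  have "(F has_derivative frechet_derivative F (at (s, x))) (at (s, x))"
    using assms by (intro smooth_on_has_derivative[OF F]) auto
  from has_derivative_compose[OF has_derivative_Pair[OF has_derivative_ident has_derivative_const] this]
  have "((\<lambda>s. F (s, x)) has_derivative (\<lambda>v. frechet_derivative F (at (s, x)) (v, 0))) (at s)" .
  moreover have d: "((\<lambda>s. F (s, x)) has_derivative (\<lambda>v. deriv (\<lambda>s. F (s, x)) s * v)) (at s)"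
    using holomorphic_derivI[OF hol D(1) assms(2)] by (simp add: has_field_derivative_def)
  ultimately have "(\<lambda>v. frechet_derivative F (at (s, x)) (v, 0)) = (\<lambda>v. deriv (\<lambda>s. F (s, x)) s * v)"
    by (rule has_derivative_unique)
  then have "pds F (s, x) = deriv (\<lambda>s. F (s, x)) s"
    unfolding pds_def by (metis mult.right_neutral)
  then show ?thesis
    using holomorphic_derivI[OF hol D(1) assms(2)] by simp
qed

lemma hol_family_pds:
  assumes "hol_family D B F"
  shows "hol_family D B (pds F)"
proof -
  have "(\<lambda>s. pds F (s, x)) holomorphic_on D" if "x \<in> B" for x
  proof -
    have "deriv (\<lambda>s. F (s, x)) holomorphic_on D"
      using assms that by (auto simp: hol_family_def intro: holomorphic_deriv)
    then show ?thesis
      by (rule holomorphic_transform) (use hol_family_DERIV[OF assms _ that] in \<open>auto intro: DERIV_imp_deriv\<close>)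
  qed
  then show ?thesis
    using assms smooth_on_frechet unfolding hol_family_def pds_def by blast
qed

lemma hol_family_pds_pow: "hol_family D B F \<Longrightarrow> hol_family D B ((pds ^^ k) F)"
  by (induction k) (auto intro: hol_family_pds)

lemma higher_deriv_hol_family:
  assumes "hol_family D B F" "s \<in> D" "x \<in> B"
  shows "(deriv ^^ k) (\<lambda>s. F (s, x)) s = (pds ^^ k) F (s, x)"
  using assms(2)
proof (induction k arbitrary: s)
  case (Suc k)
  have "open D" using assms by (simp add: hol_family_def)
  then have "eventually (\<lambda>s. (deriv ^^ k) (\<lambda>s. F (s, x)) s = (pds ^^ k) F (s, x)) (nhds s)"
    using Suc by (auto simp: eventually_nhds)
  then have "deriv ((deriv ^^ k) (\<lambda>s. F (s, x))) s = deriv (\<lambda>s. (pds ^^ k) F (s, x)) s"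
    by (rule deriv_cong_ev) simp
  then show ?case
    using hol_family_DERIV[OF hol_family_pds_pow[OF assms(1)] Suc.prems assms(3)]
    by (simp add: DERIV_imp_deriv)
qed auto

section \<open>Division by a quartic\<close>

definition circ :: "real \<Rightarrow> real \<Rightarrow> complex" where
  "circ r t = of_real r * exp (2 * of_real pi * \<i> * of_real t)"

lemma circ_props [simp]: "norm (circ r t) = \<bar>r\<bar>" "circ r t = 0 \<longleftrightarrow> r = 0"
  by (auto simp: circ_def norm_mult)

lemma smooth_on_exp [smooth_intros]:
  fixes f :: "'a::real_normed_vector \<Rightarrow> complex"
  shows "open S \<Longrightarrow> smooth_on S f \<Longrightarrow> smooth_on S (\<lambda>x. exp (f x))"
  by (rule smooth_on_compose[OF smooth_on_holomorphic[OF holomorphic_on_exp open_UNIV] open_UNIV]) auto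

lemma smooth_circ: "open S \<Longrightarrow> smooth_on S f \<Longrightarrow> smooth_on S (\<lambda>x. circ r (f x))"
  unfolding circ_def by (intro smooth_intros)

lemma circ_eq: "circlepath 0 r t = circ r t"
  by (simp add: circlepath circ_def)

text \<open>The velocity of the circle is \<open>2 * pi * \<i>\<close> times its position; dividing
  by the constant leaves the extra factor \<open>circ r t\<close> that accompanies all integrands
  below.\<close>

lemma has_contour_integral_circ:
  assumes "(f has_contour_integral (2 * of_real pi * \<i> * I)) (circlepath 0 r)"
  shows "((\<lambda>t. f (circ r t) * circ r t) has_integral I) {0..1}"
proof -
  have "((\<lambda>t. f (circ r t) * (2 * of_real pi * \<i> * circ r t)) has_integral (2 * of_real pi * \<i> * I)) {0..1}"
    using assms unfolding has_contour_integral_def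
    by (rule has_integral_eq[rotated])
      (auto simp: vector_derivative_circlepath01 circ_eq circ_def mult_ac)
  from has_integral_mult_right[OF this, of "1 / (2 * of_real pi * \<i>)"]
  show ?thesis
    by (simp add: field_simps)
qed

lemma Cauchy_circ:
  assumes "f holomorphic_on ball 0 R" "0 < r" "r < R" "norm w < r"
  shows "((\<lambda>t. f (circ r t) / (circ r t - w) * circ r t) has_integral f w) {0..1}"
proof -
  have "((\<lambda>u. f u / (u - w)) has_contour_integral (2 * of_real pi * \<i> * f w)) (circlepath 0 r)"
    by (rule Cauchy_integral_circlepath_simple) (use assms in \<open>auto elim: holomorphic_on_subset\<close>)
  from has_contour_integral_circ[OF this] show ?thesis .
qed

lemma Cauchy_circ_higher:
  assumes "f holomorphic_on ball 0 R" "0 < r" "r < R"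
  shows "((\<lambda>t. f (circ r t) / circ r t ^ Suc k * circ r t) has_integral ((deriv ^^ k) f 0 / fact k)) {0..1}"
proof -
  have h: "f holomorphic_on cball 0 r"
    using assms by (auto elim: holomorphic_on_subset)
  have "continuous_on (cball 0 r) f" "f holomorphic_on ball 0 r" "0 \<in> ball (0::complex) r"
    using assms h by (auto intro: holomorphic_on_imp_continuous_on holomorphic_on_subset)
  from Cauchy_has_contour_integral_higher_derivative_circlepath[OF this, of k]
  have "((\<lambda>u. f u / u ^ Suc k) has_contour_integral (2 * of_real pi * \<i> * ((deriv ^^ k) f 0 / fact k))) (circlepath 0 r)"
    by simp
  from has_contour_integral_circ[OF this] show ?thesis .
qed

type_synonym quad = "real \<times> real \<times> real \<times> real"

definition qc :: "quad \<Rightarrow> real" where "qc a = fst a"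
definition q2 :: "quad \<Rightarrow> real" where "q2 a = fst (snd a)"
definition q1 :: "quad \<Rightarrow> real" where "q1 a = fst (snd (snd a))"
definition q0 :: "quad \<Rightarrow> real" where "q0 a = snd (snd (snd a))"

lemma quad_linear [simp]:
  "qc 0 = 0" "q2 0 = 0" "q1 0 = 0" "q0 0 = 0"
  "qc (t *\<^sub>R v) = t * qc v" "q2 (t *\<^sub>R v) = t * q2 v" "q1 (t *\<^sub>R v) = t * q1 v" "q0 (t *\<^sub>R v) = t * q0 v"
  "bounded_linear qc" "bounded_linear q2" "bounded_linear q1" "bounded_linear q0"
  unfolding qc_def q2_def q1_def q0_def by (auto intro!: bounded_linear_intros)

lemma quad_eq_0: "qc v = 0 \<Longrightarrow> q2 v = 0 \<Longrightarrow> q1 v = 0 \<Longrightarrow> q0 v = 0 \<Longrightarrow> v = 0"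
  by (cases v) (auto simp: qc_def q2_def q1_def q0_def zero_prod_def)

lemmas smooth_quad [smooth_intros] =
  smooth_on_bounded_linear[OF quad_linear(9)] smooth_on_bounded_linear[OF quad_linear(10)]
  smooth_on_bounded_linear[OF quad_linear(11)] smooth_on_bounded_linear[OF quad_linear(12)]

text \<open>A quartic without cubic term in the shifted variable \<open>w + c\<close>; every monic quartic has this form.\<close>

definition quartic :: "quad \<Rightarrow> 'f::real_normed_field \<Rightarrow> 'f" where
  "quartic a w = (w + of_real (qc a)) ^ 4 + of_real (q2 a) * (w + of_real (qc a)) ^ 2
      + of_real (q1 a) * (w + of_real (qc a)) + of_real (q0 a)"

lemma quartic_of_real: "quartic a (of_real w) = of_real (quartic a w)"
  by (simp add: quartic_def)

lemma quartic_0 [simp]: "quartic 0 w = w ^ 4"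
  by (simp add: quartic_def)

text \<open>With \<open>y = s + c\<close> and \<open>v = w + c\<close>, the divided difference of
  the quartic is a cubic polynomial in \<open>v\<close>; \<open>dq j\<close> is its coefficient at
  \<open>v ^ j\<close>.\<close>

definition dq :: "nat \<Rightarrow> quad \<Rightarrow> complex \<Rightarrow> complex" where
  "dq j a s = (let y = s + of_real (qc a) in
     if j = 3 then 1 else if j = 2 then y else if j = 1 then y ^ 2 + of_real (q2 a)
     else y ^ 3 + of_real (q2 a) * y + of_real (q1 a))"

lemma quartic_difference:
  "quartic a s - quartic a w = (s - w) * (\<Sum>j<4. (w + of_real (qc a)) ^ j * dq j a s)"
  unfolding quartic_def dq_def Let_def
  by (simp add: eval_nat_numeral algebra_simps)

lemma dq_0: "j < 4 \<Longrightarrow> dq j 0 s = s ^ (3 - j)"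
  by (auto simp: dq_def Let_def less_Suc_eq numeral_eq_Suc)

text \<open>For \<open>a = 0\<close> the quartic is \<open>s ^ 4\<close>, which has no zero on the
  circle; compactness of the circle extends this to all small \<open>a\<close> by the tube
  lemma.\<close>

lemma quartic_nonzero_near_circle:
  assumes "r > 0"
  obtains d where "d > 0" "\<And>a (s::complex). a \<in> ball 0 d \<Longrightarrow> norm s = r \<Longrightarrow> quartic a s \<noteq> 0"
proof -
  define W where "W = {p :: quad \<times> complex. quartic (fst p) (snd p) \<noteq> 0}"
  have c: "continuous_on UNIV (\<lambda>p :: quad \<times> complex. quartic (fst p) (snd p))"
    unfolding quartic_def qc_def q2_def q1_def q0_def by (intro continuous_intros)
  have "open W"
    unfolding W_def using open_Collect_neq[OF c continuous_on_const, of 0] by simp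
  moreover have "{0} \<times> sphere 0 r \<subseteq> W"
    using assms by (auto simp: W_def)
  ultimately obtain X0 where X0: "0 \<in> X0" "open X0" "X0 \<times> sphere 0 r \<subseteq> W"
    using Elementary_Topology.tube_lemma[OF compact_sphere] by metis
  then obtain d where d: "d > 0" "ball 0 d \<subseteq> X0"
    using open_contains_ball by blast
  show ?thesis
  proof (rule that[OF d(1)])
    fix a :: quad and s :: complex
    assume "a \<in> ball 0 d" "norm s = r"
    then have "(a, s) \<in> X0 \<times> sphere 0 r"
      using d(2) by auto
    then have "(a, s) \<in> W"
      using X0(3) by blast
    then show "quartic a s \<noteq> 0"
      by (simp add: W_def)
  qed
qed

lemma smooth_dq: "open S \<Longrightarrow> smooth_on S f \<Longrightarrow> smooth_on S g \<Longrightarrow> smooth_on S (\<lambda>x. dq j (f x) (g x))"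
  unfolding dq_def Let_def
  by (cases "j = 3"; cases "j = 2"; cases "j = 1") (simp_all, (intro smooth_intros; assumption)+)

lemma smooth_quartic:
  "open S \<Longrightarrow> smooth_on S f \<Longrightarrow> smooth_on S g \<Longrightarrow> smooth_on S (\<lambda>x. quartic (f x) (g x))"
  unfolding quartic_def by (intro smooth_intros)

text \<open>Integrating \<open>F(s)/(s - w)\<close> and splitting off \<open>(P(s) - P(w))/(s - w)\<close>, which is polynomial
  in \<open>w\<close>, divides \<open>F\<close> by the quartic \<open>P\<close>. Only real \<open>w\<close> are retained, so that taking real parts is
  compatible with the real quartic.\<close>

theorem division_by_quartic:
  fixes F :: "complex \<times> 'x::euclidean_space \<Rightarrow> complex"
  assumes F: "hol_family (ball 0 R) B F" and R: "R > 0"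
  obtains r d Q \<rho> where "r > 0" "r \<le> R" "d > 0"
    "smooth_on (ball 0 r \<times> ball 0 d \<times> B) (Q :: real \<times> quad \<times> 'x \<Rightarrow> real)"
    "\<And>j. smooth_on (ball 0 d \<times> B) (\<rho> j :: quad \<times> 'x \<Rightarrow> real)"
    "\<And>w a x. w \<in> ball 0 r \<Longrightarrow> a \<in> ball 0 d \<Longrightarrow> x \<in> B \<Longrightarrow>
       Re (F (of_real w, x)) = quartic a w * Q (w, a, x) + (\<Sum>j<4. (w + qc a) ^ j * \<rho> j (a, x))"
    "\<And>j x. j < 4 \<Longrightarrow> x \<in> B \<Longrightarrow> \<rho> j (0, x) = Re ((pds ^^ j) F (0, x)) / fact j"
    "\<And>x. x \<in> B \<Longrightarrow> Q (0, 0, x) = Re ((pds ^^ 4) F (0, x)) / fact 4"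
proof -
  define r where "r = R / 2"
  have r: "0 < r" "r < R" using R by (auto simp: r_def)
  obtain d where d: "d > 0" "\<And>a (s::complex). a \<in> ball 0 d \<Longrightarrow> norm s = r \<Longrightarrow> quartic a s \<noteq> 0"
    using quartic_nonzero_near_circle[OF r(1)] by blast
  have B: "open B" and sF: "smooth_on (ball 0 R \<times> B) F" and hF: "\<And>x. x \<in> B \<Longrightarrow> (\<lambda>s. F (s, x)) holomorphic_on ball 0 R"
    using F by (auto simp: hol_family_def)
  \<comment> \<open>Kernels of the quotient and of the remainder coefficients. Both have
    \<open>quartic a s\<close> in the denominator, which is why \<open>a\<close> is confined to
    \<open>ball 0 d\<close>; the real \<open>w\<close> stays inside the circle.\<close>
  define KQ where "KQ p = (case p of (t, w, a, x) \<Rightarrow>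
      F (circ r t, x) / (quartic a (circ r t) * (circ r t - of_real w)) * circ r t)" for p :: "real \<times> real \<times> quad \<times> 'x"
  define KR where "KR j p = (case p of (t, a, x) \<Rightarrow>
      F (circ r t, x) * dq j a (circ r t) / quartic a (circ r t) * circ r t)" for j and p :: "real \<times> quad \<times> 'x"
  define Q where "Q y = Re (integral {0..1} (\<lambda>t. KQ (t, y)))" for y
  define \<rho> where "\<rho> j y = Re (integral {0..1} (\<lambda>t. KR j (t, y)))" for j y
  let ?W = "UNIV \<times> ball 0 r \<times> ball 0 d \<times> B :: (real \<times> real \<times> quad \<times> 'x) set"
  let ?V = "UNIV \<times> ball 0 d \<times> B :: (real \<times> quad \<times> 'x) set"
  have W: "open ?W" "open ?V"
    by (intro open_Times B open_UNIV open_ball)+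
  have neq: "circ r t \<noteq> of_real w" if "w \<in> ball 0 r" for t w
    using that r circ_props(1)[of r t] by (metis abs_of_pos dist_0_norm less_irrefl mem_ball norm_of_real real_norm_def)
  have smF: "smooth_on ?W (\<lambda>p. F (circ r (fst p), snd (snd (snd p))))"
    by (rule smooth_on_compose[OF sF]) (auto intro!: smooth_intros smooth_circ open_Times B simp: r abs_of_pos)
  have smF': "smooth_on ?V (\<lambda>p. F (circ r (fst p), snd (snd p)))"
    by (rule smooth_on_compose[OF sF]) (auto intro!: smooth_intros smooth_circ open_Times B simp: r abs_of_pos)
  have sKQ: "smooth_on ?W KQ"
    unfolding KQ_def split_beta
    by (intro smooth_intros smooth_quartic smooth_circ smF W) (use d(2) r neq in auto)
  have sKR: "smooth_on ?V (KR j)" for j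
    unfolding KR_def split_beta
    by (intro smooth_intros smooth_quartic smooth_dq smooth_circ smF' W) (use d(2) r in auto)
  have sQ: "smooth_on (ball 0 r \<times> ball 0 d \<times> B) Q"
    unfolding Q_def
    by (intro smooth_on_Re smooth_on_integral[OF W(1) _ _ sKQ]) (auto intro!: open_Times B)
  have s\<rho>: "smooth_on (ball 0 d \<times> B) (\<rho> j)" for j
    unfolding \<rho>_def
    by (intro smooth_on_Re smooth_on_integral[OF W(2) _ _ sKR]) (auto intro!: open_Times B)
  have id: "Re (F (of_real w, x)) = quartic a w * Q (w, a, x) + (\<Sum>j<4. (w + qc a) ^ j * \<rho> j (a, x))"
    if w: "w \<in> ball 0 r" and a: "a \<in> ball 0 d" and x: "x \<in> B" for w a x
  proof -
    let ?q = "integral {0..1} (\<lambda>t. KQ (t, w, a, x))" and ?R = "\<lambda>j. integral {0..1} (\<lambda>t. KR j (t, a, x))"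
    have cQ: "continuous_on {0..1} (\<lambda>t. KQ (t, w, a, x))"
      by (rule continuous_on_compose2[OF smooth_on_imp_continuous_on[OF sKQ]])
        (use w a x in \<open>auto intro!: continuous_intros\<close>)
    have cR: "continuous_on {0..1} (\<lambda>t. KR j (t, a, x))" for j
      by (rule continuous_on_compose2[OF smooth_on_imp_continuous_on[OF sKR]])
        (use w a x in \<open>auto intro!: continuous_intros\<close>)
    have iQ: "((\<lambda>t. KQ (t, w, a, x)) has_integral ?q) {0..1}"
      using cQ by (simp add: integrable_continuous_interval integrable_integral)
    have iR: "((\<lambda>t. KR j (t, a, x)) has_integral ?R j) {0..1}" for j
      using cR by (simp add: integrable_continuous_interval integrable_integral)
    have "((\<lambda>t. quartic a (of_real w) * KQ (t, w, a, x) + (\<Sum>j<4. (of_real w + of_real (qc a)) ^ j * KR j (t, a, x)))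
       has_integral (quartic a (of_real w) * ?q + (\<Sum>j<4. (of_real w + of_real (qc a)) ^ j * ?R j))) {0..1}"
      by (intro has_integral_add has_integral_sum has_integral_mult_right iQ iR) auto
    moreover have "quartic a (of_real w) * KQ (t, w, a, x) + (\<Sum>j<4. (of_real w + of_real (qc a)) ^ j * KR j (t, a, x))
        = F (circ r t, x) / (circ r t - of_real w) * circ r t" for t
    proof -
      let ?s = "circ r t"
      have nz: "quartic a ?s \<noteq> 0" "?s - of_real w \<noteq> 0"
        using d(2)[OF a, of ?s] r neq[OF w, of t] by auto
      have "quartic a (of_real w) * KQ (t, w, a, x) + (\<Sum>j<4. (of_real w + of_real (qc a)) ^ j * KR j (t, a, x))
        = F (?s, x) * ?s / quartic a ?s * (quartic a (of_real w) / (?s - of_real w) +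
            (\<Sum>j<4. (of_real w + of_real (qc a)) ^ j * dq j a ?s))"
        by (simp add: KQ_def KR_def sum_distrib_left distrib_left mult_ac)
      also have "(\<Sum>j<4. (of_real w + of_real (qc a)) ^ j * dq j a ?s)
          = (quartic a ?s - quartic a (of_real w)) / (?s - of_real w)"
        using quartic_difference[of a ?s "of_real w"] nz by (simp add: field_simps)
      also have "F (?s, x) * ?s / quartic a ?s * (quartic a (of_real w) / (?s - of_real w) + \<dots>)
          = F (?s, x) / (?s - of_real w) * ?s"
        using nz by (simp add: field_simps flip: add_divide_distrib)
      finally show ?thesis .
    qed
    ultimately have "((\<lambda>t. F (circ r t, x) / (circ r t - of_real w) * circ r t)
       has_integral (quartic a (of_real w) * ?q + (\<Sum>j<4. (of_real w + of_real (qc a)) ^ j * ?R j))) {0..1}"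
      by simp
    moreover have "((\<lambda>t. F (circ r t, x) / (circ r t - of_real w) * circ r t) has_integral F (of_real w, x)) {0..1}"
      using Cauchy_circ[OF hF[OF x] r, of "of_real w"] w by simp
    ultimately have "F (of_real w, x) = quartic a (of_real w) * ?q + (\<Sum>j<4. (of_real w + of_real (qc a)) ^ j * ?R j)"
      using has_integral_unique by blast
    then have "Re (F (of_real w, x)) = Re (of_real (quartic a w) * ?q + (\<Sum>j<4. of_real ((w + qc a) ^ j) * ?R j))"
      by (simp add: quartic_of_real)
    also have "\<dots> = quartic a w * Re ?q + (\<Sum>j<4. (w + qc a) ^ j * Re (?R j))"
      by (simp only: plus_complex.sel Re_sum Re_complex_of_real Im_complex_of_real times_complex.sel mult_zero_left diff_zero)
    finally show ?thesis by (simp add: Q_def \<rho>_def)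
  qed
  have v\<rho>: "\<rho> j (0, x) = Re ((pds ^^ j) F (0, x)) / fact j" if j: "j < 4" and x: "x \<in> B" for j x
  proof -
    \<comment> \<open>For \<open>a = 0\<close> the factor \<open>s ^ (3 - j)\<close> over
      \<open>s ^ 4\<close> is the kernel of the Taylor coefficient of order
      \<open>j\<close>.\<close>
    have "KR j (t, 0, x) = F (circ r t, x) / circ r t ^ Suc j * circ r t" for t
    proof -
      have "circ r t ^ 4 = circ r t ^ (3 - j) * circ r t ^ Suc j"
        using j unfolding power_add[symmetric] by simp
      then show ?thesis
        using r j by (simp add: KR_def dq_0)
    qed
    then have "integral {0..1} (\<lambda>t. KR j (t, 0, x)) = (deriv ^^ j) (\<lambda>s. F (s, x)) 0 / fact j"
      using Cauchy_circ_higher[OF hF[OF x] r, of j] by (simp add: integral_unique)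
    then have "\<rho> j (0, x) = Re ((deriv ^^ j) (\<lambda>s. F (s, x)) 0 / of_real (fact j))"
      unfolding \<rho>_def of_real_fact by (rule arg_cong)
    then show ?thesis
      using higher_deriv_hol_family[OF F _ x, of 0 j] R
      by (simp only: Re_divide_of_real) simp
  qed
  have vQ: "Q (0, 0, x) = Re ((pds ^^ 4) F (0, x)) / fact 4" if x: "x \<in> B" for x
  proof -
    have "KQ (t, 0, 0, x) = F (circ r t, x) / circ r t ^ Suc 4 * circ r t" for t
      by (cases "circ r t = 0") (simp_all add: KQ_def field_simps eval_nat_numeral)
    then have "integral {0..1} (\<lambda>t. KQ (t, 0, 0, x)) = (deriv ^^ 4) (\<lambda>s. F (s, x)) 0 / fact 4"
      using Cauchy_circ_higher[OF hF[OF x] r, of 4] by (simp add: integral_unique del: power_Suc)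
    then have "Q (0, 0, x) = Re ((deriv ^^ 4) (\<lambda>s. F (s, x)) 0 / of_real (fact 4))"
      unfolding Q_def of_real_fact by (rule arg_cong)
    then show ?thesis
      using higher_deriv_hol_family[OF F _ x, of 0 4] R
      by (simp only: Re_divide_of_real) simp
  qed
  show ?thesis
    by (rule that[OF r(1) less_imp_le[OF r(2)] d(1) sQ s\<rho> id v\<rho> vQ])
qed

section \<open>A preparation theorem for unfoldings of order four\<close>

text \<open>The equation is only available off 0, having been divided by a power of
  \<open>w\<close>; the value of \<open>p\<close> is recovered as a limit.\<close>

lemma zero_of_order_one:
  fixes p :: real
  assumes r: "r > 0" and eq: "\<And>w. w \<noteq> 0 \<Longrightarrow> \<bar>w\<bar> < r \<Longrightarrow> p + w * g w = w * h w"
    and g: "isCont g 0" and h: "isCont h 0"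
  shows "p = 0"
proof -
  have lim: "((\<lambda>w. w * h w - w * g w) \<longlongrightarrow> 0 * h 0 - 0 * g 0) (at 0)"
    using g h by (intro tendsto_intros) (auto simp: isCont_def)
  have ev: "eventually (\<lambda>w. w * h w - w * g w = p) (at 0)"
    unfolding eventually_at using r eq by (intro exI[of _ r]) (auto simp: dist_real_def algebra_simps)
  have "((\<lambda>w. p) \<longlongrightarrow> 0 * h 0 - 0 * g 0) (at (0::real))"
    by (rule Lim_transform_eventually[OF lim ev])
  from LIM_unique[OF tendsto_const this] show ?thesis by simp
qed

text \<open>Dividing successively by \<open>w\<close> strips off one coefficient after the other.
  This will give the uniqueness of the quartic factor to first order in its coefficients.\<close>

lemma cubic_of_order_four:
  fixes p0 :: real
  assumes r: "r > 0" and h: "isCont h 0"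
    and eq: "\<And>w. \<bar>w\<bar> < r \<Longrightarrow> p0 + p1 * w + p2 * w ^ 2 + p3 * w ^ 3 = w ^ 4 * h w"
  shows "p0 = 0" "p1 = 0" "p2 = 0" "p3 = 0"
proof -
  show 0: "p0 = 0" using eq[of 0] r by simp
  show 1: "p1 = 0"
  proof (rule zero_of_order_one[OF r])
    show "p1 + w * (p2 + p3 * w) = w * (w ^ 2 * h w)" if "w \<noteq> 0" "\<bar>w\<bar> < r" for w
    proof -
      have "w * (p1 + w * (p2 + p3 * w)) = w * (w * (w ^ 2 * h w))"
        using eq[OF that(2)] 0 by (simp add: eval_nat_numeral algebra_simps)
      then show ?thesis using that by simp
    qed
  qed (auto intro!: continuous_intros h)
  show 2: "p2 = 0"
  proof (rule zero_of_order_one[OF r])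
    show "p2 + w * p3 = w * (w * h w)" if "w \<noteq> 0" "\<bar>w\<bar> < r" for w
    proof -
      have "w ^ 2 * (p2 + w * p3) = w ^ 2 * (w * (w * h w))"
        using eq[OF that(2)] 0 1 by (simp add: eval_nat_numeral algebra_simps)
      then show ?thesis using that by simp
    qed
  qed (auto intro!: continuous_intros h)
  show "p3 = 0"
  proof (rule zero_of_order_one[OF r])
    show "p3 + w * 0 = w * h w" if "w \<noteq> 0" "\<bar>w\<bar> < r" for w
    proof -
      have "w ^ 3 * (p3 + w * 0) = w ^ 3 * (w * h w)"
        using eq[OF that(2)] 0 1 2 by (simp add: eval_nat_numeral algebra_simps)
      then show ?thesis using that by simp
    qed
  qed (auto intro!: continuous_intros h)
qed

lemma hol_family_real_DERIV:
  assumes "hol_family D B F" "of_real w \<in> D" "x \<in> B"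
  shows "((\<lambda>w. Re (F (of_real w, x))) has_real_derivative Re (pds F (of_real w, x))) (at w)"
proof -
  have "((\<lambda>w. F (of_real w, x)) has_vector_derivative pds F (of_real w, x)) (at w)"
    using has_vector_derivative_real_field[OF hol_family_DERIV[OF assms]] by simp
  from bounded_linear.has_vector_derivative[OF bounded_linear_Re this] show ?thesis
    by (simp add: has_real_derivative_iff_has_vector_derivative)
qed

lemma has_derivative_snd_arg:
  assumes "(F has_derivative D) (at (s, x))"
  shows "((\<lambda>x. F (s, x)) has_derivative (\<lambda>v. D (0, v))) (at x)"
  by (rule has_derivative_compose[OF has_derivative_Pair[OF has_derivative_const has_derivative_ident] assms])

lemma has_derivative_fst_arg:
  assumes "(F has_derivative D) (at (s, x))"
  shows "((\<lambda>s. F (s, x)) has_derivative (\<lambda>v. D (v, 0))) (at s)"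
  by (rule has_derivative_compose[OF has_derivative_Pair[OF has_derivative_ident has_derivative_const] assms])

lemma smooth_on_partial_DERIV:
  fixes H :: "real \<times> 'x::real_normed_vector \<Rightarrow> real"
  assumes "smooth_on S H" "(w, x) \<in> S"
  shows "((\<lambda>w. H (w, x)) has_real_derivative frechet_derivative H (at (w, x)) (1, 0)) (at w)"
proof -
  have d: "(H has_derivative frechet_derivative H (at (w, x))) (at (w, x))"
    by (rule smooth_on_has_derivative[OF assms])
  interpret linear "frechet_derivative H (at (w, x))"
    using d has_derivative_linear by blast
  have "frechet_derivative H (at (w, x)) (h, 0) = frechet_derivative H (at (w, x)) (1, 0) * h" for h
    using scale[of h "(1, 0)"] by simp
  then have "(\<lambda>h. frechet_derivative H (at (w, x)) (h, 0)) = (*) (frechet_derivative H (at (w, x)) (1, 0))"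
    by (intro ext)
  with has_derivative_fst_arg[OF d] show ?thesis
    by (simp add: has_field_derivative_def)
qed

lemma linear_path_DERIV:
  fixes f :: "'a::real_normed_vector \<Rightarrow> real"
  assumes "(f has_derivative f') (at x)"
  shows "((\<lambda>t. f (x + t *\<^sub>R v)) has_real_derivative f' v) (at 0)"
proof -
  have "((\<lambda>t. x + t *\<^sub>R v) has_derivative (\<lambda>t. t *\<^sub>R v)) (at 0)"
    by (auto intro!: derivative_eq_intros)
  from has_derivative_compose[OF this, of f f'] assms
  have "((\<lambda>t. f (x + t *\<^sub>R v)) has_derivative (\<lambda>t. f' (t *\<^sub>R v))) (at 0)"
    by simp
  moreover have "(\<lambda>t. f' (t *\<^sub>R v)) = (*) (f' v)"
    using has_derivative_linear[OF assms] by (auto simp: linear_scale mult.commute)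
  ultimately show ?thesis by (simp add: has_field_derivative_def)
qed

definition dquartic :: "quad \<Rightarrow> real \<Rightarrow> real" where
  "dquartic a w = 4 * (w + qc a) ^ 3 + 2 * q2 a * (w + qc a) + q1 a"

definition ddquartic :: "quad \<Rightarrow> real \<Rightarrow> real" where
  "ddquartic a w = 12 * (w + qc a) ^ 2 + 2 * q2 a"

lemma quartic_DERIV: "(quartic a has_real_derivative dquartic a w) (at w)"
  unfolding quartic_def dquartic_def by (auto intro!: derivative_eq_intros)

lemma dquartic_DERIV: "(dquartic a has_real_derivative ddquartic a w) (at w)"
  unfolding dquartic_def ddquartic_def by (auto intro!: derivative_eq_intros)

lemma quartic_line_DERIV:
  "((\<lambda>t. quartic (t *\<^sub>R v) (w::real)) has_real_derivative
     (q0 v + q1 v * w + q2 v * w ^ 2 + (4 * qc v) * w ^ 3)) (at 0)"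
  unfolding quartic_def by (auto intro!: derivative_eq_intros)

lemma quartic_coeff_has_derivative:
  assumes a: "(a has_derivative a') (at x)" and a0: "a x = 0"
  shows "((\<lambda>x. quartic (a x) (0::real)) has_derivative (\<lambda>Y. q0 (a' Y))) (at x)"
    and "((\<lambda>x. dquartic (a x) 0) has_derivative (\<lambda>Y. q1 (a' Y))) (at x)"
    and "((\<lambda>x. ddquartic (a x) 0) has_derivative (\<lambda>Y. 2 * q2 (a' Y))) (at x)"
proof -
  note d = bounded_linear.has_derivative[OF quad_linear(9) a] bounded_linear.has_derivative[OF quad_linear(10) a]
    bounded_linear.has_derivative[OF quad_linear(11) a] bounded_linear.has_derivative[OF quad_linear(12) a]
  show "((\<lambda>x. quartic (a x) (0::real)) has_derivative (\<lambda>Y. q0 (a' Y))) (at x)"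
    unfolding quartic_def by (rule derivative_eq_intros d refl)+ (simp add: a0)
  show "((\<lambda>x. dquartic (a x) 0) has_derivative (\<lambda>Y. q1 (a' Y))) (at x)"
    unfolding dquartic_def by (rule derivative_eq_intros d refl)+ (simp add: a0)
  show "((\<lambda>x. ddquartic (a x) 0) has_derivative (\<lambda>Y. 2 * q2 (a' Y))) (at x)"
    unfolding ddquartic_def by (rule derivative_eq_intros d refl)+ (simp add: a0)
qed

lemma Re_has_derivative_snd_arg:
  assumes "hol_family D B F" "s \<in> D" "x \<in> B"
  shows "((\<lambda>x. Re (F (s, x))) has_derivative (\<lambda>Y. Re (frechet_derivative F (at (s, x)) (0, Y)))) (at x)"
  using assms
  by (intro bounded_linear.has_derivative[OF bounded_linear_Re] has_derivative_snd_arg smooth_on_has_derivative)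
    (auto simp: hol_family_def)

text \<open>\<open>a x\<close> is chosen so that the remainder of the division by the quartic
  vanishes; what is left of \<open>Re F\<close> is the quartic times a unit. The last three
  conclusions come from differentiating this product at \<open>w = 0\<close>: a triangular system
  with diagonal \<open>l0\<close>, \<open>l0\<close>, \<open>2 * l0\<close>, by which parameter
  derivatives of \<open>F\<close> control those of the coefficients \<open>q0\<close>,
  \<open>q1\<close>, \<open>q2\<close>. The constants \<open>l0\<close>, \<open>l1\<close>,
  \<open>l2\<close> are the value and the first two \<open>w\<close>-derivatives of the
  unit.\<close>

theorem preparation_order_four:
  fixes F :: "complex \<times> 'x::euclidean_space \<Rightarrow> complex"
  assumes F: "hol_family (ball 0 R) B F" and R: "R > 0" and x0: "x0 \<in> B"
    and van: "\<And>k. k < 4 \<Longrightarrow> Re ((pds ^^ k) F (0, x0)) = 0" and ord: "Re ((pds ^^ 4) F (0, x0)) \<noteq> 0"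
  obtains r B' a l0 l1 l2 where "r > 0" "r \<le> R" "open B'" "x0 \<in> B'" "B' \<subseteq> B"
    "smooth_on B' (a :: 'x \<Rightarrow> quad)" "a x0 = 0"
    "\<And>w x. \<bar>w\<bar> < r \<Longrightarrow> x \<in> B' \<Longrightarrow> Re (F (of_real w, x)) = 0 \<Longrightarrow> Re (pds F (of_real w, x)) = 0
       \<Longrightarrow> quartic (a x) w = 0 \<and> dquartic (a x) w = 0"
    "l0 \<noteq> 0"
    "\<And>Y. Re (frechet_derivative F (at (0, x0)) (0, Y)) = l0 * q0 (frechet_derivative a (at x0) Y)"
    "\<And>Y. Re (frechet_derivative (pds F) (at (0, x0)) (0, Y))
        = l0 * q1 (frechet_derivative a (at x0) Y) + l1 * q0 (frechet_derivative a (at x0) Y)"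
    "\<And>Y. Re (frechet_derivative (pds (pds F)) (at (0, x0)) (0, Y))
        = 2 * l0 * q2 (frechet_derivative a (at x0) Y) + 2 * l1 * q1 (frechet_derivative a (at x0) Y)
          + l2 * q0 (frechet_derivative a (at x0) Y)"
proof -
  have B: "open B" using F by (simp add: hol_family_def)
  obtain r d Q \<rho> where r: "r > 0" "r \<le> R" and d: "d > 0"
    and sQ: "smooth_on (ball 0 r \<times> ball 0 d \<times> B) (Q :: real \<times> quad \<times> 'x \<Rightarrow> real)"
    and s\<rho>: "\<And>j. smooth_on (ball 0 d \<times> B) (\<rho> j :: quad \<times> 'x \<Rightarrow> real)"
    and id: "\<And>w a x. w \<in> ball 0 r \<Longrightarrow> a \<in> ball 0 d \<Longrightarrow> x \<in> B \<Longrightarrow>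
       Re (F (of_real w, x)) = quartic a w * Q (w, a, x) + (\<Sum>j<4. (w + qc a) ^ j * \<rho> j (a, x))"
    and v\<rho>: "\<And>j x. j < 4 \<Longrightarrow> x \<in> B \<Longrightarrow> \<rho> j (0, x) = Re ((pds ^^ j) F (0, x)) / fact j"
    and vQ: "\<And>x. x \<in> B \<Longrightarrow> Q (0, 0, x) = Re ((pds ^^ 4) F (0, x)) / fact 4"
    by (rule division_by_quartic[OF F R]) blast
  have \<rho>0: "\<rho> j (0, x0) = 0" if "j < 4" for j
    using v\<rho>[OF that x0] van[OF that] by simp
  have Q0: "Q (0, 0, x0) \<noteq> 0"
    using vQ[OF x0] ord by simp
  define G where "G y = (\<rho> 3 y, \<rho> 2 y, \<rho> 1 y, \<rho> 0 y)" for y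
  have oS: "open (ball 0 d \<times> B)" and oW: "open (ball 0 r \<times> ball 0 d \<times> B)"
    by (auto intro!: open_Times B)
  have sG: "smooth_on (ball 0 d \<times> B) G"
    unfolding G_def by (intro smooth_on_Pair s\<rho> oS)
  have p0: "(0, x0) \<in> ball 0 d \<times> B" using d x0 by simp
  have d\<rho>: "(\<rho> j has_derivative frechet_derivative (\<rho> j) (at (0, x0))) (at (0, x0))" for j
    by (rule smooth_on_has_derivative[OF s\<rho> p0])
  \<comment> \<open>Since \<open>F (w, x0)\<close> does not involve the coefficients,
    differentiating the division identity in direction \<open>v\<close> at the quartic
    \<open>w ^ 4\<close> gives a cubic with coefficients \<open>q0 v\<close>, \<open>q1 v\<close>,
    \<open>q2 v\<close>, \<open>4 * qc v\<close> that vanishes to order four. So it is zero, and the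
    remainder has an invertible derivative in the coefficients.\<close>
  have inj: "v = 0" if "frechet_derivative G (at (0, x0)) (v, 0) = 0" for v
  proof -
    let ?D = "\<lambda>j. frechet_derivative (\<rho> j) (at (0, x0))"
    have "(G has_derivative (\<lambda>u. (?D 3 u, ?D 2 u, ?D 1 u, ?D 0 u))) (at (0, x0))"
      unfolding G_def by (intro has_derivative_Pair d\<rho>)
    then have "frechet_derivative G (at (0, x0)) = (\<lambda>u. (?D 3 u, ?D 2 u, ?D 1 u, ?D 0 u))"
      by (rule frechet_derivative_at[symmetric])
    with that have "?D 3 (v, 0) = 0 \<and> ?D 2 (v, 0) = 0 \<and> ?D 1 (v, 0) = 0 \<and> ?D 0 (v, 0) = 0"
      by (simp add: zero_prod_def)
    then have D0: "?D j (v, 0) = 0" if "j < 4" for j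
      using that by (auto simp: less_Suc_eq numeral_eq_Suc)
    let ?l = "\<lambda>w. q0 v + q1 v * w + q2 v * w ^ 2 + (4 * qc v) * w ^ 3"
    define DQ where "DQ w = frechet_derivative Q (at (w, 0, x0)) (0, v, 0)" for w
    have lin: "?l w * Q (w, 0, x0) + w ^ 4 * DQ w = 0" if w: "w \<in> ball 0 r" for w
    proof -
      have wS: "(w, 0, x0) \<in> ball 0 r \<times> ball 0 d \<times> B" using w d x0 by simp
      have 1: "((\<lambda>t. Q (w, t *\<^sub>R v, x0)) has_real_derivative DQ w) (at 0)"
        using linear_path_DERIV[OF smooth_on_has_derivative[OF sQ wS], of "(0, v, 0)"]
        by (simp add: DQ_def)
      have 2: "((\<lambda>t. \<rho> j (t *\<^sub>R v, x0)) has_real_derivative 0) (at 0)" if "j < 4" for j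
        using linear_path_DERIV[OF d\<rho>, of j "(v, 0)"] D0[OF that] by simp
      have 3: "((\<lambda>t. \<Sum>j<4. (w + qc (t *\<^sub>R v)) ^ j * \<rho> j (t *\<^sub>R v, x0)) has_real_derivative (\<Sum>j<(4::nat). 0)) (at 0)"
      proof (intro DERIV_sum)
        fix j assume "j \<in> {..<4::nat}"
        then have j: "j < 4" by simp
        have "((\<lambda>t. (w + qc (t *\<^sub>R v)) ^ j) has_real_derivative (of_nat j * w ^ (j - 1) * qc v)) (at 0)"
          by (auto intro!: derivative_eq_intros)
        from DERIV_mult[OF this 2[OF j]]
        show "((\<lambda>t. (w + qc (t *\<^sub>R v)) ^ j * \<rho> j (t *\<^sub>R v, x0)) has_real_derivative 0) (at 0)"
          using \<rho>0[OF j] by simp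
      qed
      have 4: "((\<lambda>t. quartic (t *\<^sub>R v) w * Q (w, t *\<^sub>R v, x0) + (\<Sum>j<4. (w + qc (t *\<^sub>R v)) ^ j * \<rho> j (t *\<^sub>R v, x0)))
         has_real_derivative (?l w * Q (w, 0, x0) + w ^ 4 * DQ w)) (at 0)"
        using DERIV_add[OF DERIV_mult[OF quartic_line_DERIV 1] 3] by (simp add: mult_ac)
      have "((\<lambda>t. Re (F (of_real w, x0))) has_real_derivative (?l w * Q (w, 0, x0) + w ^ 4 * DQ w)) (at 0)"
      proof (rule has_field_derivative_transform_within_open[OF 4])
        show "open {t. norm (t *\<^sub>R v) < d}"
          by (intro open_Collect_less continuous_intros)
        show "0 \<in> {t. norm (t *\<^sub>R v) < d}" using d by simp
        show "quartic (t *\<^sub>R v) w * Q (w, t *\<^sub>R v, x0) + (\<Sum>j<4. (w + qc (t *\<^sub>R v)) ^ j * \<rho> j (t *\<^sub>R v, x0))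
          = Re (F (of_real w, x0))" if "t \<in> {t. norm (t *\<^sub>R v) < d}" for t
          using id[OF w _ x0, of "t *\<^sub>R v"] that by simp
      qed
      from DERIV_unique[OF this DERIV_const] show ?thesis .
    qed
    have cont0: "isCont (\<lambda>w. H (w, 0, x0)) 0" if "smooth_on (ball 0 r \<times> ball 0 d \<times> B) H"
      for H :: "real \<times> quad \<times> 'x \<Rightarrow> real"
    proof -
      have "continuous_on (ball 0 r) (\<lambda>w. H (w, 0, x0))"
        by (rule continuous_on_compose2[OF smooth_on_imp_continuous_on[OF that]])
          (use d x0 in \<open>auto intro!: continuous_intros\<close>)
      then show ?thesis using r by (simp add: continuous_on_eq_continuous_at)
    qed
    have cQ: "isCont (\<lambda>w. Q (w, 0, x0)) 0" by (rule cont0[OF sQ])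
    have cDQ: "isCont DQ 0" unfolding DQ_def by (rule cont0[OF smooth_on_frechet[OF sQ]])
    obtain e where e: "e > 0" "\<And>w. \<bar>w\<bar> < e \<Longrightarrow> Q (w, 0, x0) \<noteq> 0"
      using continuous_at_avoid[OF cQ, of 0] Q0 by (auto simp: dist_real_def)
    have lineq: "?l w = w ^ 4 * (- DQ w / Q (w, 0, x0))" if "\<bar>w\<bar> < min r e" for w
      using lin[of w] e(2)[of w] that by (simp add: field_simps eq_neg_iff_add_eq_0)
    have pos: "min r e > 0" using r e by simp
    have ch: "isCont (\<lambda>w. - DQ w / Q (w, 0, x0)) 0"
      using cQ cDQ Q0 by (intro continuous_intros)
    from cubic_of_order_four[OF pos ch lineq]
    have "q0 v = 0" "q1 v = 0" "q2 v = 0" "4 * qc v = 0" by blast+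
    then show "v = 0" by (intro quad_eq_0) auto
  qed
  have G0: "G (0, x0) = 0"
    using \<rho>0[of 0] \<rho>0[of 1] \<rho>0[of 2] \<rho>0[of 3] by (simp add: G_def zero_prod_def)
  obtain A B1 a where A: "open A" "0 \<in> A" and B1: "open B1" "x0 \<in> B1" and AB: "A \<times> B1 \<subseteq> ball 0 d \<times> B"
    and sa: "smooth_on B1 a" "a x0 = 0" and aA: "\<And>x. x \<in> B1 \<Longrightarrow> a x \<in> A \<and> G (a x, x) = 0"
    by (rule smooth_implicit_function[OF oS sG p0 G0 inj]) blast+
  define Q' where "Q' p = Q (fst p, a (snd p), snd p)" for p
  have ad: "a x \<in> ball 0 d" "x \<in> B" if "x \<in> B1" for x
    using aA[OF that] AB that A by auto
  have oB1: "open (ball 0 r \<times> B1)" by (intro open_Times B1 open_ball)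
  have sQ': "smooth_on (ball 0 r \<times> B1) Q'"
    unfolding Q'_def
    by (rule smooth_on_compose[OF sQ oW oB1])
      (use ad in \<open>auto intro!: smooth_intros smooth_on_compose[OF sa(1) B1(1)] oB1\<close>)
  \<comment> \<open>On this set the quotient is a unit, so common zeros of \<open>Re F\<close> and
    its derivative are double roots of the quartic.\<close>
  define W where "W = (ball 0 r \<times> B1) \<inter> Q' -` (- {0})"
  have oW: "open W"
    unfolding W_def using smooth_on_imp_continuous_on[OF sQ'] oB1
    by (intro continuous_open_preimage) auto
  have "(0, x0) \<in> W" using r B1 Q0 sa(2) by (auto simp: W_def Q'_def)
  then obtain I B' where I: "open I" "0 \<in> I" and B': "open B'" "x0 \<in> B'" and IB: "I \<times> B' \<subseteq> W"
    using open_prod_elim[OF oW] by (metis mem_Sigma_iff)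
  obtain e where e: "e > 0" "ball 0 e \<subseteq> I" using I open_contains_ball by blast
  have IB': "I \<subseteq> ball 0 r" "B' \<subseteq> B1"
    using IB I B' by (auto simp: W_def)
  have idQ: "Re (F (of_real w, x)) = quartic (a x) w * Q' (w, x)" if "w \<in> I" "x \<in> B'" for w x
  proof -
    have "G (a x, x) = 0" using aA that IB' by blast
    then have "\<rho> j (a x, x) = 0" if "j < 4" for j
      using that by (auto simp: G_def zero_prod_def less_Suc_eq numeral_eq_Suc)
    moreover have "w \<in> ball 0 r" "x \<in> B1" using that IB' by blast+
    ultimately show ?thesis
      using id[of w "a x" x] ad[of x] by (simp add: Q'_def)
  qed
  define Q1 where "Q1 p = frechet_derivative Q' (at p) (1, 0)" for p
  define Q2 where "Q2 p = frechet_derivative Q1 (at p) (1, 0)" for p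
  have sQ1: "smooth_on (ball 0 r \<times> B1) Q1"
    unfolding Q1_def by (rule smooth_on_frechet[OF sQ'])
  have sQ2: "smooth_on (ball 0 r \<times> B1) Q2"
    unfolding Q2_def by (rule smooth_on_frechet[OF sQ1])
  have inS: "(w, x) \<in> ball 0 r \<times> B1" "of_real w \<in> ball (0::complex) R" "x \<in> B" if "w \<in> I" "x \<in> B'" for w x
    using that IB' ad r by (auto dest!: subsetD[OF IB'(1)])
  have F1: "hol_family (ball 0 R) B (pds F)" and F2: "hol_family (ball 0 R) B (pds (pds F))"
    by (intro hol_family_pds F)+
  have idQ1: "Re (pds F (of_real w, x)) = dquartic (a x) w * Q' (w, x) + quartic (a x) w * Q1 (w, x)"
    if wx: "w \<in> I" "x \<in> B'" for w x
  proof (rule DERIV_unique)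
    show "((\<lambda>w. Re (F (of_real w, x))) has_real_derivative Re (pds F (of_real w, x))) (at w)"
      by (rule hol_family_real_DERIV[OF F inS(2,3)[OF wx]])
    have "((\<lambda>w. quartic (a x) w * Q' (w, x)) has_real_derivative
        dquartic (a x) w * Q' (w, x) + quartic (a x) w * Q1 (w, x)) (at w)"
      using DERIV_mult[OF quartic_DERIV[of "a x"] smooth_on_partial_DERIV[OF sQ' inS(1)[OF wx]]]
      by (simp add: Q1_def mult_ac)
    then show "((\<lambda>w. Re (F (of_real w, x))) has_real_derivative
        dquartic (a x) w * Q' (w, x) + quartic (a x) w * Q1 (w, x)) (at w)"
      by (rule has_field_derivative_transform_within_open[OF _ I(1) wx(1)]) (simp add: idQ wx)
  qed
  have idQ2: "Re (pds (pds F) (of_real w, x)) = ddquartic (a x) w * Q' (w, x)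
      + 2 * (dquartic (a x) w * Q1 (w, x)) + quartic (a x) w * Q2 (w, x)"
    if wx: "w \<in> I" "x \<in> B'" for w x
  proof (rule DERIV_unique)
    show "((\<lambda>w. Re (pds F (of_real w, x))) has_real_derivative Re (pds (pds F) (of_real w, x))) (at w)"
      by (rule hol_family_real_DERIV[OF F1 inS(2,3)[OF wx]])
    have "((\<lambda>w. dquartic (a x) w * Q' (w, x) + quartic (a x) w * Q1 (w, x)) has_real_derivative
        ddquartic (a x) w * Q' (w, x) + 2 * (dquartic (a x) w * Q1 (w, x)) + quartic (a x) w * Q2 (w, x)) (at w)"
      using DERIV_add[OF DERIV_mult[OF dquartic_DERIV[of "a x"] smooth_on_partial_DERIV[OF sQ' inS(1)[OF wx]]]
          DERIV_mult[OF quartic_DERIV[of "a x"] smooth_on_partial_DERIV[OF sQ1 inS(1)[OF wx]]]]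
      by (simp add: Q1_def Q2_def algebra_simps)
    then show "((\<lambda>w. Re (pds F (of_real w, x))) has_real_derivative
        ddquartic (a x) w * Q' (w, x) + 2 * (dquartic (a x) w * Q1 (w, x)) + quartic (a x) w * Q2 (w, x)) (at w)"
      by (rule has_field_derivative_transform_within_open[OF _ I(1) wx(1)]) (simp add: idQ1 wx)
  qed
  let ?a' = "frechet_derivative a (at x0)"
  have da: "(a has_derivative ?a') (at x0)"
    by (rule smooth_on_has_derivative[OF sa(1) B1(2)])
  note qd = quartic_coeff_has_derivative[OF da sa(2)]
  have z: "(0, x0) \<in> ball 0 r \<times> B1" using r B1 by simp
  note dQ' = has_derivative_snd_arg[OF smooth_on_has_derivative[OF sQ' z]]
    and dQ1 = has_derivative_snd_arg[OF smooth_on_has_derivative[OF sQ1 z]]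
    and dQ2 = has_derivative_snd_arg[OF smooth_on_has_derivative[OF sQ2 z]]
  have q00: "quartic (a x0) (0::real) = 0" "dquartic (a x0) 0 = 0" "ddquartic (a x0) 0 = 0"
    using sa(2) by (auto simp: dquartic_def ddquartic_def)
  have R0: "(0::complex) \<in> ball 0 R" using R by simp
  show ?thesis
  proof (rule that)
    show "min e r > 0" "min e r \<le> R" "open B'" "x0 \<in> B'" "B' \<subseteq> B" "a x0 = 0"
      using e r B' IB' ad sa by auto
    show "smooth_on B' a" by (rule smooth_on_subset[OF sa(1) IB'(2)])
    show "Q' (0, x0) \<noteq> 0" using Q0 sa(2) by (simp add: Q'_def)
    show "quartic (a x) w = 0 \<and> dquartic (a x) w = 0"
      if "\<bar>w\<bar> < min e r" "x \<in> B'" "Re (F (of_real w, x)) = 0" "Re (pds F (of_real w, x)) = 0" for w x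
    proof -
      have w: "w \<in> I" using that(1) e by auto
      then have "Q' (w, x) \<noteq> 0" using IB that(2) by (auto simp: W_def)
      then show ?thesis
        using idQ[OF w that(2)] idQ1[OF w that(2)] that by auto
    qed
    show "Re (frechet_derivative F (at (0, x0)) (0, Y)) = Q' (0, x0) * q0 (?a' Y)" for Y
    proof -
      have "((\<lambda>x. Re (F (0, x))) has_derivative (\<lambda>Y. Q' (0, x0) * q0 (?a' Y))) (at x0)"
        by (rule has_derivative_transform_within_open[OF _ B', of "\<lambda>x. quartic (a x) 0 * Q' (0, x)"])
          (use has_derivative_mult[OF qd(1) dQ'] idQ[OF I(2)] q00 in \<open>simp_all add: mult.commute\<close>)
      from has_derivative_unique[OF Re_has_derivative_snd_arg[OF F R0 x0] this] show ?thesis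
        by (rule fun_cong)
    qed
    show "Re (frechet_derivative (pds F) (at (0, x0)) (0, Y)) = Q' (0, x0) * q1 (?a' Y) + Q1 (0, x0) * q0 (?a' Y)" for Y
    proof -
      have "((\<lambda>x. Re (pds F (0, x))) has_derivative (\<lambda>Y. Q' (0, x0) * q1 (?a' Y) + Q1 (0, x0) * q0 (?a' Y))) (at x0)"
        by (rule has_derivative_transform_within_open[OF _ B', of "\<lambda>x. dquartic (a x) 0 * Q' (0, x) + quartic (a x) 0 * Q1 (0, x)"])
          (use has_derivative_add[OF has_derivative_mult[OF qd(2) dQ'] has_derivative_mult[OF qd(1) dQ1]] idQ1[OF I(2)] q00
            in \<open>simp_all add: mult.commute\<close>)
      from has_derivative_unique[OF Re_has_derivative_snd_arg[OF F1 R0 x0] this] show ?thesis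
        by (rule fun_cong)
    qed
    show "Re (frechet_derivative (pds (pds F)) (at (0, x0)) (0, Y))
        = 2 * Q' (0, x0) * q2 (?a' Y) + 2 * Q1 (0, x0) * q1 (?a' Y) + Q2 (0, x0) * q0 (?a' Y)" for Y
    proof -
      have "((\<lambda>x. Re (pds (pds F) (0, x))) has_derivative
          (\<lambda>Y. 2 * Q' (0, x0) * q2 (?a' Y) + 2 * Q1 (0, x0) * q1 (?a' Y) + Q2 (0, x0) * q0 (?a' Y))) (at x0)"
        by (rule has_derivative_transform_within_open[OF _ B', of "\<lambda>x. ddquartic (a x) 0 * Q' (0, x)
             + 2 * (dquartic (a x) 0 * Q1 (0, x)) + quartic (a x) 0 * Q2 (0, x)"])
          (use has_derivative_add[OF has_derivative_add[OF has_derivative_mult[OF qd(3) dQ']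
              has_derivative_mult[OF has_derivative_const[of 2] has_derivative_mult[OF qd(2) dQ1]]]
              has_derivative_mult[OF qd(1) dQ2]] idQ2[OF I(2)] q00
            in \<open>simp_all add: mult_ac\<close>)
      from has_derivative_unique[OF Re_has_derivative_snd_arg[OF F2 R0 x0] this] show ?thesis
        by (rule fun_cong)
    qed
  qed
qed

section \<open>Eliminating a nondegenerate variable\<close>

lemma frechet_derivative_cong_open:
  assumes "(f has_derivative f') (at x)" "open S" "x \<in> S" "\<And>y. y \<in> S \<Longrightarrow> f y = g y"
  shows "frechet_derivative g (at x) = f'"
  using frechet_derivative_at[OF has_derivative_transform_within_open[OF assms]] by simp

text \<open>The arguments of the functions \<open>E\<close> are ordered as \<open>(t, s, x)\<close>: the critical variable \<open>t\<close> is
  eliminated first.\<close>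

theorem eliminate_critical_variable:
  fixes E Es Et Ess Est Ett :: "complex \<times> complex \<times> 'x::euclidean_space \<Rightarrow> complex"
  assumes S: "open S" and p0: "(0, 0, x0) \<in> S"
    and sE: "smooth_on S E" and sEs: "smooth_on S Es" and sEt: "smooth_on S Et"
    and dE: "\<And>p \<tau> \<sigma>. p \<in> S \<Longrightarrow> frechet_derivative E (at p) (\<tau>, \<sigma>, 0) = Et p * \<tau> + Es p * \<sigma>"
    and dEs: "\<And>p \<tau> \<sigma>. p \<in> S \<Longrightarrow> frechet_derivative Es (at p) (\<tau>, \<sigma>, 0) = Est p * \<tau> + Ess p * \<sigma>"
    and dEt: "\<And>p \<tau> \<sigma>. p \<in> S \<Longrightarrow> frechet_derivative Et (at p) (\<tau>, \<sigma>, 0) = Ett p * \<tau> + Est p * \<sigma>"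
    and crit: "Et (0, 0, x0) = 0" and nondeg: "Ett (0, 0, x0) \<noteq> 0" and diag: "Est (0, 0, x0) = 0"
  obtains R B h \<delta> F where "R > 0" "x0 \<in> B" "hol_family (ball 0 R) B F" "\<delta> > 0"
    "\<And>s x. s \<in> ball 0 R \<Longrightarrow> x \<in> B \<Longrightarrow> (h (s, x), s, x) \<in> S"
    "\<And>t s x. t \<in> ball 0 \<delta> \<Longrightarrow> s \<in> ball 0 R \<Longrightarrow> x \<in> B \<Longrightarrow> Et (t, s, x) = 0 \<Longrightarrow> h (s, x) = t"
    "\<And>s x. s \<in> ball 0 R \<Longrightarrow> x \<in> B \<Longrightarrow> F (s, x) = E (h (s, x), s, x)"
    "\<And>s x. s \<in> ball 0 R \<Longrightarrow> x \<in> B \<Longrightarrow> pds F (s, x) = Es (h (s, x), s, x)"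
    "\<And>s x. s \<in> ball 0 R \<Longrightarrow> x \<in> B \<Longrightarrow> Ett (h (s, x), s, x) \<noteq> 0 \<and>
       pds (pds F) (s, x) = Ess (h (s, x), s, x) - Est (h (s, x), s, x) ^ 2 / Ett (h (s, x), s, x)"
    "\<And>Y. frechet_derivative F (at (0, x0)) (0, Y) = frechet_derivative E (at (0, 0, x0)) (0, 0, Y)"
    "\<And>Y. frechet_derivative (pds F) (at (0, x0)) (0, Y) = frechet_derivative Es (at (0, 0, x0)) (0, 0, Y)"
proof -
  have ett: "Ett p = frechet_derivative Et (at p) (1, 0, 0)" if "p \<in> S" for p
    using dEt[OF that, of 1 0] by simp
  \<comment> \<open>Shrinking to where \<open>Ett\<close> does not vanish makes the Schur complement
    meaningful along the whole graph of \<open>h\<close>, not only at the base point.\<close>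
  define S' where "S' = S \<inter> (\<lambda>p. frechet_derivative Et (at p) (1, 0, 0)) -` (- {0})"
  have S': "open S'" "S' \<subseteq> S" "(0, 0, x0) \<in> S'"
    unfolding S'_def using smooth_on_imp_continuous_on[OF smooth_on_frechet[OF sEt]] S p0 nondeg ett[OF p0]
    by (auto intro!: continuous_open_preimage)
  have inj: "v = 0" if "frechet_derivative Et (at (0, 0, x0)) (v, 0) = 0" for v
    using that dEt[OF p0, of v 0] nondeg by (simp add: zero_prod_def)
  obtain A C h where A: "open A" "0 \<in> A" and C: "open C" "(0, x0) \<in> C" and AC: "A \<times> C \<subseteq> S'"
    and sh: "smooth_on C h" and h0: "h (0, x0) = 0"
    and hA: "\<And>y. y \<in> C \<Longrightarrow> h y \<in> A \<and> Et (h y, y) = 0"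
    and uniq: "\<And>t y. t \<in> A \<Longrightarrow> y \<in> C \<Longrightarrow> Et (t, y) = 0 \<Longrightarrow> t = h y"
    by (rule smooth_implicit_function[OF S'(1) smooth_on_subset[OF sEt S'(2)] S'(3) crit inj]) blast+
  obtain D B where D: "open D" "0 \<in> D" and B: "open B" "x0 \<in> B" and DB: "D \<times> B \<subseteq> C"
    using open_prod_elim[OF C] by (metis mem_Sigma_iff)
  obtain R where R: "R > 0" "ball 0 R \<subseteq> D" using D open_contains_ball by blast
  obtain \<delta> where \<delta>: "\<delta> > 0" "ball 0 \<delta> \<subseteq> A" using A open_contains_ball by blast
  have inC: "(s, x) \<in> C" if "s \<in> ball 0 R" "x \<in> B" for s x
    using that R DB by blast
  have inS: "(h y, y) \<in> S'" "(h y, y) \<in> S" if "y \<in> C" for y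
    using hA[OF that] AC S' that by blast+
  let ?O = "ball (0::complex) R \<times> B"
  have oO: "open ?O" by (intro open_Times B open_ball)
  have OC: "?O \<subseteq> C" using inC by auto
  define c where "c y = (h y, y)" for y
  have sc: "smooth_on ?O c"
    unfolding c_def by (intro smooth_intros oO smooth_on_subset[OF sh OC])
  have cS: "c y \<in> S" if "y \<in> ?O" for y
    using inS that OC by (auto simp: c_def)
  let ?h' = "\<lambda>y. frechet_derivative h (at y)"
  have dc: "(c has_derivative (\<lambda>v. (?h' y v, v))) (at y)" if "y \<in> ?O" for y
    unfolding c_def using that OC
    by (intro has_derivative_Pair smooth_on_has_derivative[OF sh] has_derivative_ident) auto
  have chain: "((\<lambda>y. H (c y)) has_derivative (\<lambda>v. frechet_derivative H (at (c y)) (?h' y v, v))) (at y)"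
    if "smooth_on S H" "y \<in> ?O" for H :: "complex \<times> complex \<times> 'x \<Rightarrow> complex" and y
    by (rule has_derivative_compose[OF dc[OF that(2)] smooth_on_has_derivative[OF that(1) cS[OF that(2)]]])
  define F where "F y = E (c y)" for y
  have sF: "smooth_on ?O F"
    unfolding F_def by (rule smooth_on_compose[OF sE S oO sc cS])
  have dF: "(F has_derivative (\<lambda>v. frechet_derivative E (at (c y)) (?h' y v, v))) (at y)" if "y \<in> ?O" for y
    unfolding F_def by (rule chain[OF sE that])
  have Et0: "Et (c y) = 0" if "y \<in> ?O" for y
    using hA that OC by (auto simp: c_def)
  \<comment> \<open>\<open>Et\<close> vanishes along the graph of \<open>h\<close>, so the
    derivative of \<open>h\<close> drops out and the derivative of \<open>F\<close> in
    \<open>s\<close> is multiplication by the complex number \<open>Es\<close>.\<close>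
  have "(\<lambda>s. F (s, x)) holomorphic_on ball 0 R" if x: "x \<in> B" for x
  proof (rule holomorphic_onI)
    fix s :: complex assume s: "s \<in> ball 0 R"
    have "((\<lambda>s. F (s, x)) has_derivative (\<lambda>v. frechet_derivative E (at (c (s, x))) (?h' (s, x) (v, 0), v, 0))) (at s)"
      using has_derivative_fst_arg[OF dF] s x by auto
    moreover have "(\<lambda>v. frechet_derivative E (at (c (s, x))) (?h' (s, x) (v, 0), v, 0)) = (*) (Es (c (s, x)))"
      using dE[OF cS] Et0 s x by auto
    ultimately have "((\<lambda>s. F (s, x)) has_field_derivative Es (c (s, x))) (at s)"
      by (simp add: has_field_derivative_def)
    then show "(\<lambda>s. F (s, x)) field_differentiable at s within ball 0 R"
      using field_differentiable_def field_differentiable_at_within by blast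
  qed
  then have hol: "hol_family (ball 0 R) B F"
    using sF B by (auto simp: hol_family_def)
  have F1: "pds F y = Es (c y)" if y: "y \<in> ?O" for y
  proof -
    have "pds F y = frechet_derivative E (at (c y)) (?h' y (1, 0), 1, 0)"
      unfolding pds_def using fun_cong[OF frechet_derivative_at[OF dF[OF y]], of "(1, 0)"] by simp
    then show ?thesis using dE[OF cS[OF y]] Et0[OF y] by simp
  qed
  have dF1: "frechet_derivative (pds F) (at y) = (\<lambda>v. frechet_derivative Es (at (c y)) (?h' y v, v))"
    if y: "y \<in> ?O" for y
    by (rule frechet_derivative_cong_open[OF chain[OF sEs y] oO y]) (simp add: F1)
  \<comment> \<open>Differentiating \<open>Et = 0\<close> along the graph gives the
    \<open>s\<close>-derivative of \<open>h\<close> as \<open>- Est / Ett\<close>; the result is the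
    Schur complement of \<open>Ett\<close> in the Hessian.\<close>
  have F2: "Ett (c y) \<noteq> 0 \<and> pds (pds F) y = Ess (c y) - Est (c y) ^ 2 / Ett (c y)" if y: "y \<in> ?O" for y
  proof -
    have nz: "Ett (c y) \<noteq> 0"
      using inS[of y] y OC ett by (auto simp: S'_def c_def)
    have "frechet_derivative (\<lambda>y. Et (c y)) (at y) = (\<lambda>v. 0)"
      by (rule frechet_derivative_cong_open[OF has_derivative_const oO y]) (simp add: Et0)
    moreover have "frechet_derivative (\<lambda>y. Et (c y)) (at y) = (\<lambda>v. frechet_derivative Et (at (c y)) (?h' y v, v))"
      by (rule frechet_derivative_at[OF chain[OF sEt y], symmetric])
    ultimately have "(\<lambda>v. frechet_derivative Et (at (c y)) (?h' y v, v)) = (\<lambda>v. 0)" by simp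
    from fun_cong[OF this, of "(1, 0)"] have "Ett (c y) * ?h' y (1, 0) + Est (c y) = 0"
      using dEt[OF cS[OF y]] by simp
    then have "?h' y (1, 0) = - Est (c y) / Ett (c y)"
      using nz by (simp add: field_simps add_eq_0_iff)
    moreover have "pds (pds F) y = Est (c y) * ?h' y (1, 0) + Ess (c y)"
      using dEs[OF cS[OF y], of "?h' y (1, 0)" 1] by (simp add: pds_def[of "pds F"] dF1[OF y])
    ultimately show ?thesis using nz by (simp add: power2_eq_square)
  qed
  have z: "(0, x0) \<in> ?O" using R B by simp
  have c0: "c (0, x0) = (0, 0, x0)" using h0 by (simp add: c_def)
  \<comment> \<open>Isolates the variation of \<open>h\<close> with the parameters, which is
    invisible at the base point because \<open>Et\<close> and \<open>Est\<close> both vanish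
    there.\<close>
  have split: "frechet_derivative H (at (0, 0, x0)) (\<tau>, 0, Y)
      = frechet_derivative H (at (0, 0, x0)) (\<tau>, 0, 0) + frechet_derivative H (at (0, 0, x0)) (0, 0, Y)"
    if "smooth_on S H" for H :: "complex \<times> complex \<times> 'x \<Rightarrow> complex" and \<tau> Y
  proof -
    have "linear (frechet_derivative H (at (0, 0, x0)))"
      using smooth_on_has_derivative[OF that p0] has_derivative_linear by blast
    from linear_add[OF this, of "(\<tau>, 0, 0)" "(0, 0, Y)"] show ?thesis by simp
  qed
  show ?thesis
  proof (rule that[OF R(1) B(2) hol \<delta>(1)])
    show "(h (s, x), s, x) \<in> S" if "s \<in> ball 0 R" "x \<in> B" for s x
      using inS inC that by blast
    show "h (s, x) = t" if "t \<in> ball 0 \<delta>" "s \<in> ball 0 R" "x \<in> B" "Et (t, s, x) = 0" for t s x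
      using uniq[of t "(s, x)"] that inC \<delta> by auto
    show "F (s, x) = E (h (s, x), s, x)" for s x
      by (simp add: F_def c_def)
    show "pds F (s, x) = Es (h (s, x), s, x)" if "s \<in> ball 0 R" "x \<in> B" for s x
      using F1[of "(s, x)"] that by (simp add: c_def)
    show "Ett (h (s, x), s, x) \<noteq> 0 \<and>
       pds (pds F) (s, x) = Ess (h (s, x), s, x) - Est (h (s, x), s, x) ^ 2 / Ett (h (s, x), s, x)"
      if "s \<in> ball 0 R" "x \<in> B" for s x
      using F2[of "(s, x)"] that by (simp add: c_def)
    show "frechet_derivative F (at (0, x0)) (0, Y) = frechet_derivative E (at (0, 0, x0)) (0, 0, Y)" for Y
    proof -
      have "frechet_derivative F (at (0, x0)) (0, Y) = frechet_derivative E (at (0, 0, x0)) (?h' (0, x0) (0, Y), 0, Y)"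
        using fun_cong[OF frechet_derivative_at[OF dF[OF z]], of "(0, Y)"] unfolding c0 by (rule sym)
      also have "\<dots> = frechet_derivative E (at (0, 0, x0)) (0, 0, Y)"
        unfolding split[OF sE, of "?h' (0, x0) (0, Y)" Y] dE[OF p0] crit by simp
      finally show ?thesis .
    qed
    show "frechet_derivative (pds F) (at (0, x0)) (0, Y) = frechet_derivative Es (at (0, 0, x0)) (0, 0, Y)" for Y
    proof -
      have "frechet_derivative (pds F) (at (0, x0)) (0, Y) = frechet_derivative Es (at (0, 0, x0)) (?h' (0, x0) (0, Y), 0, Y)"
        using fun_cong[OF dF1[OF z], of "(0, Y)"] unfolding c0 .
      also have "\<dots> = frechet_derivative Es (at (0, 0, x0)) (0, 0, Y)"
        unfolding split[OF sEs, of "?h' (0, x0) (0, Y)" Y] dEs[OF p0] diag by simp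
      finally show ?thesis .
    qed
  qed
qed

section \<open>Swallowtails from generating families\<close>

definition to_R3 :: "real \<times> complex \<Rightarrow> real^3" where
  "to_R3 y = vector [fst y, Re (snd y), Im (snd y)]"

definition of_R3 :: "real^3 \<Rightarrow> real \<times> complex" where
  "of_R3 y = (y $ 1, Complex (y $ 2) (y $ 3))"

lemma R3_inverse [simp]: "of_R3 (to_R3 y) = y" "to_R3 (of_R3 u) = u"
  by (auto simp: of_R3_def to_R3_def vec_eq_iff forall_3 prod_eq_iff)

lemma bounded_linear_R3: "bounded_linear to_R3" "bounded_linear of_R3"
  unfolding linear_conv_bounded_linear[symmetric]
  by (auto simp: of_R3_def to_R3_def vec_eq_iff forall_3 complex_eq_iff intro!: linearI)

text \<open>Solving the double-root equations for \<open>q1\<close> and \<open>q0\<close>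
  parametrises the discriminant of the quartic by \<open>q2\<close> and the shifted root, and this
  parametrisation is the standard swallowtail.\<close>

lemma quartic_double_root:
  assumes "quartic a (w::real) = 0" "dquartic a w = 0"
  shows "swallowtail_model (Complex (q2 a) (w + qc a)) = to_R3 (q2 a, Complex (q1 a) (q0 a))"
proof -
  let ?v = "w + qc a"
  have 1: "q1 a = - 4 * ?v ^ 3 - 2 * q2 a * ?v"
    using assms(2) by (simp add: dquartic_def)
  have "q0 a = - (?v ^ 4) - q2 a * ?v ^ 2 - q1 a * ?v"
    using assms(1) by (simp add: quartic_def)
  also have "\<dots> = 3 * ?v ^ 4 + q2 a * ?v ^ 2"
    unfolding 1 by algebra
  finally show ?thesis
    using 1 by (simp add: swallowtail_model_def to_R3_def vec_eq_iff forall_3)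
qed

lemma smooth_on_frechet_apply:
  fixes f :: "'b::euclidean_space \<Rightarrow> 'c::real_normed_vector"
  assumes f: "smooth_on T f" "open T" and S: "open S" and c: "smooth_on S c" "\<And>z. z \<in> S \<Longrightarrow> c z \<in> T"
    and g: "smooth_on S g"
  shows "smooth_on S (\<lambda>z. frechet_derivative f (at (c z)) (g z))"
proof (rule smooth_on_cong[OF _ S])
  show "smooth_on S (\<lambda>z. \<Sum>b\<in>Basis. (g z \<bullet> b) *\<^sub>R frechet_derivative f (at (c z)) b)"
    by (intro smooth_on_sum smooth_on_scaleR S smooth_on_bounded_linear[OF bounded_linear_inner_left] g
        smooth_on_compose[OF smooth_on_frechet[OF f(1)] f(2) S c])
  show "(\<Sum>b\<in>Basis. (g z \<bullet> b) *\<^sub>R frechet_derivative f (at (c z)) b) = frechet_derivative f (at (c z)) (g z)"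
    if "z \<in> S" for z
    by (rule linear_eq_sum_Basis[symmetric])
      (rule has_derivative_linear[OF smooth_on_has_derivative[OF f(1) c(2)[OF that]]])
qed

lemma hol_family_graph_derivative:
  assumes G: "hol_family D B G" and V: "z \<in> V" and X: "smooth_on V X"
    and e: "\<And>z. z \<in> V \<Longrightarrow> of_real (Re ((z - p) / e)) \<in> D \<and> X z \<in> B"
  shows "((\<lambda>z. Re (G (of_real (Re ((z - p) / e)), X z))) has_derivative
     (\<lambda>v. Re (pds G (of_real (Re ((z - p) / e)), X z)) * Re (v / e)
        + Re (frechet_derivative G (at (of_real (Re ((z - p) / e)), X z)) (0, frechet_derivative X (at z) v)))) (at z)"
proof -
  let ?q = "(complex_of_real (Re ((z - p) / e)), X z)"
  let ?D = "frechet_derivative G (at ?q)"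
  have dG: "(G has_derivative ?D) (at ?q)"
    using e[OF V] G by (intro smooth_on_has_derivative[of "D \<times> B"]) (auto simp: hol_family_def)
  interpret linear ?D
    using dG has_derivative_linear by blast
  have "((\<lambda>z. (z - p) / e) has_derivative (\<lambda>v. v / e)) (at z)"
    by (cases "e = 0") (auto intro!: derivative_eq_intros)
  then have d\<sigma>: "((\<lambda>z. complex_of_real (Re ((z - p) / e))) has_derivative (\<lambda>v. complex_of_real (Re (v / e)))) (at z)"
    by (intro bounded_linear.has_derivative[OF bounded_linear_of_real] bounded_linear.has_derivative[OF bounded_linear_Re])
  have "((\<lambda>z. (complex_of_real (Re ((z - p) / e)), X z)) has_derivative
      (\<lambda>v. (complex_of_real (Re (v / e)), frechet_derivative X (at z) v))) (at z)"
    by (intro has_derivative_Pair d\<sigma> smooth_on_has_derivative[OF X V])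
  from has_derivative_compose[OF this dG]
  have "((\<lambda>z. Re (G (of_real (Re ((z - p) / e)), X z))) has_derivative
      (\<lambda>v. Re (?D (complex_of_real (Re (v / e)), frechet_derivative X (at z) v)))) (at z)"
    by (rule bounded_linear.has_derivative[OF bounded_linear_Re])
  moreover have "Re (?D (complex_of_real c, Y)) = Re (pds G ?q) * c + Re (?D (0, Y))" for c Y
  proof -
    have "(complex_of_real c, Y) = c *\<^sub>R (1, 0) + (0, Y)"
      by (simp add: scaleR_conv_of_real)
    then have "?D (complex_of_real c, Y) = c *\<^sub>R ?D (1, 0) + ?D (0, Y)"
      by (simp only: add scale)
    then show ?thesis by (simp add: pds_def)
  qed
  ultimately show ?thesis by simp
qed

text \<open>Here \<open>l\<close> cuts out the singular set, \<eta> is a field that is null on it,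
  and \<open>k\<close> is a factor that is nonzero at \<open>p\<close>. Differentiating the three
  identities for \<open>F\<close> along the graph of \<open>X\<close> shows that the unfolding has
  order exactly four at \<open>p\<close>, because the \<eta>-derivative of \<open>l\<close> has a
  simple zero in direction \<open>e\<close>, and that moving in direction \<open>\<i> * e\<close>
  changes the coefficient \<open>q2\<close> to first order. Source and target coordinates are then
  read off the quartic.\<close>

theorem swallowtail_of_generating_family:
  fixes F :: "complex \<times> (real \<times> complex) \<Rightarrow> complex" and X u :: "complex \<Rightarrow> real \<times> complex"
    and k l :: "complex \<Rightarrow> real"
  assumes F: "hol_family (ball 0 R) B F" and R: "R > 0"
    and V: "open V" "p \<in> V" and e: "e \<noteq> 0" and X: "smooth_on V X"
    and inB: "\<And>z. z \<in> V \<Longrightarrow> of_real (Re ((z - p) / e)) \<in> ball (0::complex) R \<and> X z \<in> B"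
    and F0: "\<And>z. z \<in> V \<Longrightarrow> Re (F (of_real (Re ((z - p) / e)), X z)) = 0"
    and F1: "\<And>z. z \<in> V \<Longrightarrow> Re (pds F (of_real (Re ((z - p) / e)), X z)) = 0"
    and F2: "\<And>z. z \<in> V \<Longrightarrow> Re (pds (pds F) (of_real (Re ((z - p) / e)), X z)) = k z * l z"
    and smooth: "smooth_on V k" "smooth_on V l" "smooth_on V \<eta>" "smooth_on V u"
    and kp: "k p \<noteq> 0" and lp: "l p = 0" and \<eta>p: "\<eta> p = e"
    and kernel: "\<And>z. z \<in> V \<Longrightarrow> frechet_derivative X (at z) (\<eta> z) = l z *\<^sub>R u z"
    and le: "frechet_derivative l (at p) e = 0" and lie: "frechet_derivative l (at p) (\<i> * e) \<noteq> 0"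
    and \<xi>: "((\<lambda>t. frechet_derivative l (at (p + t *\<^sub>R e)) (\<eta> (p + t *\<^sub>R e))) has_real_derivative \<xi>) (at 0)" "\<xi> \<noteq> 0"
    and vers: "\<And>Y. Re (frechet_derivative F (at (0, X p)) (0, Y)) = 0 \<Longrightarrow>
       Re (frechet_derivative (pds F) (at (0, X p)) (0, Y)) = 0 \<Longrightarrow>
       \<exists>c. Y = c *\<^sub>R frechet_derivative X (at p) (\<i> * e)"
  obtains V' W \<phi> N \<Psi> \<theta> where "V' \<subseteq> V" "p \<in> V'" "0 \<in> W" "diffeo_on \<phi> W V'" "\<phi> 0 = p"
    "open N" "N \<subseteq> B" "smooth_on N (\<Psi> :: real \<times> complex \<Rightarrow> real^3)" "inj_on \<Psi> N" "open (\<Psi> ` N)"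
    "smooth_on (\<Psi> ` N) \<theta>" "\<And>x. x \<in> N \<Longrightarrow> \<theta> (\<Psi> x) = x" "\<Psi> (X p) = 0"
    "\<And>w. w \<in> W \<Longrightarrow> X (\<phi> w) \<in> N \<and> \<Psi> (X (\<phi> w)) = swallowtail_model w"
proof -
  define s where "s z = complex_of_real (Re ((z - p) / e))" for z
  define DX where "DX z = frechet_derivative X (at z)" for z
  define x0 where "x0 = X p"
  have sp: "s p = 0" by (simp add: s_def)
  have ss: "smooth_on V s"
    unfolding s_def using e by (intro smooth_intros V)
  have inB': "s z \<in> ball 0 R" "X z \<in> B" if "z \<in> V" for z
    using inB[OF that] by (auto simp: s_def)
  have x0B: "x0 \<in> B" using inB' V by (simp add: x0_def)
  note Fp = hol_family_pds_pow[OF F]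
  let ?F = "\<lambda>n. (pds ^^ n) F"
  let ?q = "\<lambda>z. (s z, X z)"
  let ?D = "\<lambda>n q Y. Re (frechet_derivative (?F n) (at q) (0, Y))"
  have chain: "((\<lambda>z. Re (?F n (?q z))) has_derivative
     (\<lambda>v. Re (?F (Suc n) (?q z)) * Re (v / e) + ?D n (?q z) (DX z v))) (at z)" if "z \<in> V" for n z
    using hol_family_graph_derivative[OF Fp that X inB, of n] by (simp add: s_def DX_def)
  have pm: "?F 1 = pds F" "?F 2 = pds (pds F)"
    by (auto simp: numeral_eq_Suc)
  have I0: "Re (?F 0 (?q z)) = 0" and I1: "Re (?F 1 (?q z)) = 0" and I2: "Re (?F 2 (?q z)) = k z * l z" if "z \<in> V" for z
    using F0[OF that] F1[OF that] F2[OF that] pm by (auto simp: s_def)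
  have const: "f' = (\<lambda>v. 0)" if "(f has_derivative f') (at z)" "\<And>z. z \<in> V \<Longrightarrow> f z = 0" "z \<in> V" for f :: "complex \<Rightarrow> real" and f' z
    by (rule has_derivative_unique[OF has_derivative_transform_within_open[OF that(1) V(1) that(3,2)] has_derivative_const])
  have D0: "Re (?F 1 (?q z)) * Re (v / e) + ?D 0 (?q z) (DX z v) = 0" if "z \<in> V" for z v
    using fun_cong[OF const[OF chain[OF that, of 0] I0 that], of v] by simp
  have D1: "Re (?F 2 (?q z)) * Re (v / e) + ?D 1 (?q z) (DX z v) = 0" if "z \<in> V" for z v
    using fun_cong[OF const[OF chain[OF that, of 1] I1 that], of v] by (simp add: numeral_eq_Suc)
  let ?Dk = "\<lambda>z. frechet_derivative k (at z)" and ?Dl = "\<lambda>z. frechet_derivative l (at z)"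
  have D2: "Re (?F 3 (?q z)) * Re (v / e) + ?D 2 (?q z) (DX z v) = k z * ?Dl z v + ?Dk z v * l z" if "z \<in> V" for z v
  proof -
    have a: "((\<lambda>z. k z * l z) has_derivative (\<lambda>v. k z * ?Dl z v + ?Dk z v * l z)) (at z)"
      by (intro has_derivative_mult smooth_on_has_derivative[OF _ that] smooth)
    have b: "((\<lambda>z. k z * l z) has_derivative (\<lambda>v. Re (?F (Suc 2) (?q z)) * Re (v / e) + ?D 2 (?q z) (DX z v))) (at z)"
      by (rule has_derivative_transform_within_open[OF chain[OF that] V(1) that I2])
    from fun_cong[OF has_derivative_unique[OF b a], of v] show ?thesis
      by (simp add: numeral_eq_Suc)
  qed
  have DXe: "DX p e = 0"
    using kernel[OF V(2)] lp \<eta>p by (simp add: DX_def)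
  have q: "?q p = (0, x0)" by (simp add: sp x0_def)
  have Dn0: "?D n (0, x0) 0 = 0" for n
  proof -
    have "linear (frechet_derivative (?F n) (at (0, x0)))"
      using Fp[of n] x0B R by (intro has_derivative_linear[OF smooth_on_has_derivative[of "ball 0 R \<times> B"]]) (auto simp: hol_family_def)
    from linear_0[OF this] show ?thesis by (simp add: zero_prod_def)
  qed
  have F3: "Re (?F 3 (0, x0)) = 0"
    using D2[OF V(2), of e] le lp e unfolding q DXe by (simp add: Dn0)
  let ?\<gamma> = "\<lambda>t::real. p + t *\<^sub>R e"
  define m where "m z = ?Dk z (\<eta> z) - ?D 2 (?q z) (u z)" for z
  have oD: "open (ball (0::complex) R \<times> B)" and sF: "smooth_on (ball 0 R \<times> B) (?F n)" for n
    using Fp[of n] by (auto simp: hol_family_def intro!: open_Times)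
  have sm: "smooth_on V m"
    unfolding m_def
    by (intro smooth_on_diff smooth_on_Re V smooth_on_frechet_apply[OF smooth(1) V(1)] smooth_on_ident smooth
        smooth_on_frechet_apply[OF sF oD] smooth_on_Pair ss X smooth_on_const) (use inB' in auto)
  have rel: "Re (?F 3 (?q z)) * Re (\<eta> z / e) = k z * ?Dl z (\<eta> z) + l z * m z" if "z \<in> V" for z
  proof -
    have "linear (frechet_derivative (?F 2) (at (?q z)))"
      using inB'[OF that] by (intro has_derivative_linear[OF smooth_on_has_derivative[OF sF]]) auto
    from linear_scale[OF this, of "l z" "(0, u z)"] have "?D 2 (?q z) (l z *\<^sub>R u z) = l z * ?D 2 (?q z) (u z)"
      by simp
    then show ?thesis
      using D2[OF that, of "\<eta> z"] kernel[OF that] by (simp add: DX_def m_def algebra_simps)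
  qed
  \<comment> \<open>Along \<open>p + t e\<close> the term \<open>l * m\<close> is of second order,
    as \<open>l\<close> and its derivative in direction \<open>e\<close> vanish at \<open>p\<close>.
    On the left \<open>X\<close> is stationary to first order and the third derivative vanishes at
    \<open>p\<close>, so only the fourth derivative of \<open>F\<close> survives.\<close>
  have F4: "Re (?F 4 (0, x0)) = k p * \<xi>"
  proof -
    have a1: "((\<lambda>t. Re (?F 3 (?q (?\<gamma> t)))) has_real_derivative Re (?F 4 (0, x0))) (at 0)"
      using linear_path_DERIV[OF chain[OF V(2), of 3], of e] e Dn0[of 3] unfolding q DXe
      by (simp add: numeral_eq_Suc)
    have path: "((\<lambda>t. f (?\<gamma> t)) has_real_derivative frechet_derivative f (at p) e) (at 0)" if "smooth_on V f" for f :: "complex \<Rightarrow> real"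
      by (rule linear_path_DERIV[OF smooth_on_has_derivative[OF that V(2)]])
    have s\<eta>: "smooth_on V (\<lambda>z. Re (\<eta> z / e))"
      using e by (intro smooth_intros V smooth)
    have lhs: "((\<lambda>t. Re (?F 3 (?q (?\<gamma> t))) * Re (\<eta> (?\<gamma> t) / e)) has_real_derivative Re (?F 4 (0, x0))) (at 0)"
      using DERIV_mult[OF a1 path[OF s\<eta>]] F3 e \<eta>p by (simp add: sp x0_def)
    have b: "((\<lambda>t. k (?\<gamma> t) * ?Dl (?\<gamma> t) (\<eta> (?\<gamma> t))) has_real_derivative k p * \<xi>) (at 0)"
      using DERIV_mult[OF path[OF smooth(1)] \<xi>(1)] le \<eta>p by (simp add: mult.commute)
    have c: "((\<lambda>t. l (?\<gamma> t) * m (?\<gamma> t)) has_real_derivative 0) (at 0)"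
      using DERIV_mult[OF path[OF smooth(2)] path[OF sm]] le lp by simp
    have "((\<lambda>t. k (?\<gamma> t) * ?Dl (?\<gamma> t) (\<eta> (?\<gamma> t)) + l (?\<gamma> t) * m (?\<gamma> t)) has_real_derivative k p * \<xi>) (at 0)"
      using DERIV_add[OF b c] by simp
    moreover have "open (?\<gamma> -` V)"
      by (intro open_vimage V continuous_intros)
    moreover have "0 \<in> ?\<gamma> -` V" using V by simp
    ultimately have "((\<lambda>t. Re (?F 3 (?q (?\<gamma> t))) * Re (\<eta> (?\<gamma> t) / e)) has_real_derivative k p * \<xi>) (at 0)"
      by (rule has_field_derivative_transform_within_open) (use rel in auto)
    with lhs show ?thesis by (rule DERIV_unique)
  qed
  have van: "Re (?F n (0, x0)) = 0" if "n < 4" for n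
  proof -
    have "n = 0 \<or> n = 1 \<or> n = 2 \<or> n = 3" using that by auto
    then show ?thesis
      using I0[OF V(2)] I1[OF V(2)] I2[OF V(2)] F3 lp unfolding q by auto
  qed
  have ord: "Re (?F 4 (0, x0)) \<noteq> 0"
    using F4 kp \<xi>(2) by simp
  obtain r B' a l0 l1 l2 where r: "r > 0" "r \<le> R" and B': "open B'" "x0 \<in> B'" "B' \<subseteq> B"
    and sa: "smooth_on B' (a :: real \<times> complex \<Rightarrow> quad)" and a0: "a x0 = 0"
    and dbl: "\<And>w x. \<bar>w\<bar> < r \<Longrightarrow> x \<in> B' \<Longrightarrow> Re (F (of_real w, x)) = 0 \<Longrightarrow> Re (pds F (of_real w, x)) = 0
       \<Longrightarrow> quartic (a x) w = 0 \<and> dquartic (a x) w = 0"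
    and l0: "l0 \<noteq> 0"
    and P0: "\<And>Y. Re (frechet_derivative F (at (0, x0)) (0, Y)) = l0 * q0 (frechet_derivative a (at x0) Y)"
    and P1: "\<And>Y. Re (frechet_derivative (pds F) (at (0, x0)) (0, Y))
        = l0 * q1 (frechet_derivative a (at x0) Y) + l1 * q0 (frechet_derivative a (at x0) Y)"
    and P2: "\<And>Y. Re (frechet_derivative (pds (pds F)) (at (0, x0)) (0, Y))
        = 2 * l0 * q2 (frechet_derivative a (at x0) Y) + 2 * l1 * q1 (frechet_derivative a (at x0) Y)
          + l2 * q0 (frechet_derivative a (at x0) Y)"
    by (rule preparation_order_four[OF F R x0B van ord]) blast+
  let ?a' = "frechet_derivative a (at x0)"
  have da: "(a has_derivative ?a') (at x0)"
    by (rule smooth_on_has_derivative[OF sa B'(2)])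
  \<comment> \<open>The direction \<open>\<i> * e\<close> leaves \<open>Re ((z - p) / e)\<close>
    unchanged, so the identities along the graph isolate the parameter derivatives of
    \<open>F\<close>.\<close>
  define Y0 where "Y0 = DX p (\<i> * e)"
  have Y0: "q0 (?a' Y0) = 0" "q1 (?a' Y0) = 0" "q2 (?a' Y0) \<noteq> 0"
  proof -
    have ie: "Re (\<i> * e / e) = 0" using e by simp
    show z0: "q0 (?a' Y0) = 0"
      using D0[OF V(2), of "\<i> * e"] P0[of Y0] l0 unfolding q ie by (simp add: Y0_def)
    show z1: "q1 (?a' Y0) = 0"
      using D1[OF V(2), of "\<i> * e"] P1[of Y0] z0 l0 unfolding q ie by (simp add: Y0_def)
    show "q2 (?a' Y0) \<noteq> 0"
      using D2[OF V(2), of "\<i> * e"] P2[of Y0] z0 z1 kp lie lp unfolding q ie by (auto simp: Y0_def numeral_eq_Suc)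
  qed
  \<comment> \<open>The shift \<open>qc\<close> is left out of the target coordinates: translating
    the variable of the quartic does not change whether it has a double root. It reappears in the
    source coordinate \<kappa>.\<close>
  define \<Psi>1 where "\<Psi>1 x = (q2 (a x), Complex (q1 (a x)) (q0 (a x)))" for x
  have s\<Psi>1: "smooth_on B' \<Psi>1"
    unfolding \<Psi>1_def by (intro smooth_intros B' sa)
  have d\<Psi>1: "frechet_derivative \<Psi>1 (at x0) = (\<lambda>Y. (q2 (?a' Y), Complex (q1 (?a' Y)) (q0 (?a' Y))))"
  proof (rule frechet_derivative_at[symmetric])
    show "(\<Psi>1 has_derivative (\<lambda>Y. (q2 (?a' Y), Complex (q1 (?a' Y)) (q0 (?a' Y))))) (at x0)"
      unfolding \<Psi>1_def Complex_eq
      by (intro has_derivative_Pair has_derivative_add has_derivative_mult_right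
          bounded_linear.has_derivative[OF bounded_linear_of_real] bounded_linear.has_derivative[OF quad_linear(10) da]
          bounded_linear.has_derivative[OF quad_linear(11) da] bounded_linear.has_derivative[OF quad_linear(12) da])
  qed
  \<comment> \<open>If \<open>q0\<close> and \<open>q1\<close> vanish on \<open>?a' Y\<close>,
    versality puts \<open>Y\<close> on the line spanned by \<open>Y0\<close>, where
    \<open>q2\<close> detects it.\<close>
  have inj\<Psi>: "Y = 0" if "frechet_derivative \<Psi>1 (at x0) Y = 0" for Y
  proof -
    have z: "q2 (?a' Y) = 0" "q1 (?a' Y) = 0" "q0 (?a' Y) = 0"
      using that unfolding d\<Psi>1 by (auto simp: zero_prod_def complex_eq_iff)
    then obtain c where c: "Y = c *\<^sub>R Y0"
      using vers[of Y] P0[of Y] P1[of Y] by (auto simp: Y0_def DX_def x0_def)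
    have "?a' Y = c *\<^sub>R ?a' Y0"
      unfolding c by (rule linear_scale[OF has_derivative_linear[OF da]])
    then have "c = 0" using z(1) Y0(3) by simp
    then show "Y = 0" using c by simp
  qed
  obtain N Z g where N: "open N" "x0 \<in> N" "N \<subseteq> B'" and Z: "open Z" "\<Psi>1 x0 \<in> Z"
    and hom1: "homeomorphism N Z \<Psi>1 g" and sg: "smooth_on Z g"
    by (rule smooth_local_inverse[OF B'(1) s\<Psi>1 B'(2) inj\<Psi>]) blast+
  define V1 where "V1 = V \<inter> (X -` N \<inter> V) \<inter> (s -` ball 0 r \<inter> V)"
  have "open (X -` N \<inter> V)" "open (s -` ball 0 r \<inter> V)"
    using smooth_on_imp_continuous_on[OF X] smooth_on_imp_continuous_on[OF ss] N(1)
    unfolding continuous_on_open_vimage[OF V(1)] by blast+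
  then have V1: "open V1" "p \<in> V1" "V1 \<subseteq> V"
    using V N r sp by (auto simp: V1_def x0_def[symmetric])
  have XB': "X z \<in> B'" if "z \<in> V1" for z using that N by (auto simp: V1_def)
  \<comment> \<open>The coordinates of the model: the coefficient \<open>q2\<close> and the double
    root in the shifted variable.\<close>
  define \<kappa> where "\<kappa> z = Complex (q2 (a (X z))) (Re ((z - p) / e) + qc (a (X z)))" for z
  have saX: "smooth_on V1 (\<lambda>z. a (X z))"
    by (rule smooth_on_compose[OF sa B'(1) V1(1) smooth_on_subset[OF X V1(3)] XB'])
  have s\<kappa>: "smooth_on V1 \<kappa>"
    unfolding \<kappa>_def using e by (intro smooth_intros saX V1)
  have d\<kappa>: "frechet_derivative \<kappa> (at p) = (\<lambda>v. Complex (q2 (?a' (DX p v))) (Re (v / e) + qc (?a' (DX p v))))"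
  proof (rule frechet_derivative_at[symmetric])
    have daX: "((\<lambda>z. a (X z)) has_derivative (\<lambda>v. ?a' (DX p v))) (at p)"
      using has_derivative_compose[OF smooth_on_has_derivative[OF X V(2)]] da by (simp add: x0_def DX_def)
    have "((\<lambda>z. (z - p) / e) has_derivative (\<lambda>v. v / e)) (at p)"
      using e by (auto intro!: derivative_eq_intros)
    then show "(\<kappa> has_derivative (\<lambda>v. Complex (q2 (?a' (DX p v))) (Re (v / e) + qc (?a' (DX p v))))) (at p)"
      unfolding \<kappa>_def Complex_eq
      by (intro has_derivative_add has_derivative_mult_right bounded_linear.has_derivative[OF bounded_linear_of_real]
          bounded_linear.has_derivative[OF bounded_linear_Re]
          bounded_linear.has_derivative[OF quad_linear(10) daX] bounded_linear.has_derivative[OF quad_linear(9) daX])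
  qed
  have inj\<kappa>: "v = 0" if "frechet_derivative \<kappa> (at p) v = 0" for v
  proof -
    have lX: "linear (DX p)"
      using smooth_on_has_derivative[OF X V(2)] has_derivative_linear unfolding DX_def by blast
    have v: "v = Re (v / e) *\<^sub>R e + Im (v / e) *\<^sub>R (\<i> * e)"
    proof -
      have "v = v / e * e" using e by simp
      also have "\<dots> = (of_real (Re (v / e)) + \<i> * of_real (Im (v / e))) * e"
        by (metis complex_eq)
      finally show ?thesis by (simp add: scaleR_conv_of_real algebra_simps)
    qed
    have DXv: "DX p v = Im (v / e) *\<^sub>R Y0"
      by (subst v) (simp only: linear_add[OF lX] linear_scale[OF lX] DXe Y0_def scaleR_zero_right add_0)
    have z: "q2 (?a' (DX p v)) = 0" "Re (v / e) + qc (?a' (DX p v)) = 0"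
      using that unfolding d\<kappa> by (auto simp: complex_eq_iff)
    have "?a' (DX p v) = Im (v / e) *\<^sub>R ?a' Y0"
      unfolding DXv by (rule linear_scale[OF has_derivative_linear[OF da]])
    then have i: "Im (v / e) = 0" using z(1) Y0(3) by simp
    then have "DX p v = 0" using DXv by simp
    then have "Re (v / e) = 0"
      using z(2) linear_0[OF has_derivative_linear[OF da]] by simp
    then show "v = 0" using v i by simp
  qed
  obtain V' W \<phi> where V': "open V'" "p \<in> V'" "V' \<subseteq> V1" and W: "open W" "\<kappa> p \<in> W"
    and hom2: "homeomorphism V' W \<kappa> \<phi>" and s\<phi>: "smooth_on W \<phi>"
    by (rule smooth_local_inverse[OF V1(1) s\<kappa> V1(2) inj\<kappa>]) blast+
  have \<kappa>p: "\<kappa> p = 0" using a0 by (simp add: \<kappa>_def x0_def[symmetric] complex_eq_iff)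
  have \<phi>: "\<phi> w \<in> V'" "\<kappa> (\<phi> w) = w" if "w \<in> W" for w
    using hom2 that by (auto simp: homeomorphism_def)
  have g: "g (\<Psi>1 x) = x" "\<Psi>1 x \<in> Z" if "x \<in> N" for x
    using hom1 that by (auto simp: homeomorphism_def)
  define \<Psi> where "\<Psi> x = to_R3 (\<Psi>1 x)" for x
  define \<theta> where "\<theta> y = g (of_R3 y)" for y
  have im: "\<Psi> ` N = of_R3 -` Z"
  proof
    show "\<Psi> ` N \<subseteq> of_R3 -` Z" using g by (auto simp: \<Psi>_def)
    show "of_R3 -` Z \<subseteq> \<Psi> ` N"
    proof
      fix y assume "y \<in> of_R3 -` Z"
      then have "of_R3 y \<in> \<Psi>1 ` N" using hom1 by (auto simp: homeomorphism_def)
      then show "y \<in> \<Psi> ` N" unfolding \<Psi>_def by (metis R3_inverse(2) imageE imageI)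
    qed
  qed
  have oim: "open (\<Psi> ` N)"
    unfolding im by (intro open_vimage Z linear_continuous_on bounded_linear_R3)
  show ?thesis
  proof (rule that)
    show "V' \<subseteq> V" "p \<in> V'" "0 \<in> W" "open N" "N \<subseteq> B" "open (\<Psi> ` N)"
      using V' V1 W \<kappa>p N B' oim by auto
    show "diffeo_on \<phi> W V'"
      by (rule homeomorphism_smooth_imp_diffeo_on[OF W(1) V'(1) _ s\<phi> smooth_on_subset[OF s\<kappa> V'(3)]])
        (use hom2 in \<open>simp add: homeomorphism_symD\<close>)
    show "\<phi> 0 = p"
      using hom2 V'(2) \<kappa>p by (metis homeomorphism_apply1)
    show "smooth_on N \<Psi>"
      unfolding \<Psi>_def
      by (intro smooth_on_bounded_linear[OF bounded_linear_R3(1)] N smooth_on_subset[OF s\<Psi>1])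
    show "inj_on \<Psi> N"
      by (rule inj_on_inverseI[of _ "\<lambda>y. g (of_R3 y)"]) (simp add: \<Psi>_def g)
    show "smooth_on (\<Psi> ` N) \<theta>"
      unfolding \<theta>_def
      by (rule smooth_on_compose[OF sg Z(1) oim smooth_on_bounded_linear[OF bounded_linear_R3(2) oim smooth_on_ident[OF oim]]])
        (auto simp: im)
    show "\<theta> (\<Psi> x) = x" if "x \<in> N" for x
      using g that by (simp add: \<theta>_def \<Psi>_def)
    show "\<Psi> (X p) = 0"
      using a0 by (simp add: \<Psi>_def \<Psi>1_def x0_def[symmetric] to_R3_def vec_eq_iff forall_3)
    show "X (\<phi> w) \<in> N \<and> \<Psi> (X (\<phi> w)) = swallowtail_model w" if "w \<in> W" for w
    proof -
      let ?z = "\<phi> w"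
      have z: "?z \<in> V1" "?z \<in> V" using \<phi>[OF that] V' V1 by auto
      then have N': "X ?z \<in> N" and r': "\<bar>Re ((?z - p) / e)\<bar> < r"
        by (auto simp: V1_def s_def)
      have "quartic (a (X ?z)) (Re ((?z - p) / e)) = 0 \<and> dquartic (a (X ?z)) (Re ((?z - p) / e)) = 0"
        by (rule dbl[OF r' XB'[OF z(1)] F0[OF z(2)] F1[OF z(2)]])
      then have "swallowtail_model (\<kappa> ?z) = \<Psi> (X ?z)"
        unfolding \<kappa>_def \<Psi>_def \<Psi>1_def using quartic_double_root by blast
      then show ?thesis using N' \<phi>(2)[OF that] by simp
    qed
  qed
qed

section \<open>Polarised products\<close>

lemma hol_family_frechet_fst:
  assumes "hol_family D B F" "s \<in> D" "x \<in> B"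
  shows "frechet_derivative F (at (s, x)) (v, 0) = pds F (s, x) * v"
proof -
  have "(F has_derivative frechet_derivative F (at (s, x))) (at (s, x))"
    using assms by (intro smooth_on_has_derivative[of "D \<times> B"]) (auto simp: hol_family_def)
  from fun_cong[OF has_derivative_unique[OF has_derivative_fst_arg[OF this]
      hol_family_DERIV[OF assms, unfolded has_field_derivative_def]], of v]
  show ?thesis .
qed

lemma pds_eqI:
  assumes "hol_family D B F" "s \<in> D" "x \<in> B" "((\<lambda>s. F (s, x)) has_field_derivative d) (at s)"
  shows "pds F (s, x) = d"
  using DERIV_unique[OF hol_family_DERIV[OF assms(1-3)] assms(4)] .

text \<open>Complex linearity in the two complex variables, with the coefficient functions recorded
  so that second derivatives can be formed by iteration; on the real parameters nothing but
  differentiability is asked.\<close>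

definition pdiff :: "(complex \<times> complex \<times> 'x::euclidean_space) set \<Rightarrow> (complex \<times> complex \<times> 'x \<Rightarrow> complex)
    \<Rightarrow> (complex \<times> complex \<times> 'x \<Rightarrow> complex) \<Rightarrow> (complex \<times> complex \<times> 'x \<Rightarrow> complex) \<Rightarrow> bool" where
  "pdiff S H Ht Hs \<longleftrightarrow> (\<forall>q\<in>S. \<exists>D. (H has_derivative D) (at q) \<and> (\<forall>\<tau> \<sigma>. D (\<tau>, \<sigma>, 0) = Ht q * \<tau> + Hs q * \<sigma>))"

lemma pdiff_frechet: "pdiff S H Ht Hs \<Longrightarrow> q \<in> S \<Longrightarrow> frechet_derivative H (at q) (\<tau>, \<sigma>, 0) = Ht q * \<tau> + Hs q * \<sigma>"
  unfolding pdiff_def using frechet_derivative_at by metis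

lemma pdiff_cong:
  "pdiff S H Ht Hs \<Longrightarrow> (\<And>q. H q = H' q) \<Longrightarrow> (\<And>q. Ht q = Ht' q) \<Longrightarrow> (\<And>q. Hs q = Hs' q) \<Longrightarrow> pdiff S H' Ht' Hs'"
proof -
  assume "pdiff S H Ht Hs" "\<And>q. H q = H' q" "\<And>q. Ht q = Ht' q" "\<And>q. Hs q = Hs' q"
  moreover from this have "H = H'" "Ht = Ht'" "Hs = Hs'" by auto
  ultimately show ?thesis by simp
qed

lemma pdiff_add:
  assumes "pdiff S H Ht Hs" "pdiff S K Kt Ks"
  shows "pdiff S (\<lambda>q. H q + K q) (\<lambda>q. Ht q + Kt q) (\<lambda>q. Hs q + Ks q)"
  unfolding pdiff_def
proof
  fix q assume "q \<in> S"
  then obtain D D' where "(H has_derivative D) (at q)" "\<forall>\<tau> \<sigma>. D (\<tau>, \<sigma>, 0) = Ht q * \<tau> + Hs q * \<sigma>"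
    "(K has_derivative D') (at q)" "\<forall>\<tau> \<sigma>. D' (\<tau>, \<sigma>, 0) = Kt q * \<tau> + Ks q * \<sigma>"
    using assms unfolding pdiff_def by blast
  then show "\<exists>D. ((\<lambda>q. H q + K q) has_derivative D) (at q) \<and>
      (\<forall>\<tau> \<sigma>. D (\<tau>, \<sigma>, 0) = (Ht q + Kt q) * \<tau> + (Hs q + Ks q) * \<sigma>)"
    by (intro exI[of _ "\<lambda>v. D v + D' v"] conjI has_derivative_add) (auto simp: algebra_simps)
qed

lemma pdiff_cmult:
  assumes "pdiff S H Ht Hs"
  shows "pdiff S (\<lambda>q. c * H q) (\<lambda>q. c * Ht q) (\<lambda>q. c * Hs q)"
  unfolding pdiff_def
proof
  fix q assume "q \<in> S"
  then obtain D where "(H has_derivative D) (at q)" "\<forall>\<tau> \<sigma>. D (\<tau>, \<sigma>, 0) = Ht q * \<tau> + Hs q * \<sigma>"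
    using assms unfolding pdiff_def by blast
  then show "\<exists>D. ((\<lambda>q. c * H q) has_derivative D) (at q) \<and>
      (\<forall>\<tau> \<sigma>. D (\<tau>, \<sigma>, 0) = c * Ht q * \<tau> + c * Hs q * \<sigma>)"
    by (intro exI[of _ "\<lambda>v. c * D v"] conjI has_derivative_mult_right) (auto simp: algebra_simps)
qed

lemma pdiff_parameter:
  assumes "bounded_linear L"
  shows "pdiff S (\<lambda>q. L (snd (snd q))) (\<lambda>q. 0) (\<lambda>q. 0)"
  unfolding pdiff_def
proof
  fix q assume "q \<in> S"
  show "\<exists>D. ((\<lambda>q. L (snd (snd q))) has_derivative D) (at q) \<and> (\<forall>\<tau> \<sigma>. D (\<tau>, \<sigma>, 0) = 0 * \<tau> + 0 * \<sigma>)"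
    by (intro exI[of _ "\<lambda>v. L (snd (snd v))"] conjI bounded_linear.has_derivative[OF assms]
        bounded_linear.has_derivative[OF bounded_linear_snd] has_derivative_ident)
      (simp add: linear_0[OF bounded_linear.linear[OF assms]])
qed

text \<open>For real \<open>s\<close> and \<open>t\<close> this is \<open>f(z) cnj (g(z))\<close> at \<open>z = p + e(s + \<i>t)\<close>; it is holomorphic in
  \<open>(t, s)\<close>.\<close>

definition polar :: "complex \<Rightarrow> complex \<Rightarrow> (complex \<times> 'x \<Rightarrow> complex) \<Rightarrow> (complex \<times> 'x \<Rightarrow> complex)
    \<Rightarrow> complex \<times> complex \<times> 'x \<Rightarrow> complex" where
  "polar p e f g q = f (p + e * (fst (snd q) + \<i> * fst q), snd (snd q))
     * cnj (g (p + e * (cnj (fst (snd q)) + \<i> * cnj (fst q)), snd (snd q)))"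

definition polar_dom :: "complex \<Rightarrow> complex \<Rightarrow> complex set \<Rightarrow> 'x set \<Rightarrow> (complex \<times> complex \<times> 'x) set" where
  "polar_dom p e D B = {q. p + e * (fst (snd q) + \<i> * fst q) \<in> D \<and>
     p + e * (cnj (fst (snd q)) + \<i> * cnj (fst q)) \<in> D \<and> snd (snd q) \<in> B}"

lemma open_polar_dom:
  assumes "open D" "open B"
  shows "open (polar_dom p e D B)"
proof -
  have "polar_dom p e D B = (\<lambda>q. p + e * (fst (snd q) + \<i> * fst q)) -` D
      \<inter> (\<lambda>q. p + e * (cnj (fst (snd q)) + \<i> * cnj (fst q))) -` D \<inter> (\<lambda>q. snd (snd q)) -` B"
    by (auto simp: polar_dom_def)
  also have "open \<dots>"
    by (intro open_Int open_vimage assms continuous_intros)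
  finally show ?thesis .
qed

lemma smooth_on_polar:
  fixes f g :: "complex \<times> 'x::euclidean_space \<Rightarrow> complex"
  assumes "hol_family D B f" "hol_family D B g"
  shows "smooth_on (polar_dom p e D B) (polar p e f g)"
proof -
  have o: "open D" "open B" and s: "smooth_on (D \<times> B) f" "smooth_on (D \<times> B) g"
    using assms by (auto simp: hol_family_def)
  note oo = open_polar_dom[OF o, of p e]
  have DB: "open (D \<times> B)" by (intro open_Times o)
  show ?thesis
    unfolding polar_def
    by (intro smooth_on_mult smooth_on_cnj oo smooth_on_compose[OF s(1) DB oo] smooth_on_compose[OF s(2) DB oo]
        smooth_on_Pair smooth_on_add smooth_on_const smooth_on_fst smooth_on_snd smooth_on_ident)
      (auto simp: polar_dom_def)
qed

text \<open>The inner and outer conjugations cancel, so the second factor is complex differentiable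
  as well; it contributes \<open>cnj e\<close> in direction \<open>s\<close> and, since
  \<open>cnj \<i> = - \<i>\<close>, the factor \<open>- \<i> * cnj e\<close> in direction
  \<open>t\<close>.\<close>

lemma pdiff_polar:
  fixes f g :: "complex \<times> 'x::euclidean_space \<Rightarrow> complex"
  assumes f: "hol_family D B f" and g: "hol_family D B g"
  shows "pdiff (polar_dom p e D B) (polar p e f g)
    (\<lambda>q. \<i> * (e * polar p e (pds f) g q - cnj e * polar p e f (pds g) q))
    (\<lambda>q. e * polar p e (pds f) g q + cnj e * polar p e f (pds g) q)"
  unfolding pdiff_def
proof
  fix q :: "complex \<times> complex \<times> 'x"
  assume q: "q \<in> polar_dom p e D B"
  let ?z = "(p + e * (fst (snd q) + \<i> * fst q), snd (snd q))"
  let ?w = "(p + e * (cnj (fst (snd q)) + \<i> * cnj (fst q)), snd (snd q))"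
  have zw: "?z \<in> D \<times> B" "?w \<in> D \<times> B" using q by (auto simp: polar_dom_def)
  have df: "(f has_derivative frechet_derivative f (at ?z)) (at ?z)"
    using f zw(1) by (intro smooth_on_has_derivative[of "D \<times> B"]) (auto simp: hol_family_def)
  have dg: "(g has_derivative frechet_derivative g (at ?w)) (at ?w)"
    using g zw(2) by (intro smooth_on_has_derivative[of "D \<times> B"]) (auto simp: hol_family_def)
  have 1: "((\<lambda>q. (p + e * (fst (snd q) + \<i> * fst q), snd (snd q))) has_derivative
      (\<lambda>v. (e * (fst (snd v) + \<i> * fst v), snd (snd v)))) (at q)"
    by (auto intro!: derivative_eq_intros)
  have 2: "((\<lambda>q. (p + e * (cnj (fst (snd q)) + \<i> * cnj (fst q)), snd (snd q))) has_derivative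
      (\<lambda>v. (e * (cnj (fst (snd v)) + \<i> * cnj (fst v)), snd (snd v)))) (at q)"
    by (auto intro!: derivative_eq_intros)
  note d = has_derivative_mult[OF has_derivative_compose[OF 1 df]
      bounded_linear.has_derivative[OF bounded_linear_cnj has_derivative_compose[OF 2 dg]]]
  show "\<exists>D. (polar p e f g has_derivative D) (at q) \<and> (\<forall>\<tau> \<sigma>. D (\<tau>, \<sigma>, 0) =
       \<i> * (e * polar p e (pds f) g q - cnj e * polar p e f (pds g) q) * \<tau>
       + (e * polar p e (pds f) g q + cnj e * polar p e f (pds g) q) * \<sigma>)"
    unfolding polar_def
    by (rule exI, rule conjI, rule d)
      (use hol_family_frechet_fst[OF f] hol_family_frechet_fst[OF g] zw in \<open>simp add: algebra_simps\<close>)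
qed

section \<open>The swallowtail normal form of a flat front\<close>

text \<open>The entries \<open>a, b, c, d\<close> of the frame, normalised to the identity at \<open>p\<close>. The sign \<open>\<epsilon>\<close> is
  \<open>1\<close> for the front in hyperbolic space and \<open>-1\<close> for the one in de Sitter space; the front is
  \<open>A diag(1, \<epsilon>) A*\<close> and \<open>1 / r\<close> spans its null direction along the singular set.\<close>

locale flat_frame =
  fixes U :: "complex set" and p :: complex and \<alpha> \<beta> a b c d r :: "complex \<Rightarrow> complex" and \<epsilon> :: real
  assumes U: "open U" "p \<in> U"
    and hol: "\<alpha> holomorphic_on U" "\<beta> holomorphic_on U" "r holomorphic_on U"
    and da: "\<And>z. z \<in> U \<Longrightarrow> (a has_field_derivative \<beta> z * b z) (at z)"
    and db: "\<And>z. z \<in> U \<Longrightarrow> (b has_field_derivative \<alpha> z * a z) (at z)"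
    and dc: "\<And>z. z \<in> U \<Longrightarrow> (c has_field_derivative \<beta> z * d z) (at z)"
    and dd: "\<And>z. z \<in> U \<Longrightarrow> (d has_field_derivative \<alpha> z * c z) (at z)"
    and det: "\<And>z. z \<in> U \<Longrightarrow> a z * d z - b z * c z = 1"
    and init: "a p = 1" "b p = 0" "c p = 0" "d p = 1"
    and nz: "\<And>z. z \<in> U \<Longrightarrow> \<alpha> z \<noteq> 0 \<and> \<beta> z \<noteq> 0"
    and r2: "\<And>z. z \<in> U \<Longrightarrow> r z ^ 2 = - of_real \<epsilon> * \<alpha> z * \<beta> z"
    and \<epsilon>: "\<epsilon> = 1 \<or> \<epsilon> = -1"
    and lp: "lam \<alpha> \<beta> p = 0"
begin

lemma \<epsilon>2 [simp]: "\<epsilon> * \<epsilon> = 1" "of_real \<epsilon> * of_real \<epsilon> = (1::complex)" "\<epsilon> \<noteq> 0"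
  using \<epsilon> by auto

lemma r_nz: "z \<in> U \<Longrightarrow> r z \<noteq> 0"
  using r2[of z] nz[of z] by auto

lemma hol_abcd: "a holomorphic_on U" "b holomorphic_on U" "c holomorphic_on U" "d holomorphic_on U"
  using da db dc dd U(1) holomorphic_on_open by blast+

lemma smooth_data [smooth_intros]:
  "smooth_on U \<alpha>" "smooth_on U \<beta>" "smooth_on U r" "smooth_on U a" "smooth_on U b" "smooth_on U c" "smooth_on U d"
  using hol hol_abcd U(1) smooth_on_holomorphic by blast+

lemma lam_eq: "lam \<alpha> \<beta> z = Re (\<alpha> z * cnj (\<alpha> z)) - Re (\<beta> z * cnj (\<beta> z))"
  unfolding lam_def cmod_power2 by (simp add: power2_eq_square)

lemma smooth_lam: "smooth_on U (lam \<alpha> \<beta>)"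
  unfolding lam_eq[abs_def] by (intro smooth_intros U(1))

text \<open>The first row of the Hermitian matrix; the determinant \<epsilon> fixes the remaining
  entry as long as the first coordinate is not 0.\<close>

definition X :: "complex \<Rightarrow> real \<times> complex" where
  "X z = (Re (a z * cnj (a z)) + \<epsilon> * Re (b z * cnj (b z)), a z * cnj (c z) + of_real \<epsilon> * b z * cnj (d z))"

lemma smooth_X: "smooth_on U X"
  unfolding X_def by (intro smooth_intros U(1))

lemma X_p: "X p = (1, 0)"
  by (simp add: X_def init)

text \<open>Pulled back by the frame, the differential of the front is a Hermitian matrix with zero
  diagonal. This is its lower left entry, so its zeros form the kernel.\<close>

definition om :: "complex \<Rightarrow> complex \<Rightarrow> complex" where
  "om z v = \<beta> z * v + of_real \<epsilon> * cnj (\<alpha> z * v)"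

definition dX :: "complex \<Rightarrow> complex \<Rightarrow> real \<times> complex" where
  "dX z w = (2 * Re (cnj (a z) * b z * w), b z * cnj (c z) * w + a z * cnj (d z) * cnj w)"

lemma X_derivative:
  assumes z: "z \<in> U"
  shows "frechet_derivative X (at z) = (\<lambda>v. dX z (om z v))"
proof (rule frechet_derivative_at[symmetric])
  note D = da[OF z, unfolded has_field_derivative_def] db[OF z, unfolded has_field_derivative_def]
    dc[OF z, unfolded has_field_derivative_def] dd[OF z, unfolded has_field_derivative_def]
  note C = bounded_linear.has_derivative[OF bounded_linear_cnj]
  have 1: "((\<lambda>z. Re (f z * cnj (f z))) has_derivative (\<lambda>v. 2 * Re (cnj (f z) * (f' * v)))) (at z)"
    if "(f has_derivative (*) f') (at z)" for f f'
    using bounded_linear.has_derivative[OF bounded_linear_Re has_derivative_mult[OF that C[OF that]]]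
    by (rule has_derivative_eq_rhs) (auto simp: algebra_simps)
  have 2: "((\<lambda>z. f z * cnj (g z)) has_derivative (\<lambda>v. f z * cnj (g' * v) + f' * v * cnj (g z))) (at z)"
    if "(f has_derivative (*) f') (at z)" "(g has_derivative (*) g') (at z)" for f f' g g'
    by (rule has_derivative_mult[OF that(1) C[OF that(2)]])
  have "(X has_derivative (\<lambda>v. (2 * Re (cnj (a z) * (\<beta> z * b z * v)) + \<epsilon> * (2 * Re (cnj (b z) * (\<alpha> z * a z * v))),
      a z * cnj (\<beta> z * d z * v) + \<beta> z * b z * v * cnj (c z)
       + of_real \<epsilon> * (b z * cnj (\<alpha> z * c z * v) + \<alpha> z * a z * v * cnj (d z))))) (at z)"
    unfolding X_def mult.assoc[of "of_real \<epsilon>"]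
    by (intro has_derivative_Pair has_derivative_add has_derivative_mult_right 1 2 D)
  then show "(X has_derivative (\<lambda>v. dX z (om z v))) (at z)"
  proof (rule has_derivative_eq_rhs, intro ext prod_eqI)
    fix v
    have "Re (cnj (a z) * b z * om z v) = Re (cnj (a z) * (\<beta> z * b z * v)) + \<epsilon> * Re (cnj (b z) * (\<alpha> z * a z * v))"
      by (simp add: om_def algebra_simps)
    then show "fst (2 * Re (cnj (a z) * (\<beta> z * b z * v)) + \<epsilon> * (2 * Re (cnj (b z) * (\<alpha> z * a z * v))),
      a z * cnj (\<beta> z * d z * v) + \<beta> z * b z * v * cnj (c z)
       + of_real \<epsilon> * (b z * cnj (\<alpha> z * c z * v) + \<alpha> z * a z * v * cnj (d z))) = fst (dX z (om z v))"
      by (simp add: dX_def)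
    show "snd (2 * Re (cnj (a z) * (\<beta> z * b z * v)) + \<epsilon> * (2 * Re (cnj (b z) * (\<alpha> z * a z * v))),
      a z * cnj (\<beta> z * d z * v) + \<beta> z * b z * v * cnj (c z)
       + of_real \<epsilon> * (b z * cnj (\<alpha> z * c z * v) + \<alpha> z * a z * v * cnj (d z))) = snd (dX z (om z v))"
      by (simp add: dX_def om_def algebra_simps)
  qed
qed

text \<open>The null direction at \<open>p\<close>; source points are written
  \<open>p + e * (s + \<i> * t)\<close>.\<close>

definition e :: complex where "e = inverse (r p)"

lemma e_nz: "e \<noteq> 0"
  using r_nz U by (simp add: e_def)

lemma e_sq: "of_real \<epsilon> * (\<alpha> p * \<beta> p) * e ^ 2 = -1"
proof -
  have "of_real \<epsilon> * (\<alpha> p * \<beta> p) = - (r p ^ 2)"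
    using r2[OF U(2)] by simp
  then show ?thesis
    using r_nz[OF U(2)] by (simp add: e_def power_inverse)
qed

lemma norm_\<alpha>\<beta>: "norm (\<alpha> p) = norm (\<beta> p)"
  using lp power2_eq_iff_nonneg[of "norm (\<alpha> p)" "norm (\<beta> p)"] by (simp add: lam_def)

lemma norm_e\<beta>: "norm (e * \<beta> p) = 1"
proof -
  have "norm (of_real \<epsilon> * (\<alpha> p * \<beta> p) * e ^ 2) = 1"
    unfolding e_sq by simp
  then have "(norm (e * \<beta> p)) ^ 2 = 1"
    using \<epsilon> by (auto simp: norm_mult norm_power norm_\<alpha>\<beta> power2_eq_square mult_ac)
  then have "(norm (e * \<beta> p)) ^ 2 = 1 ^ 2" by simp
  then show ?thesis by (rule power2_eq_imp_eq) auto
qed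

text \<open>This is \<open>om p e = 0\<close> in conjugated form. The product of
  \<open>\<epsilon> * \<alpha> p * e\<close> and \<open>\<beta> p * e\<close> is -1, and the second
  factor is unimodular.\<close>

lemma null_e: "of_real \<epsilon> * (\<alpha> p * e) = - cnj (\<beta> p * e)"
proof -
  have 1: "(\<beta> p * e) * cnj (\<beta> p * e) = 1"
    using norm_e\<beta> by (simp add: complex_norm_square[symmetric] mult.commute[of e] del: complex_cnj_mult)
  have "of_real \<epsilon> * (\<alpha> p * e) * (\<beta> p * e) = - ((\<beta> p * e) * cnj (\<beta> p * e))"
    unfolding 1 using e_sq by (simp add: power2_eq_square mult_ac)
  then have "(of_real \<epsilon> * (\<alpha> p * e) + cnj (\<beta> p * e)) * (\<beta> p * e) = 0"
    by (simp only: distrib_right) (simp add: algebra_simps)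
  then show ?thesis
    using e_nz nz[OF U(2)] by (simp only: mult_eq_0_iff eq_neg_iff_add_eq_0) auto
qed

definition B0 :: "(real \<times> complex) set" where "B0 = {x. fst x > 0}"

lemma open_B0: "open B0"
proof -
  have "B0 = fst -` {0<..}" by (auto simp: B0_def)
  moreover have "open (fst -` {0<..} :: (real \<times> complex) set)"
    by (intro open_vimage continuous_intros open_greaterThan)
  ultimately show ?thesis by simp
qed

definition fa :: "complex \<times> (real \<times> complex) \<Rightarrow> complex" where "fa q = a (fst q)"

text \<open>For \<open>x = (m, n)\<close>, multiplying the quadratic form of \<open>adj(X)\<close>
  at the column \<open>(a, c)\<close> by \<open>m\<close> clears the entry
  \<open>(\<epsilon> + |n|^2) / m\<close> and completes the square: the result is
  \<open>|fU|^2 + \<epsilon> |fa|^2\<close>.\<close>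

definition fU :: "complex \<times> (real \<times> complex) \<Rightarrow> complex" where
  "fU q = cnj (snd (snd q)) * a (fst q) - of_real (fst (snd q)) * c (fst q)"

lemma hol_family_fa: "hol_family U B0 fa" and hol_family_fU: "hol_family U B0 fU"
proof -
  have o: "open (U \<times> B0)" by (intro open_Times U(1) open_B0)
  have s: "smooth_on (U \<times> B0) (\<lambda>q. g (fst q))" if "smooth_on U g" for g :: "complex \<Rightarrow> complex"
    by (rule smooth_on_compose[OF that U(1) o]) (use o in \<open>auto intro!: smooth_intros\<close>)
  show "hol_family U B0 fa"
    unfolding hol_family_def fa_def using U(1) open_B0 hol_abcd s smooth_data by auto
  have "smooth_on (U \<times> B0) (\<lambda>q. cnj (snd (snd q)) * a (fst q) - of_real (fst (snd q)) * c (fst q))"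
    by (intro smooth_on_diff smooth_on_mult smooth_on_cnj smooth_on_of_real smooth_on_fst smooth_on_snd
        smooth_on_ident o s smooth_data)
  then show "hol_family U B0 fU"
    unfolding hol_family_def fU_def using U(1) open_B0 hol_abcd by (auto intro!: holomorphic_intros)
qed

lemma deriv_\<beta>: "z \<in> U \<Longrightarrow> (\<beta> has_field_derivative deriv \<beta> z) (at z)"
  using holomorphic_derivI[OF hol(2) U(1)] .

lemma pds_fa: "z \<in> U \<Longrightarrow> x \<in> B0 \<Longrightarrow> pds fa (z, x) = \<beta> z * b z"
  by (rule pds_eqI[OF hol_family_fa]) (auto simp: fa_def da)

lemma pds_fU: "z \<in> U \<Longrightarrow> x \<in> B0 \<Longrightarrow> pds fU (z, x) = \<beta> z * (cnj (snd x) * b z - of_real (fst x) * d z)"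
  by (rule pds_eqI[OF hol_family_fU]) (auto simp: fU_def algebra_simps intro!: derivative_eq_intros da dc)

lemma pds2_fa:
  assumes "z \<in> U" "x \<in> B0"
  shows "pds (pds fa) (z, x) = deriv \<beta> z * b z + \<beta> z * \<alpha> z * a z"
proof (rule pds_eqI[OF hol_family_pds[OF hol_family_fa] assms])
  have "((\<lambda>z. \<beta> z * b z) has_field_derivative (deriv \<beta> z * b z + \<beta> z * \<alpha> z * a z)) (at z)"
    by (auto intro!: derivative_eq_intros deriv_\<beta> db assms)
  then show "((\<lambda>s. pds fa (s, x)) has_field_derivative (deriv \<beta> z * b z + \<beta> z * \<alpha> z * a z)) (at z)"
    by (rule has_field_derivative_transform_within_open[OF _ U(1) assms(1)]) (simp add: pds_fa assms)
qed

lemma pds2_fU: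
  assumes "z \<in> U" "x \<in> B0"
  shows "pds (pds fU) (z, x) = deriv \<beta> z * (cnj (snd x) * b z - of_real (fst x) * d z)
    + \<beta> z * \<alpha> z * (cnj (snd x) * a z - of_real (fst x) * c z)"
proof (rule pds_eqI[OF hol_family_pds[OF hol_family_fU] assms])
  have "((\<lambda>z. \<beta> z * (cnj (snd x) * b z - of_real (fst x) * d z)) has_field_derivative
     (deriv \<beta> z * (cnj (snd x) * b z - of_real (fst x) * d z)
    + \<beta> z * \<alpha> z * (cnj (snd x) * a z - of_real (fst x) * c z))) (at z)"
    by (rule derivative_eq_intros deriv_\<beta> db dd assms refl)+ (simp add: algebra_simps)
  then show "((\<lambda>s. pds fU (s, x)) has_field_derivative
     (deriv \<beta> z * (cnj (snd x) * b z - of_real (fst x) * d z)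
    + \<beta> z * \<alpha> z * (cnj (snd x) * a z - of_real (fst x) * c z))) (at z)"
    by (rule has_field_derivative_transform_within_open[OF _ U(1) assms(1)]) (simp add: pds_fU assms)
qed

text \<open>On the graph of the front these make the generating function and its gradient vanish, so that the
  front is the envelope of its horospheres.\<close>

lemma fU_graph:
  assumes z: "z \<in> U"
  shows "cnj (snd (X z)) * a z - of_real (fst (X z)) * c z = of_real \<epsilon> * cnj (b z)"
    and "cnj (snd (X z)) * b z - of_real (fst (X z)) * d z = - cnj (a z)"
proof -
  have m: "of_real (fst (X z)) = a z * cnj (a z) + of_real \<epsilon> * (b z * cnj (b z))"
    by (simp add: X_def complex_eq_iff)
  have n: "cnj (snd (X z)) = cnj (a z) * c z + of_real \<epsilon> * cnj (b z) * d z"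
    by (simp add: X_def)
  have "cnj (snd (X z)) * a z - of_real (fst (X z)) * c z
      = of_real \<epsilon> * cnj (b z) * (a z * d z - b z * c z)"
    unfolding m n by (simp add: algebra_simps)
  then show "cnj (snd (X z)) * a z - of_real (fst (X z)) * c z = of_real \<epsilon> * cnj (b z)"
    using det[OF z] by simp
  have "cnj (snd (X z)) * b z - of_real (fst (X z)) * d z = - cnj (a z) * (a z * d z - b z * c z)"
    unfolding m n by (simp add: algebra_simps)
  then show "cnj (snd (X z)) * b z - of_real (fst (X z)) * d z = - cnj (a z)"
    using det[OF z] by simp
qed

abbreviation S0 :: "(complex \<times> complex \<times> (real \<times> complex)) set" where "S0 \<equiv> polar_dom p e U B0"

text \<open>The polarised mixed derivative, \<open>i\<close> times in \<open>z\<close> and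
  \<open>j\<close> times in its conjugate, of \<open>|fU|^2 + \<epsilon> |fa|^2\<close>.\<close>

definition W :: "nat \<Rightarrow> nat \<Rightarrow> complex \<times> complex \<times> (real \<times> complex) \<Rightarrow> complex" where
  "W i j q = polar p e ((pds ^^ i) fU) ((pds ^^ j) fU) q
     + of_real \<epsilon> * polar p e ((pds ^^ i) fa) ((pds ^^ j) fa) q"

lemma open_S0: "open S0"
  by (rule open_polar_dom[OF U(1) open_B0])

lemma smooth_W: "smooth_on S0 (W i j)"
  unfolding W_def
  by (intro smooth_on_add smooth_on_mult smooth_on_const open_S0 smooth_on_polar hol_family_pds_pow
      hol_family_fa hol_family_fU)

lemma pdiff_W: "pdiff S0 (W i j) (\<lambda>q. \<i> * (e * W (Suc i) j q - cnj e * W i (Suc j) q))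
    (\<lambda>q. e * W (Suc i) j q + cnj e * W i (Suc j) q)"
proof -
  have "pdiff S0 (W i j)
    (\<lambda>q. \<i> * (e * polar p e (pds ((pds ^^ i) fU)) ((pds ^^ j) fU) q - cnj e * polar p e ((pds ^^ i) fU) (pds ((pds ^^ j) fU)) q)
       + of_real \<epsilon> * (\<i> * (e * polar p e (pds ((pds ^^ i) fa)) ((pds ^^ j) fa) q - cnj e * polar p e ((pds ^^ i) fa) (pds ((pds ^^ j) fa)) q)))
    (\<lambda>q. e * polar p e (pds ((pds ^^ i) fU)) ((pds ^^ j) fU) q + cnj e * polar p e ((pds ^^ i) fU) (pds ((pds ^^ j) fU)) q
       + of_real \<epsilon> * (e * polar p e (pds ((pds ^^ i) fa)) ((pds ^^ j) fa) q + cnj e * polar p e ((pds ^^ i) fa) (pds ((pds ^^ j) fa)) q))"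
    unfolding W_def
    by (intro pdiff_add pdiff_cmult pdiff_polar hol_family_pds_pow hol_family_fa hol_family_fU)
  then show ?thesis
    by (simp add: W_def algebra_simps)
qed

text \<open>By \<open>fU_graph\<close>, on the front \<open>fU\<close> is
  \<open>\<epsilon> * cnj b\<close> and its derivative is \<open>- \<beta> * cnj a\<close>. All
  terms with the derivative of \<beta> cancel, and
  \<open>|a|^2 + \<epsilon> |b|^2 = fst (X z)\<close> comes out as a common factor of the values
  that do not vanish.\<close>

lemma W_graph:
  assumes z: "z \<in> U" "X z \<in> B0"
    and q: "q = (of_real (Im ((z - p) / e)), of_real (Re ((z - p) / e)), X z)"
  shows "q \<in> S0" "W 0 0 q = of_real (\<epsilon> * fst (X z))" "W (Suc 0) 0 q = 0" "W 0 (Suc 0) q = 0"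
    "W (Suc (Suc 0)) 0 q = of_real (\<epsilon> * fst (X z)) * (\<alpha> z * \<beta> z)"
    "W 0 (Suc (Suc 0)) q = of_real (\<epsilon> * fst (X z)) * cnj (\<alpha> z * \<beta> z)"
    "W (Suc 0) (Suc 0) q = of_real (fst (X z) * (norm (\<beta> z)) ^ 2)"
proof -
  have pz: "p + e * (of_real (Re ((z - p) / e)) + \<i> * of_real (Im ((z - p) / e))) = z"
    using e_nz by (simp flip: complex_eq)
  have m: "of_real (fst (X z)) = a z * cnj (a z) + of_real \<epsilon> * (b z * cnj (b z))"
    by (simp add: X_def complex_eq_iff)
  have pol: "polar p e f g q = f (z, X z) * cnj (g (z, X z))" for f g
    unfolding polar_def q by (simp only: fst_conv snd_conv complex_cnj_complex_of_real pz)
  show "q \<in> S0"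
    unfolding polar_dom_def q using z by (simp only: fst_conv snd_conv complex_cnj_complex_of_real pz mem_Collect_eq)
  have u0: "fU (z, X z) = of_real \<epsilon> * cnj (b z)"
    using fU_graph(1)[OF z(1)] by (simp add: fU_def)
  have u1: "pds fU (z, X z) = - \<beta> z * cnj (a z)"
    using pds_fU[OF z] fU_graph(2)[OF z(1)] by simp
  have u2: "pds (pds fU) (z, X z) = - deriv \<beta> z * cnj (a z) + \<beta> z * \<alpha> z * (of_real \<epsilon> * cnj (b z))"
    using pds2_fU[OF z] fU_graph[OF z(1)] by simp
  note v = u0 u1 u2 pds_fa[OF z] pds2_fa[OF z]
  have v0: "fa (z, X z) = a z" by (simp add: fa_def)
  have ee: "of_real \<epsilon> * (of_real \<epsilon> * x) = x" for x :: complex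
    by (simp flip: mult.assoc)
  show "W 0 0 q = of_real (\<epsilon> * fst (X z))"
    unfolding W_def pol by (simp add: v v0 m algebra_simps ee)
  show "W (Suc 0) 0 q = 0" "W 0 (Suc 0) q = 0"
    unfolding W_def pol by (simp_all add: v v0 algebra_simps ee)
  show "W (Suc (Suc 0)) 0 q = of_real (\<epsilon> * fst (X z)) * (\<alpha> z * \<beta> z)"
    "W 0 (Suc (Suc 0)) q = of_real (\<epsilon> * fst (X z)) * cnj (\<alpha> z * \<beta> z)"
    unfolding W_def pol by (simp_all add: v v0 m algebra_simps ee)
  have "of_real ((norm (\<beta> z)) ^ 2) = \<beta> z * cnj (\<beta> z)"
    by (rule complex_norm_square)
  then show "W (Suc 0) (Suc 0) q = of_real (fst (X z) * (norm (\<beta> z)) ^ 2)"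
    unfolding W_def pol of_real_mult m by (simp add: v v0 algebra_simps ee)
qed

end

section \<open>The reduced Hessian and the versality of the horosphere family\<close>

context flat_frame
begin

lemma dX_scale: "dX z (of_real l * w) = l *\<^sub>R dX z w"
  by (simp add: dX_def algebra_simps scaleR_conv_of_real)

text \<open>The quotient of \<open>om z (1 / r)\<close> by \<lambda>, in a form that is smooth
  across \<lambda> = 0. It comes from \<open>|\<alpha>|^2 \<lambda> = |\<alpha>|^4 - |r|^4\<close>,
  a consequence of \<open>|r|^2 = |\<alpha>| |\<beta>|\<close>, by cancelling
  \<open>|\<alpha>|^2 - |r|^2\<close>.\<close>

definition om1 :: "complex \<Rightarrow> complex" where
  "om1 z = of_real \<epsilon> * (\<alpha> z * cnj (\<alpha> z)) / ((\<alpha> z * cnj (\<alpha> z) + r z * cnj (r z)) * (\<alpha> z * cnj (r z)))"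

lemma om1_denominator: "z \<in> U \<Longrightarrow> \<alpha> z * cnj (\<alpha> z) + r z * cnj (r z) \<noteq> 0"
proof -
  assume z: "z \<in> U"
  have "\<alpha> z * cnj (\<alpha> z) + r z * cnj (r z) = of_real (norm (\<alpha> z) ^ 2 + norm (r z) ^ 2)"
    by (simp only: complex_norm_square of_real_add)
  moreover have "norm (\<alpha> z) ^ 2 + norm (r z) ^ 2 > 0"
    using nz[OF z] by (intro add_pos_nonneg) auto
  ultimately show ?thesis by (metis of_real_eq_0_iff less_irrefl)
qed

lemma smooth_u: "smooth_on U (\<lambda>z. dX z (om1 z))"
  unfolding dX_def om1_def
  by (intro smooth_intros U(1)) (use om1_denominator nz r_nz in auto)

lemma om_kernel:
  assumes z: "z \<in> U"
  shows "om z (inverse (r z)) = of_real (lam \<alpha> \<beta> z) * om1 z"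
proof -
  have rz: "r z \<noteq> 0" "\<alpha> z \<noteq> 0" using r_nz nz z by auto
  let ?A = "\<alpha> z * cnj (\<alpha> z)" and ?R = "r z * cnj (r z)"
  have beta: "\<beta> z = - (of_real \<epsilon> * r z ^ 2) / \<alpha> z"
    using r2[OF z] rz \<epsilon> by (auto simp: field_simps)
  have "norm (r z) ^ 2 = norm (\<alpha> z) * norm (\<beta> z)"
    using arg_cong[OF r2[OF z], of norm] \<epsilon> by (auto simp: norm_power norm_mult)
  then have "(norm (r z) ^ 2) ^ 2 = norm (\<alpha> z) ^ 2 * norm (\<beta> z) ^ 2"
    by (simp add: power_mult_distrib)
  then have "of_real ((norm (r z) ^ 2) ^ 2) = (of_real (norm (\<alpha> z) ^ 2 * norm (\<beta> z) ^ 2) :: complex)"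
    by (rule arg_cong)
  then have R2: "?R * ?R = ?A * (\<beta> z * cnj (\<beta> z))"
    by (simp only: complex_norm_square of_real_mult power2_eq_square[of "norm (r z) ^ 2"])
  have l: "of_real (lam \<alpha> \<beta> z) = ?A - \<beta> z * cnj (\<beta> z)"
    by (simp only: lam_def complex_norm_square of_real_diff)
  have num: "?A * of_real (lam \<alpha> \<beta> z) = (?A - ?R) * (?A + ?R)"
    using R2 unfolding l by (simp add: algebra_simps)
  have "of_real (lam \<alpha> \<beta> z) * om1 z
      = of_real \<epsilon> * (?A * of_real (lam \<alpha> \<beta> z)) / ((?A + ?R) * (\<alpha> z * cnj (r z)))"
    by (simp add: om1_def)
  also have "\<dots> = of_real \<epsilon> * (?A - ?R) / (\<alpha> z * cnj (r z))"
    unfolding num using om1_denominator[OF z] by simp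
  also have "\<dots> = of_real \<epsilon> * (cnj (\<alpha> z) / cnj (r z)) - of_real \<epsilon> * (r z / \<alpha> z)"
    using rz by (simp add: field_simps)
  also have "\<dots> = om z (inverse (r z))"
    unfolding om_def beta using rz by (simp add: field_simps power2_eq_square)
  finally show ?thesis by simp
qed

text \<open>The generating function multiplied by \<open>fst x\<close>, which is positive on
  \<open>B0\<close>, so the zeros are the same. The indexed functions are its partial derivatives in
  \<open>t\<close> and \<open>s\<close>.\<close>

definition E :: "complex \<times> complex \<times> (real \<times> complex) \<Rightarrow> complex" where
  "E q = W 0 0 q + (- of_real \<epsilon>) * of_real (fst (snd (snd q)))"
definition Es :: "complex \<times> complex \<times> (real \<times> complex) \<Rightarrow> complex" where
  "Es q = e * W (Suc 0) 0 q + cnj e * W 0 (Suc 0) q"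
definition Et :: "complex \<times> complex \<times> (real \<times> complex) \<Rightarrow> complex" where
  "Et q = \<i> * (e * W (Suc 0) 0 q + (- cnj e) * W 0 (Suc 0) q)"
definition Ess :: "complex \<times> complex \<times> (real \<times> complex) \<Rightarrow> complex" where
  "Ess q = e ^ 2 * W (Suc (Suc 0)) 0 q + 2 * e * cnj e * W (Suc 0) (Suc 0) q + cnj e ^ 2 * W 0 (Suc (Suc 0)) q"
definition Est :: "complex \<times> complex \<times> (real \<times> complex) \<Rightarrow> complex" where
  "Est q = \<i> * (e ^ 2 * W (Suc (Suc 0)) 0 q - cnj e ^ 2 * W 0 (Suc (Suc 0)) q)"
definition Ett :: "complex \<times> complex \<times> (real \<times> complex) \<Rightarrow> complex" where
  "Ett q = - (e ^ 2 * W (Suc (Suc 0)) 0 q - 2 * e * cnj e * W (Suc 0) (Suc 0) q + cnj e ^ 2 * W 0 (Suc (Suc 0)) q)"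

lemma smooth_E: "smooth_on S0 E" "smooth_on S0 Es" "smooth_on S0 Et"
  unfolding E_def Es_def Et_def
  by (intro smooth_on_add smooth_on_mult smooth_on_const smooth_W smooth_on_of_real smooth_on_fst smooth_on_snd
      smooth_on_ident open_S0)+

lemma d_E: "q \<in> S0 \<Longrightarrow> frechet_derivative E (at q) (\<tau>, \<sigma>, 0) = Et q * \<tau> + Es q * \<sigma>"
proof (rule pdiff_frechet)
  have "bounded_linear (\<lambda>x :: real \<times> complex. complex_of_real (fst x))"
    by (intro bounded_linear_compose[OF bounded_linear_of_real] bounded_linear_fst)
  from pdiff_add[OF pdiff_W[of 0 0] pdiff_cmult[OF pdiff_parameter[OF this], of _ "- of_real \<epsilon>"]]
  show "pdiff S0 E Et Es"
    by (rule pdiff_cong) (simp_all add: E_def Et_def Es_def)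
qed

lemma d_Es: "q \<in> S0 \<Longrightarrow> frechet_derivative Es (at q) (\<tau>, \<sigma>, 0) = Est q * \<tau> + Ess q * \<sigma>"
proof (rule pdiff_frechet)
  from pdiff_add[OF pdiff_cmult[OF pdiff_W[of "Suc 0" 0], of e] pdiff_cmult[OF pdiff_W[of 0 "Suc 0"], of "cnj e"]]
  show "pdiff S0 Es Est Ess"
    by (rule pdiff_cong) (simp_all add: Es_def Est_def Ess_def algebra_simps power2_eq_square)
qed

lemma d_Et: "q \<in> S0 \<Longrightarrow> frechet_derivative Et (at q) (\<tau>, \<sigma>, 0) = Ett q * \<tau> + Est q * \<sigma>"
proof (rule pdiff_frechet)
  from pdiff_cmult[OF pdiff_add[OF pdiff_cmult[OF pdiff_W[of "Suc 0" 0], of e] pdiff_cmult[OF pdiff_W[of 0 "Suc 0"], of "- cnj e"]], of \<i>]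
  show "pdiff S0 Et Ett Est"
    by (rule pdiff_cong) (simp_all add: Et_def Est_def Ett_def algebra_simps power2_eq_square)
qed

lemma X_p_B0: "X p \<in> B0"
  by (simp add: X_p B0_def)

text \<open>The normalisation \<open>e = 1 / r p\<close> makes the Hessian explicit: from the values
  -1, -1 and 1 below, \<open>Ess\<close>, \<open>Est\<close> and \<open>Ett\<close> are 0, 0 and 4
  at the base point.\<close>

lemma W_p:
  "(0, 0, X p) \<in> S0" "W (Suc 0) 0 (0, 0, X p) = 0" "W 0 (Suc 0) (0, 0, X p) = 0"
  "e ^ 2 * W (Suc (Suc 0)) 0 (0, 0, X p) = -1" "cnj e ^ 2 * W 0 (Suc (Suc 0)) (0, 0, X p) = -1"
  "e * cnj e * W (Suc 0) (Suc 0) (0, 0, X p) = 1"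
proof -
  note w = W_graph[OF U(2) X_p_B0, of "(0, 0, X p)", simplified]
  show "(0, 0, X p) \<in> S0" "W (Suc 0) 0 (0, 0, X p) = 0" "W 0 (Suc 0) (0, 0, X p) = 0"
    by (rule w)+
  show 1: "e ^ 2 * W (Suc (Suc 0)) 0 (0, 0, X p) = -1"
    unfolding w using e_sq by (simp add: X_p mult_ac)
  show "cnj e ^ 2 * W 0 (Suc (Suc 0)) (0, 0, X p) = -1"
    unfolding w using arg_cong[OF e_sq, of cnj] by (simp add: X_p mult_ac)
  have "e * cnj e * of_real (norm (\<beta> p) ^ 2) = of_real (norm (e * \<beta> p) ^ 2)"
    by (simp only: norm_mult power_mult_distrib of_real_mult complex_norm_square)
  then show "e * cnj e * W (Suc 0) (Suc 0) (0, 0, X p) = 1"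
    unfolding w norm_e\<beta> by (simp add: X_p)
qed

lemma critical_p: "Et (0, 0, X p) = 0" "Ett (0, 0, X p) \<noteq> 0" "Est (0, 0, X p) = 0"
proof -
  show "Et (0, 0, X p) = 0" by (simp add: Et_def W_p)
  show "Est (0, 0, X p) = 0" by (simp add: Est_def W_p)
  have 2: "2 * e * cnj e * W (Suc 0) (Suc 0) (0, 0, X p) = 2"
    using W_p(6) by (simp add: mult.assoc)
  show "Ett (0, 0, X p) \<noteq> 0" unfolding Ett_def W_p(4,5) 2 by simp
qed

lemma W_at_p:
  assumes x: "x \<in> B0"
  shows "W 0 0 (0, 0, x) = cnj (snd x) * snd x + of_real \<epsilon>"
    and "W (Suc 0) 0 (0, 0, x) = - (\<beta> p * of_real (fst x) * snd x)"
    and "W 0 (Suc 0) (0, 0, x) = - cnj (\<beta> p * of_real (fst x) * snd x)"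
  unfolding W_def polar_def using pds_fa[OF U(2) x] pds_fU[OF U(2) x]
  by (simp_all add: fa_def fU_def init)

text \<open>At \<open>p\<close> the frame is the identity, so \<open>fU\<close> reduces to
  \<open>cnj n\<close> for \<open>x = (m, n)\<close>, and its squared modulus is of second order at
  \<open>n = 0\<close>.\<close>

lemma d_E_parameter: "frechet_derivative E (at (0, 0, X p)) (0, 0, Y) = - of_real (\<epsilon> * fst Y)"
proof -
  have dE: "((\<lambda>x. E (0, 0, x)) has_derivative (\<lambda>Y. frechet_derivative E (at (0, 0, X p)) (0, 0, Y))) (at (X p))"
    by (rule has_derivative_snd_arg, rule has_derivative_snd_arg, rule smooth_on_has_derivative[OF smooth_E(1) W_p(1)])
  have "((\<lambda>x::real \<times> complex. cnj (snd x) * snd x + of_real \<epsilon> + (- of_real \<epsilon>) * of_real (fst x)) has_derivative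
      (\<lambda>Y. - of_real (\<epsilon> * fst Y))) (at (X p))"
    by (auto intro!: derivative_eq_intros simp: X_p)
  then have "((\<lambda>x. E (0, 0, x)) has_derivative (\<lambda>Y. - of_real (\<epsilon> * fst Y))) (at (X p))"
    by (rule has_derivative_transform_within_open[OF _ open_B0 X_p_B0]) (simp add: E_def W_at_p)
  from fun_cong[OF has_derivative_unique[OF dE this], of Y] show ?thesis .
qed

lemma d_Es_parameter: "frechet_derivative Es (at (0, 0, X p)) (0, 0, Y) = - of_real (2 * Re (e * \<beta> p * snd Y))"
proof -
  have dE: "((\<lambda>x. Es (0, 0, x)) has_derivative (\<lambda>Y. frechet_derivative Es (at (0, 0, X p)) (0, 0, Y))) (at (X p))"
    by (rule has_derivative_snd_arg, rule has_derivative_snd_arg, rule smooth_on_has_derivative[OF smooth_E(2) W_p(1)])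
  have "((\<lambda>x::real \<times> complex. e * - (\<beta> p * of_real (fst x) * snd x) + cnj e * - cnj (\<beta> p * of_real (fst x) * snd x)) has_derivative
      (\<lambda>Y. - of_real (2 * Re (e * \<beta> p * snd Y)))) (at (X p))"
  proof (rule has_derivative_eq_rhs)
    show "((\<lambda>x::real \<times> complex. e * - (\<beta> p * of_real (fst x) * snd x) + cnj e * - cnj (\<beta> p * of_real (fst x) * snd x)) has_derivative
      (\<lambda>Y. - (e * \<beta> p * snd Y) - cnj (e * \<beta> p * snd Y))) (at (X p))"
      by (auto intro!: derivative_eq_intros simp: X_p)
    show "(\<lambda>Y. - (e * \<beta> p * snd Y) - cnj (e * \<beta> p * snd Y)) = (\<lambda>Y. - of_real (2 * Re (e * \<beta> p * snd Y)))"
    proof -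
      have "- w - cnj w = - of_real (2 * Re w)" for w
        by (simp add: complex_eq_iff)
      then show ?thesis by (intro ext)
    qed
  qed
  then have "((\<lambda>x. Es (0, 0, x)) has_derivative (\<lambda>Y. - of_real (2 * Re (e * \<beta> p * snd Y)))) (at (X p))"
    by (rule has_derivative_transform_within_open[OF _ open_B0 X_p_B0]) (simp add: Es_def W_at_p)
  from fun_cong[OF has_derivative_unique[OF dE this], of Y] show ?thesis .
qed

lemma dX_transversal: "frechet_derivative X (at p) (\<i> * e) = (0, - 2 * \<i> * cnj (e * \<beta> p))"
proof -
  have "of_real \<epsilon> * cnj (\<alpha> p * e) = - (\<beta> p * e)"
    using arg_cong[OF null_e, of cnj] by simp
  then have "om p (\<i> * e) = 2 * \<i> * (\<beta> p * e)"
    by (simp add: om_def algebra_simps)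
  then show ?thesis
    unfolding X_derivative[OF U(2)] by (simp add: dX_def init)
qed

text \<open>\<open>e * \<beta> p\<close> is unimodular, so the two conditions leave for
  \<open>snd Y\<close> only the real multiples of \<open>\<i> * cnj (e * \<beta> p)\<close>, the
  direction in which the front itself moves when \<open>z\<close> leaves \<open>p\<close> along
  \<open>\<i> * e\<close>.\<close>

lemma versal:
  assumes "fst Y = 0" "Re (e * \<beta> p * snd Y) = 0"
  shows "\<exists>c. Y = c *\<^sub>R frechet_derivative X (at p) (\<i> * e)"
proof -
  define w where "w = e * \<beta> p"
  define y where "y = Im (w * snd Y)"
  have w: "cnj w * w = 1"
    using norm_e\<beta> complex_norm_square[of w] by (simp add: w_def mult.commute)
  have "snd Y = cnj w * w * snd Y" using w by simp
  also have "\<dots> = cnj w * (w * snd Y)" by (simp add: mult.assoc)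
  also have "w * snd Y = \<i> * of_real y"
    using assms(2) unfolding complex_eq_iff by (simp add: w_def y_def)
  finally have "snd Y = (- y / 2) *\<^sub>R (- 2 * \<i> * cnj w)"
    by (simp add: scaleR_conv_of_real)
  then have "Y = (- y / 2) *\<^sub>R (0, - 2 * \<i> * cnj (e * \<beta> p))"
    using assms(1) unfolding w_def by (intro prod_eqI) simp_all
  then show ?thesis unfolding dX_transversal by blast
qed

text \<open>Half of \<open>Ett\<close> on the graph of the front, with the factor
  \<open>fst (X z)\<close> taken out.\<close>

definition kd :: "complex \<Rightarrow> real" where
  "kd z = Re (e * cnj e) * Re (\<beta> z * cnj (\<beta> z)) - Re (of_real \<epsilon> * e ^ 2 * (\<alpha> z * \<beta> z))"

definition kk :: "complex \<Rightarrow> real" where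
  "kk z = - 2 * Re (e * cnj e) ^ 2 * fst (X z) * Re (\<beta> z * cnj (\<beta> z)) / kd z"

lemma smooth_kd: "smooth_on U kd"
  unfolding kd_def by (intro smooth_intros U(1))

lemma kd_p: "kd p = 2"
proof -
  have n: "Re (x * cnj x) = norm x ^ 2" for x
    unfolding cmod_power2 by (simp add: power2_eq_square)
  have "Re (e * cnj e) * Re (\<beta> p * cnj (\<beta> p)) = norm (e * \<beta> p) ^ 2"
    unfolding n norm_mult power_mult_distrib ..
  then have "Re (e * cnj e) * Re (\<beta> p * cnj (\<beta> p)) = 1"
    unfolding norm_e\<beta> by simp
  moreover have "Re (of_real \<epsilon> * e ^ 2 * (\<alpha> p * \<beta> p)) = -1"
    using arg_cong[OF e_sq, of Re] by (simp add: mult_ac)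
  ultimately show ?thesis by (simp add: kd_def)
qed

text \<open>With \<open>A\<close> for \<open>e^2\<close> times the pure second derivative and
  \<open>Q\<close> for \<open>|e|^2\<close> times the mixed one, \<open>Ess Ett - Est^2\<close> is
  \<open>4 (Q^2 - |A|^2)\<close>. Both squares share the factor
  \<open>fst (X z)^2 |e|^4 |\<beta>|^2\<close>, and what remains is
  \<open>|\<beta>|^2 - |\<alpha>|^2 = - \<lambda>\<close>.\<close>

lemma hessian_graph:
  assumes z: "z \<in> U" "X z \<in> B0"
    and q: "q = (of_real (Im ((z - p) / e)), of_real (Re ((z - p) / e)), X z)" and kd: "kd z > 0"
  shows "E q = 0" "Es q = 0" "Et q = 0" "Re (Ess q - Est q ^ 2 / Ett q) = kk z * lam \<alpha> \<beta> z"
proof -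
  note w = W_graph[OF z q]
  show "E q = 0" "Es q = 0" "Et q = 0"
    using w by (simp_all add: E_def Es_def Et_def q)
  define m where "m = fst (X z)"
  have m: "m > 0" using z(2) by (simp add: m_def B0_def)
  define A where "A = e ^ 2 * W (Suc (Suc 0)) 0 q"
  have A: "A = of_real m * (of_real \<epsilon> * e ^ 2 * (\<alpha> z * \<beta> z))" and A': "cnj e ^ 2 * W 0 (Suc (Suc 0)) q = cnj A"
    unfolding A_def w m_def by (simp_all add: mult_ac)
  define Q where "Q = m * (Re (e * cnj e) * Re (\<beta> z * cnj (\<beta> z)))"
  have ee: "e * cnj e = of_real (Re (e * cnj e))"
    by (simp add: complex_eq_iff)
  have bb: "norm (\<beta> z) ^ 2 = Re (\<beta> z * cnj (\<beta> z))" and aa: "norm (\<alpha> z) ^ 2 = Re (\<alpha> z * cnj (\<alpha> z))"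
    and ne: "norm e ^ 2 = Re (e * cnj e)"
    unfolding cmod_power2 by (simp_all add: power2_eq_square)
  have Q: "e * cnj e * W (Suc 0) (Suc 0) q = of_real Q"
    unfolding w bb Q_def m_def of_real_mult by (subst ee) (simp add: mult_ac)
  have Q2: "2 * e * cnj e * W (Suc 0) (Suc 0) q = of_real (2 * Q)"
    using Q by (simp add: mult.assoc)
  have den: "Q - Re A = m * kd z"
    unfolding A Q_def kd_def by (simp add: algebra_simps)
  have ess: "Ess q = of_real (2 * Re A + 2 * Q)"
    unfolding Ess_def A' Q2 A_def[symmetric] by (simp add: complex_eq_iff)
  have est: "Est q = of_real (- 2 * Im A)"
    unfolding Est_def A' A_def[symmetric] by (simp add: complex_eq_iff)
  have ett: "Ett q = of_real (2 * (m * kd z))"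
    unfolding Ett_def A' Q2 A_def[symmetric] den[symmetric] by (simp add: complex_eq_iff)
  have nA: "Re A ^ 2 + Im A ^ 2 = m ^ 2 * Re (e * cnj e) ^ 2 * (norm (\<alpha> z) ^ 2 * norm (\<beta> z) ^ 2)"
  proof -
    have "Re A ^ 2 + Im A ^ 2 = norm A ^ 2" by (simp add: cmod_power2)
    also have "\<dots> = m ^ 2 * (norm e ^ 2) ^ 2 * (norm (\<alpha> z) ^ 2 * norm (\<beta> z) ^ 2)"
      unfolding A using \<epsilon> m by (auto simp: norm_mult norm_power power_mult_distrib)
    finally show ?thesis unfolding ne .
  qed
  have "Re (Ess q - Est q ^ 2 / Ett q) = (2 * Re A + 2 * Q) - (- 2 * Im A) ^ 2 / (2 * (m * kd z))"
    unfolding ess est ett by (simp only: of_real_power[symmetric] of_real_divide[symmetric] of_real_diff[symmetric] Re_complex_of_real)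
  also have "\<dots> = 4 * (Q ^ 2 - (Re A ^ 2 + Im A ^ 2)) / (2 * (m * kd z))"
  proof -
    have "(2 * R + 2 * (K + R)) - (- 2 * I) ^ 2 / (2 * K) = 4 * ((K + R) ^ 2 - (R ^ 2 + I ^ 2)) / (2 * K)"
      if "K \<noteq> 0" for K R I :: real
      using that by (simp add: field_simps power2_eq_square)
    moreover have "Q = m * kd z + Re A" "m * kd z \<noteq> 0"
      using den m kd by auto
    ultimately show ?thesis by metis
  qed
  also have "Q ^ 2 - (Re A ^ 2 + Im A ^ 2) = - (m ^ 2 * Re (e * cnj e) ^ 2 * Re (\<beta> z * cnj (\<beta> z)) * lam \<alpha> \<beta> z)"
    unfolding nA lam_def bb Q_def by (simp add: power2_eq_square algebra_simps)
  also have "4 * - (m ^ 2 * Re (e * cnj e) ^ 2 * Re (\<beta> z * cnj (\<beta> z)) * lam \<alpha> \<beta> z) / (2 * (m * kd z))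
      = kk z * lam \<alpha> \<beta> z"
    using m kd by (simp add: kk_def m_def[symmetric] field_simps power2_eq_square)
  finally show "Re (Ess q - Est q ^ 2 / Ett q) = kk z * lam \<alpha> \<beta> z" .
qed

theorem swallowtail_normal_form:
  assumes dl: "\<not> (lam \<alpha> \<beta> has_derivative (\<lambda>_. 0)) (at p)"
    and le: "frechet_derivative (lam \<alpha> \<beta>) (at p) e = 0"
    and \<xi>: "((\<lambda>t. frechet_derivative (lam \<alpha> \<beta>) (at (p + t *\<^sub>R e)) (inverse (r (p + t *\<^sub>R e)))) has_real_derivative \<xi>) (at 0)" "\<xi> \<noteq> 0"
  obtains V' Z \<phi> N \<Psi> \<theta> where "V' \<subseteq> U" "p \<in> V'" "0 \<in> Z" "diffeo_on \<phi> Z V'" "\<phi> 0 = p"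
    "open N" "N \<subseteq> B0" "smooth_on N (\<Psi> :: real \<times> complex \<Rightarrow> real^3)" "inj_on \<Psi> N" "open (\<Psi> ` N)"
    "smooth_on (\<Psi> ` N) \<theta>" "\<And>x. x \<in> N \<Longrightarrow> \<theta> (\<Psi> x) = x" "\<Psi> (X p) = 0"
    "\<And>w. w \<in> Z \<Longrightarrow> X (\<phi> w) \<in> N \<and> \<Psi> (X (\<phi> w)) = swallowtail_model w"
proof -
  note result = that
  obtain R B h \<delta> F where R: "R > 0" and B: "X p \<in> B" and F: "hol_family (ball 0 R) B F" and \<delta>: "\<delta> > 0"
    and hS: "\<And>s x. s \<in> ball 0 R \<Longrightarrow> x \<in> B \<Longrightarrow> (h (s, x), s, x) \<in> S0"
    and uniq: "\<And>t s x. t \<in> ball 0 \<delta> \<Longrightarrow> s \<in> ball 0 R \<Longrightarrow> x \<in> B \<Longrightarrow> Et (t, s, x) = 0 \<Longrightarrow> h (s, x) = t"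
    and F0: "\<And>s x. s \<in> ball 0 R \<Longrightarrow> x \<in> B \<Longrightarrow> F (s, x) = E (h (s, x), s, x)"
    and F1: "\<And>s x. s \<in> ball 0 R \<Longrightarrow> x \<in> B \<Longrightarrow> pds F (s, x) = Es (h (s, x), s, x)"
    and F2: "\<And>s x. s \<in> ball 0 R \<Longrightarrow> x \<in> B \<Longrightarrow> Ett (h (s, x), s, x) \<noteq> 0 \<and>
       pds (pds F) (s, x) = Ess (h (s, x), s, x) - Est (h (s, x), s, x) ^ 2 / Ett (h (s, x), s, x)"
    and dF: "\<And>Y. frechet_derivative F (at (0, X p)) (0, Y) = frechet_derivative E (at (0, 0, X p)) (0, 0, Y)"
    and dF1: "\<And>Y. frechet_derivative (pds F) (at (0, X p)) (0, Y) = frechet_derivative Es (at (0, 0, X p)) (0, 0, Y)"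
    by (rule eliminate_critical_variable[OF open_S0 W_p(1) smooth_E d_E d_Es d_Et critical_p]) blast+
  have oB: "open B" using F by (simp add: hol_family_def)
  have BB0: "B \<subseteq> B0"
  proof
    fix x assume "x \<in> B"
    then have "(h (0, x), 0, x) \<in> S0" using hS R by simp
    then show "x \<in> B0" by (simp add: polar_dom_def)
  qed
  let ?s = "\<lambda>z. complex_of_real (Re ((z - p) / e))" and ?t = "\<lambda>z. complex_of_real (Im ((z - p) / e))"
  \<comment> \<open>The bound on both coordinates brings the point into the range of the uniqueness
    statement for \<open>h\<close>; positivity of \<open>kd\<close> is what
    \<open>hessian_graph\<close> asks for.\<close>
  define V where "V = U \<inter> (X -` B \<inter> U) \<inter> (?s -` ball 0 R) \<inter> (?t -` ball 0 \<delta>) \<inter> (kd -` {0<..} \<inter> U)"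
  have V: "open V" "p \<in> V" "V \<subseteq> U"
  proof -
    note vim = continuous_on_open_vimage[OF U(1), THEN iffD1, rule_format]
    have 1: "open (X -` B \<inter> U)"
      by (rule vim[OF smooth_on_imp_continuous_on[OF smooth_X] oB])
    have 2: "open (kd -` {0<..} \<inter> U)"
      by (rule vim[OF smooth_on_imp_continuous_on[OF smooth_kd] open_greaterThan])
    have 3: "open (?s -` ball 0 R)" "open (?t -` ball 0 \<delta>)"
      using e_nz by (intro open_vimage open_ball continuous_intros; simp)+
    show "open V" unfolding V_def by (intro open_Int U(1) 1 2 3)
    show "p \<in> V" unfolding V_def using U(2) B R \<delta> kd_p by simp
  qed (auto simp: V_def)
  have inV: "z \<in> U" "X z \<in> B" "X z \<in> B0" "?s z \<in> ball 0 R" "?t z \<in> ball 0 \<delta>" "kd z > 0" if "z \<in> V" for z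
    using that BB0 by (auto simp: V_def)
  \<comment> \<open>\<open>Et\<close> vanishes at the real coordinates of \<open>z\<close> because
    the front is the envelope. Uniqueness of the critical value puts them on the graph of
    \<open>h\<close>, so that \<open>F\<close> along \<open>X\<close> is \<open>E\<close> along
    \<open>X\<close>.\<close>
  have H: "h (?s z, X z) = ?t z" if "z \<in> V" for z
    using uniq inV[OF that] hessian_graph(3)[OF inV(1,3)[OF that] refl inV(6)[OF that]] by blast
  note G = hessian_graph[OF inV(1,3) refl inV(6)]
  have dlam: "(lam \<alpha> \<beta> has_derivative frechet_derivative (lam \<alpha> \<beta>) (at p)) (at p)"
    by (rule smooth_on_has_derivative[OF smooth_lam U(2)])
  have lie: "frechet_derivative (lam \<alpha> \<beta>) (at p) (\<i> * e) \<noteq> 0"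
  proof
    assume 0: "frechet_derivative (lam \<alpha> \<beta>) (at p) (\<i> * e) = 0"
    interpret linear "frechet_derivative (lam \<alpha> \<beta>) (at p)"
      using dlam has_derivative_linear by blast
    have "frechet_derivative (lam \<alpha> \<beta>) (at p) v = 0" for v
    proof -
      have "v = v / e * e" using e_nz by simp
      also have "\<dots> = (of_real (Re (v / e)) + \<i> * of_real (Im (v / e))) * e"
        by (metis complex_eq)
      also have "\<dots> = Re (v / e) *\<^sub>R e + Im (v / e) *\<^sub>R (\<i> * e)"
        by (simp add: scaleR_conv_of_real algebra_simps)
      finally have "frechet_derivative (lam \<alpha> \<beta>) (at p) v = frechet_derivative (lam \<alpha> \<beta>) (at p) (Re (v / e) *\<^sub>R e + Im (v / e) *\<^sub>R (\<i> * e))"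
        by (rule arg_cong)
      also have "\<dots> = 0" by (simp only: add scale le 0) simp
      finally show ?thesis .
    qed
    then have "frechet_derivative (lam \<alpha> \<beta>) (at p) = (\<lambda>_. 0)" by (intro ext)
    with dlam dl show False by simp
  qed
  have kp: "kk p \<noteq> 0"
  proof -
    have "Re (x * cnj x) \<noteq> 0" if "x \<noteq> 0" for x
      using that by (simp add: complex_eq_iff sum_squares_eq_zero_iff)
    then show ?thesis
      using e_nz nz[OF U(2)] by (simp only: kk_def kd_p X_p) simp
  qed
  have sk: "smooth_on V kk"
    unfolding kk_def
    by (intro smooth_intros V(1) smooth_on_subset[OF smooth_X V(3)] smooth_on_subset[OF smooth_kd V(3)]
        smooth_on_subset[OF smooth_data(2) V(3)]) (use inV in force)
  have vers: "\<exists>c. Y = c *\<^sub>R frechet_derivative X (at p) (\<i> * e)"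
    if "Re (frechet_derivative F (at (0, X p)) (0, Y)) = 0" "Re (frechet_derivative (pds F) (at (0, X p)) (0, Y)) = 0" for Y
    using that unfolding dF dF1 d_E_parameter d_Es_parameter by (intro versal) auto
  have si: "smooth_on V (\<lambda>z. inverse (r z))"
    by (intro smooth_intros V(1) smooth_on_subset[OF smooth_data(3) V(3)]) (use r_nz inV in auto)
  show ?thesis
  proof (rule swallowtail_of_generating_family[OF F R V(1,2) e_nz smooth_on_subset[OF smooth_X V(3)],
        where k = kk and l = "lam \<alpha> \<beta>" and \<eta> = "\<lambda>z. inverse (r z)" and u = "\<lambda>z. dX z (om1 z)"])
    show "?s z \<in> ball 0 R \<and> X z \<in> B" if "z \<in> V" for z using inV that by blast
    show "Re (F (?s z, X z)) = 0" if "z \<in> V" for z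
      using F0[OF inV(4,2)[OF that]] G(1)[OF that that that] H[OF that] by simp
    show "Re (pds F (?s z, X z)) = 0" if "z \<in> V" for z
      using F1[OF inV(4,2)[OF that]] G(2)[OF that that that] H[OF that] by simp
    show "Re (pds (pds F) (?s z, X z)) = kk z * lam \<alpha> \<beta> z" if "z \<in> V" for z
      using F2[OF inV(4,2)[OF that]] G(4)[OF that that that] H[OF that] by simp
    show "frechet_derivative X (at z) (inverse (r z)) = lam \<alpha> \<beta> z *\<^sub>R dX z (om1 z)" if "z \<in> V" for z
      using inV[OF that] by (simp only: X_derivative om_kernel dX_scale)
    show "smooth_on V kk" by (rule sk)
    show "smooth_on V (lam \<alpha> \<beta>)" by (rule smooth_on_subset[OF smooth_lam V(3)])
    show "smooth_on V (\<lambda>z. inverse (r z))" by (rule si)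
    show "smooth_on V (\<lambda>z. dX z (om1 z))" by (rule smooth_on_subset[OF smooth_u V(3)])
    show "inverse (r p) = e" by (simp add: e_def)
    show "kk p \<noteq> 0" by (rule kp)
    show "lam \<alpha> \<beta> p = 0" by (rule lp)
    show "frechet_derivative (lam \<alpha> \<beta>) (at p) e = 0" by (rule le)
    show "frechet_derivative (lam \<alpha> \<beta>) (at p) (\<i> * e) \<noteq> 0" by (rule lie)
    show "((\<lambda>t. frechet_derivative (lam \<alpha> \<beta>) (at (p + t *\<^sub>R e)) (inverse (r (p + t *\<^sub>R e)))) has_real_derivative \<xi>) (at 0)"
      by (rule \<xi>(1))
    show "\<xi> \<noteq> 0" by (rule \<xi>(2))
    show "\<exists>c. Y = c *\<^sub>R frechet_derivative X (at p) (\<i> * e)"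
      if "Re (frechet_derivative F (at (0, X p)) (0, Y)) = 0" "Re (frechet_derivative (pds F) (at (0, X p)) (0, Y)) = 0" for Y
      by (rule vers[OF that])
  next
    fix V' Z \<phi> N \<Psi> \<theta>
    assume h: "V' \<subseteq> V" "p \<in> V'" "0 \<in> Z" "diffeo_on \<phi> Z V'" "\<phi> 0 = p"
      "open N" "N \<subseteq> B" "smooth_on N (\<Psi> :: real \<times> complex \<Rightarrow> real^3)" "inj_on \<Psi> N" "open (\<Psi> ` N)"
      "smooth_on (\<Psi> ` N) \<theta>" "\<And>x. x \<in> N \<Longrightarrow> \<theta> (\<Psi> x) = x" "\<Psi> (X p) = 0"
      "\<And>w. w \<in> Z \<Longrightarrow> X (\<phi> w) \<in> N \<and> \<Psi> (X (\<phi> w)) = swallowtail_model w"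
    show thesis
      by (rule result[OF subset_trans[OF h(1) V(3)] h(2-6) subset_trans[OF h(7) BB0] h(8-14)])
  qed
qed

end

section \<open>Matrices\<close>

definition mat2 :: "complex \<Rightarrow> complex \<Rightarrow> complex \<Rightarrow> complex \<Rightarrow> complex^2^2" where
  "mat2 x y z w = (\<chi> i j. if i = 1 then (if j = 1 then x else y) else (if j = 1 then z else w))"

lemma mat2_nth [simp]:
  "mat2 x y z w $ 1 $ 1 = x" "mat2 x y z w $ 1 $ 2 = y" "mat2 x y z w $ 2 $ 1 = z" "mat2 x y z w $ 2 $ 2 = w"
  by (simp_all add: mat2_def)

lemma mat2_eqI:
  "X $ 1 $ 1 = x \<Longrightarrow> X $ 1 $ 2 = y \<Longrightarrow> X $ 2 $ 1 = z \<Longrightarrow> X $ 2 $ 2 = w \<Longrightarrow> X = mat2 x y z w"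
  by (simp add: vec_eq_iff forall_2)

lemma mat2_eq_iff: "mat2 x y z w = mat2 x' y' z' w' \<longleftrightarrow> x = x' \<and> y = y' \<and> z = z' \<and> w = w'"
  by (auto simp: vec_eq_iff forall_2)

lemma mat2_zero: "(0 :: complex^2^2) = mat2 0 0 0 0" and mat2_one: "mat 1 = mat2 1 0 0 1"
  by (rule mat2_eqI; simp add: mat_def)+

lemma mat2_cases: "X = mat2 (X $ 1 $ 1) (X $ 1 $ 2) (X $ 2 $ 1) (X $ 2 $ 2)"
  by (rule mat2_eqI) auto

lemma mat2_mult:
  "mat2 x y z w ** mat2 x' y' z' w' = mat2 (x * x' + y * z') (x * y' + y * w') (z * x' + w * z') (z * y' + w * w')"
  by (rule mat2_eqI) (simp_all add: matrix_matrix_mult_def sum_2)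

lemma adjm_mat2: "adjm (mat2 x y z w) = mat2 (cnj x) (cnj z) (cnj y) (cnj w)"
  by (rule mat2_eqI) (simp_all add: adjm_def)

lemma adjm_mult: "adjm (X ** Y) = adjm Y ** adjm X"
  by (subst (1 2) mat2_cases[of X], subst (1 2) mat2_cases[of Y]) (simp add: mat2_mult adjm_mat2 mat2_eq_iff mult.commute)

lemma adjm_adjm [simp]: "adjm (adjm X) = X"
  by (subst (1 2) mat2_cases[of X]) (simp add: adjm_mat2)

lemma det_mat2: "det (mat2 x y z w) = x * w - y * z"
  by (simp add: det_2)

lemma det_adjm: "det (adjm X) = cnj (det X)"
  by (subst (1 2) mat2_cases[of X]) (simp add: adjm_mat2 det_mat2 mult.commute)

lemma linear_mat2: "bounded_linear (\<lambda>t. mat2 (fst t) (fst (snd t)) (fst (snd (snd t))) (snd (snd (snd t))))"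
  unfolding linear_conv_bounded_linear[symmetric]
  by (rule linearI) (simp_all add: vec_eq_iff forall_2)

lemma smooth_on_mat2:
  assumes "open S" "smooth_on S f" "smooth_on S g" "smooth_on S h" "smooth_on S k"
  shows "smooth_on S (\<lambda>x. mat2 (f x) (g x) (h x) (k x))"
  using smooth_on_bounded_linear[OF linear_mat2 assms(1), of "\<lambda>x. (f x, g x, h x, k x)"]
  by (simp add: smooth_on_Pair assms)

lemma mat2_has_derivative:
  assumes "(f has_derivative f') (at x)" "(g has_derivative g') (at x)" "(h has_derivative h') (at x)" "(k has_derivative k') (at x)"
  shows "((\<lambda>x. mat2 (f x) (g x) (h x) (k x)) has_derivative (\<lambda>v. mat2 (f' v) (g' v) (h' v) (k' v))) (at x)"
  using bounded_linear.has_derivative[OF linear_mat2 has_derivative_Pair[OF assms(1) has_derivative_Pair[OF assms(2)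
      has_derivative_Pair[OF assms(3,4)]]]] by simp

definition dg :: "real \<Rightarrow> complex^2^2" where "dg \<epsilon> = mat2 1 0 0 (of_real \<epsilon>)"

definition front :: "real \<Rightarrow> (complex \<Rightarrow> complex^2^2) \<Rightarrow> complex \<Rightarrow> complex^2^2" where
  "front \<epsilon> A z = A z ** dg \<epsilon> ** adjm (A z)"

definition space_form :: "real \<Rightarrow> (complex^2^2) set" where
  "space_form \<epsilon> = {X. adjm X = X \<and> det X = of_real \<epsilon> \<and> (\<epsilon> = 1 \<longrightarrow> Re (X $ 1 $ 1 + X $ 2 $ 2) > 0)}"

lemma front_cases: "hyp_front A = front 1 A" "dS_front A = front (-1) A"
proof -
  have "dg 1 = mat 1" "dg (-1) = e3"
    unfolding dg_def mat2_one by (rule mat2_eqI[symmetric]; simp add: e3_def)+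
  then show "hyp_front A = front 1 A" "dS_front A = front (-1) A"
    by (intro ext; simp add: front_def hyp_front_def dS_front_def)+
qed

lemma space_form_cases: "hyperbolic3 = space_form 1" "deSitter3 = space_form (-1)"
  by (auto simp: hyperbolic3_def deSitter3_def space_form_def)

lemma front_entries:
  assumes "A z = mat2 a b c d"
  shows "front \<epsilon> A z = mat2 (a * cnj a + of_real \<epsilon> * (b * cnj b)) (a * cnj c + of_real \<epsilon> * (b * cnj d))
     (c * cnj a + of_real \<epsilon> * (d * cnj b)) (c * cnj c + of_real \<epsilon> * (d * cnj d))"
  unfolding front_def assms dg_def adjm_mat2 mat2_mult by (simp add: mat2_eq_iff mult_ac)

lemma front_in_space_form:
  assumes "det (A z) = 1" "\<epsilon> = 1 \<or> \<epsilon> = -1"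
  shows "front \<epsilon> A z \<in> space_form \<epsilon>"
proof -
  let ?a = "A z $ 1 $ 1" and ?b = "A z $ 1 $ 2" and ?c = "A z $ 2 $ 1" and ?d = "A z $ 2 $ 2"
  have e: "A z = mat2 ?a ?b ?c ?d" by (rule mat2_cases)
  have "adjm (dg \<epsilon>) = dg \<epsilon>" by (simp add: dg_def adjm_mat2)
  then have 1: "adjm (front \<epsilon> A z) = front \<epsilon> A z"
    by (simp add: front_def adjm_mult matrix_mul_assoc)
  have 2: "det (front \<epsilon> A z) = of_real \<epsilon>"
    using assms by (simp add: front_def det_mul det_adjm dg_def det_mat2)
  have 3: "Re (front \<epsilon> A z $ 1 $ 1 + front \<epsilon> A z $ 2 $ 2) > 0" if "\<epsilon> = 1"
  proof -
    have "Re (front \<epsilon> A z $ 1 $ 1 + front \<epsilon> A z $ 2 $ 2)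
        = norm ?a ^ 2 + norm ?b ^ 2 + norm ?c ^ 2 + norm ?d ^ 2"
      unfolding front_entries[where A = A and z = z, OF e] that cmod_power2 by (simp add: power2_eq_square)
    moreover have "?a \<noteq> 0 \<or> ?b \<noteq> 0"
      using assms(1) det_mat2[of ?a ?b ?c ?d] e by auto
    moreover have "norm ?a ^ 2 + norm ?b ^ 2 > 0" if "?a \<noteq> 0 \<or> ?b \<noteq> 0"
      using that by (auto intro: add_pos_nonneg add_nonneg_pos)
    moreover have "norm ?c ^ 2 \<ge> 0" "norm ?d ^ 2 \<ge> 0" by simp_all
    ultimately show ?thesis by linarith
  qed
  show ?thesis using 1 2 3 by (simp add: space_form_def)
qed

text \<open>The frame is invertible, so the kernel is already that of the off-diagonal entry
  \<open>om\<close>, whatever the frame.\<close>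

lemma front_derivative_kernel:
  assumes e: "\<And>z. A z = mat2 (a z) (b z) (c z) (d z)"
    and D: "(a has_field_derivative \<beta> * b z) (at z)" "(b has_field_derivative \<alpha> * a z) (at z)"
      "(c has_field_derivative \<beta> * d z) (at z)" "(d has_field_derivative \<alpha> * c z) (at z)"
    and det: "a z * d z - b z * c z = 1"
  obtains f' where "(front \<epsilon> A has_derivative f') (at z)"
    "\<And>v. f' v = 0 \<longleftrightarrow> \<beta> * v + of_real \<epsilon> * cnj (\<alpha> * v) = 0"
proof -
  define om where "om v = \<beta> * v + of_real \<epsilon> * cnj (\<alpha> * v)" for v
  note C = bounded_linear.has_derivative[OF bounded_linear_cnj]
  have prod: "((\<lambda>z. f z * cnj (g z) + of_real \<epsilon> * (h z * cnj (k z))) has_derivative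
      (\<lambda>v. h z * cnj (g z) * om v + f z * cnj (k z) * cnj (om v))) (at z)"
    if "(f has_field_derivative \<beta> * h z) (at z)" "(h has_field_derivative \<alpha> * f z) (at z)"
      "(g has_field_derivative \<beta> * k z) (at z)" "(k has_field_derivative \<alpha> * g z) (at z)" for f g h k
  proof -
    note d = that[unfolded has_field_derivative_def]
    have "((\<lambda>z. f z * cnj (g z) + of_real \<epsilon> * (h z * cnj (k z))) has_derivative
      (\<lambda>v. (f z * cnj (\<beta> * k z * v) + \<beta> * h z * v * cnj (g z)) + of_real \<epsilon> * (h z * cnj (\<alpha> * g z * v) + \<alpha> * f z * v * cnj (k z)))) (at z)"
      by (intro has_derivative_add has_derivative_mult_right has_derivative_mult C d)
    then show ?thesis
      by (rule has_derivative_eq_rhs) (auto simp: om_def algebra_simps)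
  qed
  define f' where "f' v = mat2 (b z * cnj (a z) * om v + a z * cnj (b z) * cnj (om v))
     (b z * cnj (c z) * om v + a z * cnj (d z) * cnj (om v))
     (d z * cnj (a z) * om v + c z * cnj (b z) * cnj (om v))
     (d z * cnj (c z) * om v + c z * cnj (d z) * cnj (om v))" for v
  have "(front \<epsilon> A has_derivative f') (at z)"
    unfolding f'_def front_entries[where A = A, OF e, abs_def]
    by (intro mat2_has_derivative prod D)
  moreover have "f' v = 0 \<longleftrightarrow> om v = 0" for v
  proof
    assume "f' v = 0"
    then have z: "b z * cnj (a z) * om v + a z * cnj (b z) * cnj (om v) = 0"
      "b z * cnj (c z) * om v + a z * cnj (d z) * cnj (om v) = 0"
      "d z * cnj (a z) * om v + c z * cnj (b z) * cnj (om v) = 0"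
      "d z * cnj (c z) * om v + c z * cnj (d z) * cnj (om v) = 0"
      unfolding f'_def mat2_zero mat2_eq_iff by auto
    \<comment> \<open>Multiplying by the determinant 1 combines two entries so that the terms in
      \<open>cnj (om v)\<close> cancel.\<close>
    have "cnj (a z) * om v = (a z * d z - b z * c z) * (cnj (a z) * om v)" using det by simp
    also have "\<dots> = a z * (d z * cnj (a z) * om v + c z * cnj (b z) * cnj (om v))
        - c z * (b z * cnj (a z) * om v + a z * cnj (b z) * cnj (om v))"
      by (simp add: algebra_simps)
    finally have 1: "cnj (a z) * om v = 0" unfolding z by simp
    have "cnj (c z) * om v = (a z * d z - b z * c z) * (cnj (c z) * om v)" using det by simp
    also have "\<dots> = a z * (d z * cnj (c z) * om v + c z * cnj (d z) * cnj (om v))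
        - c z * (b z * cnj (c z) * om v + a z * cnj (d z) * cnj (om v))"
      by (simp add: algebra_simps)
    finally have 2: "cnj (c z) * om v = 0" unfolding z by simp
    have "a z \<noteq> 0 \<or> c z \<noteq> 0" using det by auto
    then show "om v = 0" using 1 2 by auto
  qed (simp add: f'_def mat2_zero)
  ultimately show ?thesis using that unfolding om_def by blast
qed

section \<open>Kernels are invariant under equivalence of germs\<close>

text \<open>\<open>h = \<Psi> \<circ> f \<circ> \<phi>\<close> gives one inclusion of kernels and
  \<open>f \<circ> \<phi> = \<theta> \<circ> h\<close> the other; the second needs the inverse chart
  \<theta> to be differentiable at \<open>h w\<close>.\<close>

lemma germ_A_equiv_kernel:
  fixes f :: "complex \<Rightarrow> 'm::euclidean_space"
  assumes g: "germ_A_equiv N f U p h"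
    and f: "\<And>z. z \<in> U \<Longrightarrow> (f has_derivative f' z) (at z)"
    and h: "\<And>w. (h has_derivative h' w) (at w)"
  obtains W \<phi> where "open W" "0 \<in> W" "smooth_on W \<phi>" "\<phi> 0 = p" "\<And>w. w \<in> W \<Longrightarrow> \<phi> w \<in> U"
    "\<And>w v. w \<in> W \<Longrightarrow> frechet_derivative \<phi> (at w) v = 0 \<Longrightarrow> v = 0"
    "\<And>w v. w \<in> W \<Longrightarrow> f' (\<phi> w) (frechet_derivative \<phi> (at w) v) = 0 \<longleftrightarrow> h' w v = 0"
proof -
  obtain V W \<phi> Ob \<Psi> \<theta> where V: "open V" "V \<subseteq> U" and W: "open W" "0 \<in> W" and \<phi>: "diffeo_on \<phi> W V" "\<phi> 0 = p"
    and Ob: "open Ob" "smooth_on Ob \<Psi>" "open (\<Psi> ` (N \<inter> Ob))" "smooth_on (\<Psi> ` (N \<inter> Ob)) \<theta>"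
    and \<theta>: "\<forall>y\<in>N \<inter> Ob. \<theta> (\<Psi> y) = y" and eq: "\<forall>w\<in>W. f (\<phi> w) \<in> N \<inter> Ob \<and> \<Psi> (f (\<phi> w)) = h w"
    using g unfolding germ_A_equiv_def by blast
  have s\<phi>: "smooth_on W \<phi>" and s\<psi>: "smooth_on V (inv_into W \<phi>)" and bij: "bij_betw \<phi> W V"
    using \<phi>(1) by (auto simp: diffeo_on_def)
  have \<phi>V: "\<phi> w \<in> V" "\<phi> w \<in> U" if "w \<in> W" for w
    using bij that V(2) by (auto simp: bij_betw_def)
  let ?D = "\<lambda>w. frechet_derivative \<phi> (at w)"
  have d\<phi>: "(\<phi> has_derivative ?D w) (at w)" if "w \<in> W" for w
    by (rule smooth_on_has_derivative[OF s\<phi> that])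
  show ?thesis
  proof (rule that[OF W s\<phi> \<phi>(2) \<phi>V(2)])
    fix w v assume w: "w \<in> W" and v: "?D w v = 0"
    have d: "((\<lambda>w. inv_into W \<phi> (\<phi> w)) has_derivative (\<lambda>v. frechet_derivative (inv_into W \<phi>) (at (\<phi> w)) (?D w v))) (at w)"
      by (rule has_derivative_compose[OF d\<phi>[OF w] smooth_on_has_derivative[OF s\<psi> \<phi>V(1)[OF w]]])
    have "((\<lambda>w. w) has_derivative (\<lambda>v. frechet_derivative (inv_into W \<phi>) (at (\<phi> w)) (?D w v))) (at w)"
      by (rule has_derivative_transform_within_open[OF d W(1) w]) (use bij in \<open>auto simp: bij_betw_def\<close>)
    from fun_cong[OF has_derivative_unique[OF this has_derivative_ident], of v]
    have "frechet_derivative (inv_into W \<phi>) (at (\<phi> w)) 0 = v" using v by simp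
    then show "v = 0"
      using linear_0[OF has_derivative_linear[OF smooth_on_has_derivative[OF s\<psi> \<phi>V(1)[OF w]]]] by simp
  next
    fix w v assume w: "w \<in> W"
    have fw: "f (\<phi> w) \<in> Ob" "f (\<phi> w) \<in> N \<inter> Ob" "\<Psi> (f (\<phi> w)) = h w" using eq w by auto
    have hw: "h w \<in> \<Psi> ` (N \<inter> Ob)" using fw by (metis imageI)
    have df: "((\<lambda>w. f (\<phi> w)) has_derivative (\<lambda>v. f' (\<phi> w) (?D w v))) (at w)"
      by (rule has_derivative_compose[OF d\<phi>[OF w] f[OF \<phi>V(2)[OF w]]])
    note d\<Psi> = smooth_on_has_derivative[OF Ob(2) fw(1)] and d\<theta> = smooth_on_has_derivative[OF Ob(4) hw]
    have "(h has_derivative (\<lambda>v. frechet_derivative \<Psi> (at (f (\<phi> w))) (f' (\<phi> w) (?D w v)))) (at w)"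
      by (rule has_derivative_transform_within_open[OF has_derivative_compose[OF df d\<Psi>] W(1) w]) (use eq in auto)
    from fun_cong[OF has_derivative_unique[OF h this], of v]
    have 1: "h' w v = frechet_derivative \<Psi> (at (f (\<phi> w))) (f' (\<phi> w) (?D w v))" .
    have "((\<lambda>w. f (\<phi> w)) has_derivative (\<lambda>v. frechet_derivative \<theta> (at (h w)) (h' w v))) (at w)"
    proof (rule has_derivative_transform_within_open[OF has_derivative_compose[OF h d\<theta>] W(1) w])
      fix w' assume "w' \<in> W"
      then show "\<theta> (h w') = f (\<phi> w')" using eq \<theta> by metis
    qed
    from fun_cong[OF has_derivative_unique[OF df this], of v]
    have 2: "f' (\<phi> w) (?D w v) = frechet_derivative \<theta> (at (h w)) (h' w v)" .
    show "f' (\<phi> w) (?D w v) = 0 \<longleftrightarrow> h' w v = 0"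
      using 1 2 linear_0[OF has_derivative_linear[OF d\<Psi>]] linear_0[OF has_derivative_linear[OF d\<theta>]] by auto
  qed
qed

lemma vector_has_derivative:
  fixes f g h :: "'a::real_normed_vector \<Rightarrow> real"
  assumes "(f has_derivative f') (at x)" "(g has_derivative g') (at x)" "(h has_derivative h') (at x)"
  shows "((\<lambda>x. vector [f x, g x, h x] :: real^3) has_derivative (\<lambda>v. vector [f' v, g' v, h' v])) (at x)"
proof -
  have "((\<lambda>x. to_R3 (f x, Complex (g x) (h x))) has_derivative (\<lambda>v. to_R3 (f' v, Complex (g' v) (h' v)))) (at x)"
    unfolding Complex_eq
    by (intro bounded_linear.has_derivative[OF bounded_linear_R3(1)] has_derivative_Pair has_derivative_add
        has_derivative_mult_right bounded_linear.has_derivative[OF bounded_linear_of_real] assms)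
  then show ?thesis by (simp add: to_R3_def)
qed

lemma vector_zero_iff: "(vector [x, y, z] :: real^3) = 0 \<longleftrightarrow> x = 0 \<and> y = 0 \<and> z = 0"
  by (simp add: vec_eq_iff forall_3)

lemma cuspidal_edge_model_derivative:
  "(cuspidal_edge_model has_derivative (\<lambda>v. vector [Re v, 2 * Im w * Im v, 3 * Im w ^ 2 * Im v])) (at w)"
  unfolding cuspidal_edge_model_def[abs_def]
  by (intro vector_has_derivative) (auto intro!: derivative_eq_intros)

lemma swallowtail_model_derivative:
  "(swallowtail_model has_derivative (\<lambda>v. vector [Re v,
      (- 12 * Im w ^ 2 - 2 * Re w) * Im v - 2 * Im w * Re v,
      (12 * Im w ^ 3 + 2 * Re w * Im w) * Im v + Im w ^ 2 * Re v])) (at w)"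
  unfolding swallowtail_model_def[abs_def]
  by (intro vector_has_derivative) (auto intro!: derivative_eq_intros simp: algebra_simps power2_eq_square power3_eq_cube)

lemma bounded_linear_matrix_conjugation: "bounded_linear (\<lambda>X :: complex^2^2. P ** X ** Q)"
  unfolding linear_conv_bounded_linear[symmetric]
  by (rule linearI) (simp_all add: vec_eq_iff forall_2 matrix_matrix_mult_def sum_2 algebra_simps)

section \<open>The criterion for one front\<close>

text \<open>For a null \<open>v\<close> the square of \<open>r * v\<close> is
  \<open>|\<alpha> v|^2\<close>, so \<open>r * v\<close> is real and the null line is spanned by
  \<open>1 / r\<close>.\<close>

lemma null_vector:
  fixes \<alpha> \<beta> r v :: complex
  assumes "\<epsilon> = 1 \<or> \<epsilon> = -1" "\<beta> * v + of_real \<epsilon> * cnj (\<alpha> * v) = 0" "r ^ 2 = - of_real \<epsilon> * \<alpha> * \<beta>" "v \<noteq> 0" "r \<noteq> 0"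
  shows "norm \<alpha> = norm \<beta>" "v = Re (r * v) *\<^sub>R inverse r"
proof -
  have bv: "\<beta> * v = - of_real \<epsilon> * cnj (\<alpha> * v)"
    using assms(2) by (simp add: eq_neg_iff_add_eq_0)
  have "norm (\<beta> * v) = norm (\<alpha> * v)"
    unfolding bv using assms(1) by (auto simp: norm_mult)
  then show 1: "norm \<alpha> = norm \<beta>" using assms(4) by (simp add: norm_mult)
  have "(r * v) ^ 2 = - of_real \<epsilon> * (\<alpha> * v) * (\<beta> * v)"
    unfolding power_mult_distrib assms(3) by (simp add: power2_eq_square mult_ac)
  also have "\<dots> = (\<alpha> * v) * cnj (\<alpha> * v)"
    unfolding bv using assms(1) by auto
  also have "\<dots> = of_real (norm (\<alpha> * v)) ^ 2"
    by (simp only: complex_norm_square[symmetric] of_real_power)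
  finally have "r * v = of_real (norm (\<alpha> * v)) \<or> r * v = - of_real (norm (\<alpha> * v))"
    by (simp only: power2_eq_iff)
  then have im: "r * v = of_real (Re (r * v))"
    by (elim disjE) (simp_all only: of_real_minus[symmetric] Re_complex_of_real)
  show "v = Re (r * v) *\<^sub>R inverse r"
  proof -
    have "Re (r * v) *\<^sub>R inverse r = of_real (Re (r * v)) * inverse r" by (rule scaleR_conv_of_real)
    also have "\<dots> = r * v * inverse r" by (simp only: im[symmetric])
    finally show ?thesis using assms(5) by simp
  qed
qed

locale flat_surface =
  fixes U :: "complex set" and p :: complex and \<alpha> \<beta> :: "complex \<Rightarrow> complex" and A :: "complex \<Rightarrow> complex^2^2"
  assumes U: "open U" "p \<in> U"
    and hol: "\<alpha> holomorphic_on U" "\<beta> holomorphic_on U"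
    and nz: "\<And>z. z \<in> U \<Longrightarrow> \<alpha> z \<noteq> 0 \<and> \<beta> z \<noteq> 0"
    and det: "\<And>z. z \<in> U \<Longrightarrow> det (A z) = 1"
    and ode: "\<And>z i j. z \<in> U \<Longrightarrow> ((\<lambda>w. A w $ i $ j) has_field_derivative (A z ** Dmat (\<alpha> z) (\<beta> z)) $ i $ j) (at z)"
    and lp: "lam \<alpha> \<beta> p = 0" and nondeg: "\<not> (lam \<alpha> \<beta> has_derivative (\<lambda>_. 0)) (at p)"
begin

lemma ode_entries:
  assumes "z \<in> U"
  shows "((\<lambda>w. A w $ 1 $ 1) has_field_derivative \<beta> z * A z $ 1 $ 2) (at z)"
    "((\<lambda>w. A w $ 1 $ 2) has_field_derivative \<alpha> z * A z $ 1 $ 1) (at z)"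
    "((\<lambda>w. A w $ 2 $ 1) has_field_derivative \<beta> z * A z $ 2 $ 2) (at z)"
    "((\<lambda>w. A w $ 2 $ 2) has_field_derivative \<alpha> z * A z $ 2 $ 1) (at z)"
  using ode[OF assms, of 1 1] ode[OF assms, of 1 2] ode[OF assms, of 2 1] ode[OF assms, of 2 2]
  by (simp_all add: Dmat_def matrix_matrix_mult_def sum_2 mult.commute)

lemma det_entries: "z \<in> U \<Longrightarrow> A z $ 1 $ 1 * A z $ 2 $ 2 - A z $ 1 $ 2 * A z $ 2 $ 1 = 1"
  using det[of z] by (simp add: det_2)

lemma front_kernel:
  assumes "z \<in> U"
  shows "(front \<epsilon> A has_derivative frechet_derivative (front \<epsilon> A) (at z)) (at z)"
    and "frechet_derivative (front \<epsilon> A) (at z) v = 0 \<longleftrightarrow> \<beta> z * v + of_real \<epsilon> * cnj (\<alpha> z * v) = 0"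
proof -
  obtain f' where f': "(front \<epsilon> A has_derivative f') (at z)"
    "\<And>v. f' v = 0 \<longleftrightarrow> \<beta> z * v + of_real \<epsilon> * cnj (\<alpha> z * v) = 0"
    by (rule front_derivative_kernel[OF mat2_cases ode_entries[OF assms] det_entries[OF assms]]) blast
  then have "frechet_derivative (front \<epsilon> A) (at z) = f'"
    using frechet_derivative_at by blast
  with f' show "(front \<epsilon> A has_derivative frechet_derivative (front \<epsilon> A) (at z)) (at z)"
    "frechet_derivative (front \<epsilon> A) (at z) v = 0 \<longleftrightarrow> \<beta> z * v + of_real \<epsilon> * cnj (\<alpha> z * v) = 0"
    by auto
qed

lemma smooth_lam: "smooth_on U (lam \<alpha> \<beta>)"
proof -
  have "lam \<alpha> \<beta> z = Re (\<alpha> z * cnj (\<alpha> z)) - Re (\<beta> z * cnj (\<beta> z))" for z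
    unfolding lam_def cmod_power2 by (simp add: power2_eq_square)
  then have "lam \<alpha> \<beta> = (\<lambda>z. Re (\<alpha> z * cnj (\<alpha> z)) - Re (\<beta> z * cnj (\<beta> z)))" by (rule ext)
  then show ?thesis
    by (simp only:) (intro smooth_intros U smooth_on_holomorphic hol)
qed

abbreviation dlam :: "complex \<Rightarrow> complex \<Rightarrow> real" where
  "dlam z \<equiv> frechet_derivative (lam \<alpha> \<beta>) (at z)"

lemma dlam: "z \<in> U \<Longrightarrow> (lam \<alpha> \<beta> has_derivative dlam z) (at z)"
  by (rule smooth_on_has_derivative[OF smooth_lam])

lemma dlam_linear: "z \<in> U \<Longrightarrow> linear (dlam z)"
  using dlam has_derivative_linear by blast

lemma dlam_nonzero: "\<exists>v. dlam p v \<noteq> 0"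
proof (rule ccontr)
  assume "\<nexists>v. dlam p v \<noteq> 0"
  then have "dlam p = (\<lambda>_. 0)" by auto
  with dlam[OF U(2)] nondeg show False by simp
qed

text \<open>An injective \<open>L\<close> carries \<open>1\<close>, \<open>\<i>\<close> to a basis,
  on which the differential of \<lambda> cannot vanish by nondegeneracy. The arguments on germs
  below end in this contradiction.\<close>

lemma dlam_basis:
  assumes L: "linear L" "\<And>v. L v = 0 \<Longrightarrow> v = (0::complex)" and "dlam p (L 1) = 0" "dlam p (L \<i>) = 0"
  shows False
proof -
  have "surj L"
    using L linear_injective_imp_surjective linear_injective_0 by blast
  moreover have "dlam p (L v) = 0" for v
  proof -
    have v: "v = Re v *\<^sub>R 1 + Im v *\<^sub>R \<i>" by (simp add: complex_eq_iff)
    have "dlam p (L (Re v *\<^sub>R 1 + Im v *\<^sub>R \<i>)) = 0"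
      by (simp only: linear_add[OF L(1)] linear_scale[OF L(1)] linear_add[OF dlam_linear[OF U(2)]]
          linear_scale[OF dlam_linear[OF U(2)]] assms(3,4)) simp
    then show ?thesis using v by metis
  qed
  ultimately show False using dlam_nonzero by (metis surjD)
qed

text \<open>The function \<Xi> of the overview. The root \<open>r\<close> is an argument because
  both fronts are compared, through \<open>r\<close> and \<open>\<i> * r\<close>; changing the
  branch of \<open>r\<close> only changes the sign.\<close>

definition Xi :: "(complex \<Rightarrow> complex) \<Rightarrow> complex \<Rightarrow> real" where
  "Xi r z = dlam z (inverse (r z))"

lemma smooth_Xi:
  assumes "open V" "V \<subseteq> U" "r holomorphic_on V" "\<And>z. z \<in> V \<Longrightarrow> r z \<noteq> 0"
  shows "smooth_on V (Xi r)"
  unfolding Xi_def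
  by (intro smooth_on_frechet_apply[OF smooth_lam U(1) assms(1)] smooth_on_ident smooth_on_inverse
      smooth_on_holomorphic assms) (use assms(2) in auto)

lemma germ_null_direction:
  assumes "\<epsilon> = 1 \<or> \<epsilon> = -1" "\<phi> \<in> U" "frechet_derivative (front \<epsilon> A) (at \<phi>) v = 0" "v \<noteq> 0"
    and r: "r \<phi> ^ 2 = - of_real \<epsilon> * \<alpha> \<phi> * \<beta> \<phi>"
  shows "lam \<alpha> \<beta> \<phi> = 0" "v = Re (r \<phi> * v) *\<^sub>R inverse (r \<phi>)" "dlam \<phi> v = Re (r \<phi> * v) * Xi r \<phi>"
proof -
  have "r \<phi> \<noteq> 0" using r nz[OF assms(2)] assms(1) by auto
  note n = null_vector[OF assms(1) front_kernel(2)[OF assms(2), THEN iffD1, OF assms(3)] r assms(4) this]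
  show "lam \<alpha> \<beta> \<phi> = 0" using n(1) by (simp add: lam_def)
  show v: "v = Re (r \<phi> * v) *\<^sub>R inverse (r \<phi>)" by (rule n(2))
  have "dlam \<phi> (Re (r \<phi> * v) *\<^sub>R inverse (r \<phi>)) = Re (r \<phi> * v) * Xi r \<phi>"
    using linear_scale[OF dlam_linear[OF assms(2)]] by (simp add: Xi_def)
  with v show "dlam \<phi> v = Re (r \<phi> * v) * Xi r \<phi>" by metis
qed

text \<open>On the edge \<open>Im w = 0\<close> of the model the kernel is spanned by
  \<open>\<i>\<close>. Hence \<lambda> composed with \<phi> vanishes on the real axis and its
  derivative in direction 1 is 0; if \<Xi> vanished at \<open>p\<close>, so would the derivative in
  direction \<open>\<i>\<close>, against nondegeneracy.\<close>

lemma cuspidal_edge_transversal: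
  assumes germ: "germ_A_equiv N (front \<epsilon> A) U p cuspidal_edge_model"
    and \<epsilon>: "\<epsilon> = 1 \<or> \<epsilon> = -1" and r: "r p ^ 2 = - of_real \<epsilon> * \<alpha> p * \<beta> p"
  shows "Xi r p \<noteq> 0"
proof
  assume Xi0: "Xi r p = 0"
  obtain W \<phi> where W: "open W" "0 \<in> W" and s\<phi>: "smooth_on W \<phi>" and \<phi>0: "\<phi> 0 = p" and \<phi>U: "\<And>w. w \<in> W \<Longrightarrow> \<phi> w \<in> U"
    and inj: "\<And>w v. w \<in> W \<Longrightarrow> frechet_derivative \<phi> (at w) v = 0 \<Longrightarrow> v = 0"
    and ker: "\<And>w v. w \<in> W \<Longrightarrow> frechet_derivative (front \<epsilon> A) (at (\<phi> w)) (frechet_derivative \<phi> (at w) v) = 0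
       \<longleftrightarrow> (vector [Re v, 2 * Im w * Im v, 3 * Im w ^ 2 * Im v] :: real^3) = 0"
    by (rule germ_A_equiv_kernel[OF germ front_kernel(1) cuspidal_edge_model_derivative]) blast+
  let ?D = "\<lambda>w. frechet_derivative \<phi> (at w)"
  have d\<phi>: "(\<phi> has_derivative ?D 0) (at 0)" by (rule smooth_on_has_derivative[OF s\<phi> W(2)])
  have nn: "?D w \<i> \<noteq> 0" if "w \<in> W" for w using inj[OF that, of \<i>] by auto
  have k0: "frechet_derivative (front \<epsilon> A) (at (\<phi> w)) (?D w \<i>) = 0" if "w \<in> W" "Im w = 0" for w
    using ker[OF that(1), of \<i>] that(2) by (simp add: vector_zero_iff)
  \<comment> \<open>The root \<open>r\<close> is only controlled at \<open>p\<close>; elsewhere any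
    pointwise square root will do, and \<open>csqrt\<close> provides one.\<close>
  have lam0: "lam \<alpha> \<beta> (\<phi> w) = 0" if w: "w \<in> W" "Im w = 0" for w
  proof -
    show ?thesis
      by (rule germ_null_direction(1)[OF \<epsilon> \<phi>U[OF w(1)] k0[OF w] nn[OF w(1)],
          of "\<lambda>z. csqrt (- of_real \<epsilon> * \<alpha> z * \<beta> z)"]) simp
  qed
  have "((\<lambda>t. lam \<alpha> \<beta> (\<phi> (0 + t *\<^sub>R 1))) has_real_derivative dlam p (?D 0 1)) (at 0)"
    using linear_path_DERIV[OF has_derivative_compose[OF d\<phi>], of "lam \<alpha> \<beta>" "dlam p" 1] dlam[OF U(2)] \<phi>0 by simp
  then have "((\<lambda>t. 0) has_real_derivative dlam p (?D 0 1)) (at 0)"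
  proof (rule has_field_derivative_transform_within_open)
    show "open ((\<lambda>t. 0 + t *\<^sub>R 1) -` W)" by (intro open_vimage W continuous_intros)
    show "0 \<in> (\<lambda>t::real. 0 + t *\<^sub>R 1) -` W" using W by simp
    show "lam \<alpha> \<beta> (\<phi> (0 + t *\<^sub>R 1)) = 0" if "t \<in> (\<lambda>t. 0 + t *\<^sub>R 1) -` W" for t
      using lam0 that by simp
  qed
  then have 1: "dlam p (?D 0 1) = 0"
    using DERIV_unique[OF _ DERIV_const] by blast
  have 2: "dlam p (?D 0 \<i>) = 0"
    using germ_null_direction(3)[OF \<epsilon> \<phi>U[OF W(2)] k0[OF W(2)] nn[OF W(2)], of r] r Xi0 \<phi>0 by simp
  show False
    by (rule dlam_basis[OF has_derivative_linear[OF d\<phi>] inj[OF W(2)] 1 2])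
qed

text \<open>Along the singular curve \<open>(-6\<tau>\<^sup>2, \<tau>)\<close> of the model, with \<open>\<rho>\<close> the coordinate of the null
  vector \<open>\<partial>\<^sub>v\<close> with respect to \<open>1 / r\<close>, differentiating \<open>\<lambda> = 0\<close> gives \<open>\<rho> \<Xi> = 12 \<tau> \<partial>\<^sub>u \<lambda>\<close>.\<close>

lemma swallowtail_transversal:
  assumes germ: "germ_A_equiv N (front \<epsilon> A) U p swallowtail_model"
    and \<epsilon>: "\<epsilon> = 1 \<or> \<epsilon> = -1" and V: "open V" "p \<in> V" "V \<subseteq> U" and hr: "r holomorphic_on V"
    and r: "\<And>z. z \<in> V \<Longrightarrow> r z ^ 2 = - of_real \<epsilon> * \<alpha> z * \<beta> z" and Xi0: "Xi r p = 0"
  shows "frechet_derivative (Xi r) (at p) (inverse (r p)) \<noteq> 0"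
proof
  assume \<xi>: "frechet_derivative (Xi r) (at p) (inverse (r p)) = 0"
  have rnz: "r z \<noteq> 0" if "z \<in> V" for z
    using r[OF that] nz[of z] V(3) that \<epsilon> by auto
  note sXi = smooth_Xi[OF V(1,3) hr rnz]
  obtain W \<phi> where W: "open W" "0 \<in> W" and s\<phi>: "smooth_on W \<phi>" and \<phi>0: "\<phi> 0 = p" and \<phi>U: "\<And>w. w \<in> W \<Longrightarrow> \<phi> w \<in> U"
    and inj: "\<And>w v. w \<in> W \<Longrightarrow> frechet_derivative \<phi> (at w) v = 0 \<Longrightarrow> v = 0"
    and ker: "\<And>w v. w \<in> W \<Longrightarrow> frechet_derivative (front \<epsilon> A) (at (\<phi> w)) (frechet_derivative \<phi> (at w) v) = 0
       \<longleftrightarrow> (vector [Re v, (- 12 * Im w ^ 2 - 2 * Re w) * Im v - 2 * Im w * Re v,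
         (12 * Im w ^ 3 + 2 * Re w * Im w) * Im v + Im w ^ 2 * Re v] :: real^3) = 0"
    by (rule germ_A_equiv_kernel[OF germ front_kernel(1) swallowtail_model_derivative]) blast+
  let ?D = "\<lambda>w. frechet_derivative \<phi> (at w)"
  define W1 where "W1 = \<phi> -` V \<inter> W"
  have W1: "open W1" "0 \<in> W1" "W1 \<subseteq> W"
    using continuous_on_open_vimage[OF W(1), THEN iffD1, rule_format, OF smooth_on_imp_continuous_on[OF s\<phi>] V(1)]
      W(2) V(2) \<phi>0 by (auto simp: W1_def)
  have \<phi>V: "\<phi> w \<in> V" "\<phi> w \<in> U" "w \<in> W" if "w \<in> W1" for w using that V(3) by (auto simp: W1_def)
  have s\<phi>1: "smooth_on W1 \<phi>" by (rule smooth_on_subset[OF s\<phi> W1(3)])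
  have d\<phi>: "(\<phi> has_derivative ?D w) (at w)" if "w \<in> W1" for w by (rule smooth_on_has_derivative[OF s\<phi>1 that])
  have nn: "?D w \<i> \<noteq> 0" if "w \<in> W1" for w using inj[OF \<phi>V(3)[OF that], of \<i>] by auto
  \<comment> \<open>The constant comes from \<open>- 12 v^2 - 2 u = 0\<close>; the third component
    of the derivative in direction \<open>\<i>\<close> is \<open>- v\<close> times this expression
    and vanishes with it.\<close>
  define c where "c \<tau> = Complex (- 6 * \<tau> ^ 2) \<tau>" for \<tau>
  have dc: "(c has_derivative (\<lambda>t. t *\<^sub>R Complex (- 12 * \<tau>) 1)) (at \<tau>)" for \<tau>
    unfolding c_def Complex_eq
    by (auto intro!: derivative_eq_intros simp: scaleR_conv_of_real algebra_simps)
  have c0: "c 0 = 0" by (simp add: c_def complex_eq_iff)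
  define T where "T = c -` W1"
  have T: "open T" "0 \<in> T"
    unfolding T_def using W1 c0
    by (auto intro!: open_vimage continuous_at_imp_continuous_on has_derivative_continuous[OF dc])
  have chain: "((\<lambda>\<tau>. H (c \<tau>)) has_real_derivative H' (Complex (- 12 * \<tau>) 1)) (at \<tau>)"
    if "(H has_derivative H') (at (c \<tau>))" for H :: "complex \<Rightarrow> real" and H' \<tau>
  proof -
    have "((\<lambda>\<tau>. H (c \<tau>)) has_derivative (\<lambda>t. H' (t *\<^sub>R Complex (- 12 * \<tau>) 1))) (at \<tau>)"
      by (rule has_derivative_compose[OF dc that])
    then have "((\<lambda>\<tau>. H (c \<tau>)) has_derivative (*) (H' (Complex (- 12 * \<tau>) 1))) (at \<tau>)"
      by (rule has_derivative_eq_rhs) (use has_derivative_linear[OF that] in \<open>auto simp: linear_scale mult.commute\<close>)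
    then show ?thesis by (simp add: has_field_derivative_def)
  qed
  have k0: "frechet_derivative (front \<epsilon> A) (at (\<phi> (c \<tau>))) (?D (c \<tau>) \<i>) = 0" if "\<tau> \<in> T" for \<tau>
  proof -
    have "c \<tau> \<in> W" using that \<phi>V by (auto simp: T_def)
    from ker[OF this, of \<i>] show ?thesis
      by (simp add: vector_zero_iff c_def power2_eq_square power3_eq_cube)
  qed
  have gen: "lam \<alpha> \<beta> (\<phi> (c \<tau>)) = 0" "dlam (\<phi> (c \<tau>)) (?D (c \<tau>) \<i>) = Re (r (\<phi> (c \<tau>)) * ?D (c \<tau>) \<i>) * Xi r (\<phi> (c \<tau>))"
    if "\<tau> \<in> T" for \<tau>
    using germ_null_direction(1,3)[OF \<epsilon> _ k0[OF that], of r] r \<phi>V nn that by (auto simp: T_def)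
  define P where "P w = Re (r (\<phi> w) * ?D w \<i>)" for w
  define Q where "Q w = Xi r (\<phi> w)" for w
  define G where "G w = dlam (\<phi> w) (?D w 1)" for w
  have sP: "smooth_on W1 P"
    unfolding P_def
    by (intro smooth_on_Re smooth_on_mult W1(1) smooth_on_frechet[OF s\<phi>1]
        smooth_on_compose[OF smooth_on_holomorphic[OF hr V(1)] V(1) W1(1) s\<phi>1] \<phi>V)
  have sQ: "smooth_on W1 Q"
    unfolding Q_def by (rule smooth_on_compose[OF sXi V(1) W1(1) s\<phi>1 \<phi>V(1)])
  have sG: "smooth_on W1 G"
    unfolding G_def by (intro smooth_on_frechet_apply[OF smooth_lam U(1) W1(1) s\<phi>1] \<phi>V smooth_on_frechet[OF s\<phi>1])
  have rel: "P (c \<tau>) * Q (c \<tau>) = 12 * \<tau> * G (c \<tau>)" if \<tau>: "\<tau> \<in> T" for \<tau>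
  proof -
    have w: "c \<tau> \<in> W1" using \<tau> by (simp add: T_def)
    let ?L = "\<lambda>v. dlam (\<phi> (c \<tau>)) (?D (c \<tau>) v)"
    have "((\<lambda>\<tau>. lam \<alpha> \<beta> (\<phi> (c \<tau>))) has_real_derivative ?L (Complex (- 12 * \<tau>) 1)) (at \<tau>)"
      by (rule chain[OF has_derivative_compose[OF d\<phi>[OF w] dlam[OF \<phi>V(2)[OF w]]]])
    then have "((\<lambda>\<tau>. 0) has_real_derivative ?L (Complex (- 12 * \<tau>) 1)) (at \<tau>)"
      by (rule has_field_derivative_transform_within_open[OF _ T(1) \<tau>]) (rule gen(1))
    from DERIV_unique[OF this DERIV_const] have "?L (Complex (- 12 * \<tau>) 1) = 0" .
    moreover have "Complex (- 12 * \<tau>) 1 = (- 12 * \<tau>) *\<^sub>R 1 + \<i>" by (simp add: complex_eq_iff)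
    ultimately have "?L ((- 12 * \<tau>) *\<^sub>R 1 + \<i>) = 0" by simp
    then have "(- 12 * \<tau>) * ?L 1 + ?L \<i> = 0"
      using linear_add[OF has_derivative_linear[OF d\<phi>[OF w]]] linear_scale[OF has_derivative_linear[OF d\<phi>[OF w]]]
        linear_add[OF dlam_linear[OF \<phi>V(2)[OF w]]] linear_scale[OF dlam_linear[OF \<phi>V(2)[OF w]]]
      by (simp del: scaleR_minus_left)
    then show ?thesis
      using gen(2)[OF \<tau>] by (simp add: P_def Q_def G_def)
  qed
  have path: "((\<lambda>\<tau>. H (c \<tau>)) has_real_derivative frechet_derivative H (at 0) \<i>) (at 0)" if "smooth_on W1 H" for H :: "complex \<Rightarrow> real"
  proof -
    have "Complex (- 12 * 0) 1 = \<i>" by (simp add: complex_eq_iff)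
    then show ?thesis
      using chain[of H "frechet_derivative H (at 0)" 0] smooth_on_has_derivative[OF that W1(2)] c0 by simp
  qed
  \<comment> \<open>At 0 the vector \<open>\<i>\<close> is mapped to a multiple of the null vector
    \<open>1 / r p\<close>, along which \<Xi> is assumed stationary.\<close>
  have DQ: "frechet_derivative Q (at 0) \<i> = 0"
  proof -
    have "(Q has_derivative (\<lambda>v. frechet_derivative (Xi r) (at p) (?D 0 v))) (at 0)"
      unfolding Q_def using has_derivative_compose[OF d\<phi>[OF W1(2)]] smooth_on_has_derivative[OF sXi V(2)] \<phi>0 by auto
    from fun_cong[OF frechet_derivative_at[OF this], of \<i>]
    have "frechet_derivative Q (at 0) \<i> = frechet_derivative (Xi r) (at p) (?D 0 \<i>)" by simp
    also have "?D 0 \<i> = Re (r p * ?D 0 \<i>) *\<^sub>R inverse (r p)"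
      using germ_null_direction(2)[OF \<epsilon> _ k0[OF T(2)], of r] r V(2) U(2) nn[OF W1(2)] by (simp add: c0 \<phi>0)
    also have "frechet_derivative (Xi r) (at p) (Re (r p * ?D 0 \<i>) *\<^sub>R inverse (r p)) = 0"
      using linear_scale[OF has_derivative_linear[OF smooth_on_has_derivative[OF sXi V(2)]]] \<xi> by simp
    finally show ?thesis .
  qed
  \<comment> \<open>Both \<open>Q\<close> and its derivative vanish at 0, so the left side of
    \<open>rel\<close> has derivative 0 there, while the right side has
    \<open>12 * G 0\<close>.\<close>
  have a: "((\<lambda>\<tau>. P (c \<tau>) * Q (c \<tau>)) has_real_derivative 0) (at 0)"
    using DERIV_mult[OF path[OF sP] path[OF sQ]] DQ Xi0 by (simp add: c0 Q_def \<phi>0)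
  have b: "((\<lambda>\<tau>. 12 * \<tau> * G (c \<tau>)) has_real_derivative 12 * G 0) (at 0)"
    using DERIV_mult[OF DERIV_cmult[OF DERIV_ident, of 12] path[OF sG]] by (simp add: c0)
  have "((\<lambda>\<tau>. P (c \<tau>) * Q (c \<tau>)) has_real_derivative 12 * G 0) (at 0)"
    by (rule has_field_derivative_transform_within_open[OF b T]) (simp add: rel)
  from DERIV_unique[OF this a] have 1: "dlam p (?D 0 1) = 0"
    by (simp add: G_def \<phi>0)
  have 2: "dlam p (?D 0 \<i>) = 0"
    using gen(2)[OF T(2)] Xi0 by (simp add: c0 \<phi>0)
  show False
    by (rule dlam_basis[OF has_derivative_linear[OF d\<phi>[OF W1(2)]] inj[OF W(2)] 1 2])
qed

end

section \<open>Charts of the space forms\<close>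

lemma mat2_adjugate:
  assumes "x * w - y * z = 1"
  shows "mat2 x y z w ** mat2 w (- y) (- z) x = mat2 1 0 0 1" "mat2 w (- y) (- z) x ** mat2 x y z w = mat2 1 0 0 1"
  using assms by (auto simp: mat2_mult mat2_eq_iff algebra_simps)

text \<open>\<open>P\<close> will be the inverse of \<open>A p\<close>, which moves the base point
  to \<open>dg \<epsilon>\<close>. The chart is linear on the whole matrix space, hence smooth on an
  open set of it, as \<open>germ_A_equiv\<close> demands of \<Psi>.\<close>

definition frame_chart :: "complex^2^2 \<Rightarrow> complex^2^2 \<Rightarrow> real \<times> complex" where
  "frame_chart P X = (Re ((P ** X ** adjm P) $ 1 $ 1), (P ** X ** adjm P) $ 1 $ 2)"

text \<open>The lower right entry is the one forced by determinant \<epsilon>.\<close>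

definition hermitian :: "real \<Rightarrow> real \<times> complex \<Rightarrow> complex^2^2" where
  "hermitian \<epsilon> x = mat2 (of_real (fst x)) (snd x) (cnj (snd x)) (of_real ((\<epsilon> + Re (snd x * cnj (snd x))) / fst x))"

lemma bounded_linear_frame_chart: "bounded_linear (frame_chart P)"
  unfolding frame_chart_def
  by (intro bounded_linear_Pair bounded_linear_compose[OF bounded_linear_Re] bounded_linear_compose[OF bounded_linear_vec_nth]
      bounded_linear_matrix_conjugation)

lemma hermitian_unique:
  fixes Y :: "complex^2^2"
  assumes "adjm Y = Y" "det Y = of_real \<epsilon>" "Re (Y $ 1 $ 1) > 0"
  shows "hermitian \<epsilon> (Re (Y $ 1 $ 1), Y $ 1 $ 2) = Y"
proof -
  have "adjm Y = mat2 (cnj (Y $ 1 $ 1)) (cnj (Y $ 2 $ 1)) (cnj (Y $ 1 $ 2)) (cnj (Y $ 2 $ 2))"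
    by (subst mat2_cases[of Y]) (simp add: adjm_mat2)
  with assms(1) have h: "cnj (Y $ 1 $ 1) = Y $ 1 $ 1" "cnj (Y $ 1 $ 2) = Y $ 2 $ 1"
    by (metis mat2_nth(1), metis mat2_nth(3))
  have 11: "of_real (Re (Y $ 1 $ 1)) = Y $ 1 $ 1"
    using h(1) by (simp add: complex_eq_iff)
  have "Y $ 1 $ 1 * Y $ 2 $ 2 - Y $ 1 $ 2 * cnj (Y $ 1 $ 2) = of_real \<epsilon>"
    using assms(2) h(2) by (simp add: det_2)
  moreover have "Y $ 1 $ 2 * cnj (Y $ 1 $ 2) = of_real (Re (Y $ 1 $ 2 * cnj (Y $ 1 $ 2)))"
    by (simp add: complex_eq_iff)
  ultimately have "of_real (Re (Y $ 1 $ 1)) * Y $ 2 $ 2 = of_real (\<epsilon> + Re (Y $ 1 $ 2 * cnj (Y $ 1 $ 2)))"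
    unfolding 11 by (simp add: algebra_simps)
  then have 22: "Y $ 2 $ 2 = of_real ((\<epsilon> + Re (Y $ 1 $ 2 * cnj (Y $ 1 $ 2))) / Re (Y $ 1 $ 1))"
    using assms(3) by (simp add: field_simps)
  show ?thesis
    unfolding hermitian_def by (rule mat2_eqI[symmetric]) (use h 11 22 in simp_all)
qed

text \<open>\<open>C\<close> is a lower triangular Cholesky factor. Writing a chart value as a front
  makes membership in the space form, including the positive trace for
  \<open>\<epsilon> = 1\<close>, survive conjugation by a matrix of determinant 1.\<close>

lemma hermitian_eq_front:
  assumes "fst x > 0"
  obtains C where "det C = 1" "hermitian \<epsilon> x = C ** dg \<epsilon> ** adjm C"
proof -
  define s where "s = sqrt (fst x)"
  have s: "s > 0" "s * s = fst x" using assms by (auto simp: s_def)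
  define C where "C = mat2 (of_real s) 0 (cnj (snd x) / of_real s) (1 / of_real s)"
  have "det C = 1" using s(1) by (simp add: C_def det_mat2)
  moreover have "hermitian \<epsilon> x = C ** dg \<epsilon> ** adjm C"
  proof -
    have ss: "of_real (fst x) = (of_real s * of_real s :: complex)"
      by (simp only: s(2)[symmetric] of_real_mult)
    have nn: "of_real (Re (snd x * cnj (snd x))) = snd x * cnj (snd x)"
      by (simp add: complex_eq_iff)
    show ?thesis
      unfolding C_def dg_def adjm_mat2 mat2_mult hermitian_def mat2_eq_iff of_real_divide of_real_add nn ss
      using s(1) by (simp add: field_simps)
  qed
  ultimately show ?thesis by (rule that)
qed

lemma chart_inverse:
  fixes G P :: "complex^2^2"
  assumes GP: "G ** P = mat 1" "P ** G = mat 1" and det: "det G = 1" and \<epsilon>: "\<epsilon> = 1 \<or> \<epsilon> = -1"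
  shows "X \<in> space_form \<epsilon> \<Longrightarrow> fst (frame_chart P X) > 0 \<Longrightarrow> G ** hermitian \<epsilon> (frame_chart P X) ** adjm G = X"
    and "fst x > 0 \<Longrightarrow> G ** hermitian \<epsilon> x ** adjm G \<in> space_form \<epsilon> \<and> frame_chart P (G ** hermitian \<epsilon> x ** adjm G) = x"
proof -
  have one: "adjm (mat 1) = (mat 1 :: complex^2^2)" by (simp add: mat2_one adjm_mat2)
  have aGP: "adjm G ** adjm P = mat 1" "adjm P ** adjm G = mat 1"
    using adjm_mult[of P G] adjm_mult[of G P] GP one by simp_all
  have "det P = 1" using arg_cong[OF GP(1), of det] det by (simp add: det_mul)
  then have dY: "det (P ** X ** adjm P) = det X" for X by (simp add: det_mul det_adjm)
  {
    assume X: "X \<in> space_form \<epsilon>" and pos: "fst (frame_chart P X) > 0"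
    let ?Y = "P ** X ** adjm P"
    have "adjm ?Y = ?Y" "det ?Y = of_real \<epsilon>"
      using X dY by (simp_all add: space_form_def adjm_mult matrix_mul_assoc)
    then have "hermitian \<epsilon> (frame_chart P X) = ?Y"
      using hermitian_unique pos by (simp add: frame_chart_def)
    then have "G ** hermitian \<epsilon> (frame_chart P X) ** adjm G = (G ** P) ** X ** (adjm P ** adjm G)"
      by (simp add: matrix_mul_assoc)
    then show "G ** hermitian \<epsilon> (frame_chart P X) ** adjm G = X"
      by (simp add: GP aGP)
  }
  assume x: "fst x > 0"
  obtain C where C: "det C = 1" "hermitian \<epsilon> x = C ** dg \<epsilon> ** adjm C"
    by (rule hermitian_eq_front[OF x])
  have "G ** hermitian \<epsilon> x ** adjm G = front \<epsilon> (\<lambda>_. G ** C) 0"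
    unfolding C(2) front_def adjm_mult by (simp add: matrix_mul_assoc)
  moreover have "front \<epsilon> (\<lambda>_. G ** C) 0 \<in> space_form \<epsilon>"
    by (rule front_in_space_form) (use C(1) det \<epsilon> in \<open>simp_all add: det_mul\<close>)
  moreover have "P ** (G ** hermitian \<epsilon> x ** adjm G) ** adjm P = hermitian \<epsilon> x"
  proof -
    have "P ** (G ** hermitian \<epsilon> x ** adjm G) ** adjm P = (P ** G) ** hermitian \<epsilon> x ** (adjm G ** adjm P)"
      by (simp add: matrix_mul_assoc)
    then show ?thesis by (simp add: GP aGP)
  qed
  then have "frame_chart P (G ** hermitian \<epsilon> x ** adjm G) = x"
    by (simp add: frame_chart_def hermitian_def)
  ultimately show "G ** hermitian \<epsilon> x ** adjm G \<in> space_form \<epsilon> \<and> frame_chart P (G ** hermitian \<epsilon> x ** adjm G) = x"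
    by simp
qed

lemma smooth_on_hermitian:
  assumes "open S" "smooth_on S f" "\<And>y. y \<in> S \<Longrightarrow> fst (f y) \<noteq> 0"
  shows "smooth_on S (\<lambda>y. hermitian \<epsilon> (f y))"
  unfolding hermitian_def by (intro smooth_on_mat2 smooth_intros assms)

section \<open>The swallowtail criterion in the space form\<close>

context flat_surface
begin

text \<open>Left multiplication of \<open>A\<close> by a constant of determinant 1 preserves the
  differential equation, so the frame can be normalised to the identity at \<open>p\<close>. The
  normal form found in the chart is then carried to the space form by \<open>frame_chart\<close> and
  \<open>hermitian\<close>.\<close>

lemma swallowtail_sufficient:
  assumes \<epsilon>: "\<epsilon> = 1 \<or> \<epsilon> = -1" and V: "open V" "p \<in> V" "V \<subseteq> U" and hr: "r holomorphic_on V"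
    and r: "\<And>z. z \<in> V \<Longrightarrow> r z ^ 2 = - of_real \<epsilon> * \<alpha> z * \<beta> z" and Xi0: "Xi r p = 0"
    and \<xi>: "frechet_derivative (Xi r) (at p) (inverse (r p)) \<noteq> 0"
  shows "germ_A_equiv (space_form \<epsilon>) (front \<epsilon> A) U p swallowtail_model"
proof -
  let ?a = "A p $ 1 $ 1" and ?b = "A p $ 1 $ 2" and ?c = "A p $ 2 $ 1" and ?d = "A p $ 2 $ 2"
  \<comment> \<open>The adjugate, which is the inverse of \<open>A p\<close> because the determinant
    is 1.\<close>
  define P where "P = mat2 ?d (- ?b) (- ?c) ?a"
  have d0: "?a * ?d - ?b * ?c = 1" by (rule det_entries[OF U(2)])
  have GP: "A p ** P = mat 1" "P ** A p = mat 1"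
    using mat2_adjugate[OF d0] unfolding P_def mat2_cases[of "A p", symmetric] mat2_one by blast+
  define a b c d where "a z = (P ** A z) $ 1 $ 1" and "b z = (P ** A z) $ 1 $ 2"
    and "c z = (P ** A z) $ 2 $ 1" and "d z = (P ** A z) $ 2 $ 2" for z
  have PA: "P ** A z = mat2 (a z) (b z) (c z) (d z)" for z
    by (rule mat2_eqI) (simp_all add: a_def b_def c_def d_def)
  have abcd: "a z = ?d * A z $ 1 $ 1 - ?b * A z $ 2 $ 1" "b z = ?d * A z $ 1 $ 2 - ?b * A z $ 2 $ 2"
    "c z = - ?c * A z $ 1 $ 1 + ?a * A z $ 2 $ 1" "d z = - ?c * A z $ 1 $ 2 + ?a * A z $ 2 $ 2" for z
    unfolding a_def b_def c_def d_def P_def by (simp_all add: matrix_matrix_mult_def sum_2)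
  have VU: "z \<in> U" if "z \<in> V" for z using that V(3) by blast
  interpret ff: flat_frame V p \<alpha> \<beta> a b c d r \<epsilon>
  proof
    show "\<alpha> holomorphic_on V" "\<beta> holomorphic_on V"
      using hol V(3) holomorphic_on_subset by blast+
    fix z assume z: "z \<in> V"
    note o = ode_entries[OF VU[OF z]]
    show "(a has_field_derivative \<beta> z * b z) (at z)" "(b has_field_derivative \<alpha> z * a z) (at z)"
      "(c has_field_derivative \<beta> z * d z) (at z)" "(d has_field_derivative \<alpha> z * c z) (at z)"
      unfolding abcd[abs_def] by (rule derivative_eq_intros o refl | simp add: algebra_simps)+
    have "a z * d z - b z * c z = det (P ** A z)" unfolding PA det_mat2 ..
    also have "\<dots> = 1" using det[OF VU[OF z]] det[OF U(2)] arg_cong[OF GP(1), of det] by (simp add: det_mul)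
    finally show "a z * d z - b z * c z = 1" .
    show "\<alpha> z \<noteq> 0 \<and> \<beta> z \<noteq> 0" by (rule nz[OF VU[OF z]])
    show "r z ^ 2 = - of_real \<epsilon> * \<alpha> z * \<beta> z" by (rule r[OF z])
  next
    have "mat2 (a p) (b p) (c p) (d p) = mat2 1 0 0 1"
      using GP(2) PA[of p] by (simp add: mat2_one)
    then show "a p = 1" "b p = 0" "c p = 0" "d p = 1" by (auto simp: mat2_eq_iff)
  qed (use V \<epsilon> lp hr in auto)
  have rnz: "r z \<noteq> 0" if "z \<in> V" for z by (rule ff.r_nz[OF that])
  have ch: "frame_chart P (front \<epsilon> A z) = ff.X z" for z
  proof -
    have "P ** front \<epsilon> A z ** adjm P = front \<epsilon> (\<lambda>z. P ** A z) z"
      by (simp add: front_def adjm_mult matrix_mul_assoc)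
    also have "\<dots> = mat2 (a z * cnj (a z) + of_real \<epsilon> * (b z * cnj (b z))) (a z * cnj (c z) + of_real \<epsilon> * (b z * cnj (d z)))
     (c z * cnj (a z) + of_real \<epsilon> * (d z * cnj (b z))) (c z * cnj (c z) + of_real \<epsilon> * (d z * cnj (d z)))"
      by (rule front_entries[OF PA])
    finally show ?thesis by (simp add: frame_chart_def ff.X_def mult.assoc)
  qed
  have e: "ff.e = inverse (r p)" by (simp add: ff.e_def)
  have le: "dlam p ff.e = 0" using Xi0 by (simp add: e Xi_def)
  have path: "((\<lambda>t. dlam (p + t *\<^sub>R ff.e) (inverse (r (p + t *\<^sub>R ff.e)))) has_real_derivative
      frechet_derivative (Xi r) (at p) (inverse (r p))) (at 0)"
    using linear_path_DERIV[OF smooth_on_has_derivative[OF smooth_Xi[OF V(1,3) hr rnz] V(2)], of ff.e]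
    by (simp add: Xi_def e)
  obtain V' Z \<phi> N \<Psi> \<theta> where V': "V' \<subseteq> V" "p \<in> V'" and Z: "0 \<in> Z" and \<phi>: "diffeo_on \<phi> Z V'" "\<phi> 0 = p"
    and N: "open N" "N \<subseteq> ff.B0" and s\<Psi>: "smooth_on N (\<Psi> :: real \<times> complex \<Rightarrow> real^3)" and inj: "inj_on \<Psi> N"
    and oim: "open (\<Psi> ` N)" and s\<theta>: "smooth_on (\<Psi> ` N) \<theta>" and \<theta>: "\<And>x. x \<in> N \<Longrightarrow> \<theta> (\<Psi> x) = x"
    and \<Psi>0: "\<Psi> (ff.X p) = 0" and nf: "\<And>w. w \<in> Z \<Longrightarrow> ff.X (\<phi> w) \<in> N \<and> \<Psi> (ff.X (\<phi> w)) = swallowtail_model w"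
    by (rule ff.swallowtail_normal_form[OF nondeg le path \<xi>]) blast
  have pos: "fst x > 0" if "x \<in> N" for x using that N(2) by (auto simp: ff.B0_def)
  note ci = chart_inverse[OF GP det[OF U(2)] \<epsilon>]
  define Ob where "Ob = frame_chart P -` N"
  have oOb: "open Ob"
    unfolding Ob_def by (intro open_vimage N(1) linear_continuous_on bounded_linear_frame_chart)
  let ?\<Psi> = "\<lambda>X. \<Psi> (frame_chart P X)"
  let ?\<theta> = "\<lambda>y. A p ** hermitian \<epsilon> (\<theta> y) ** adjm (A p)"
  have im: "?\<Psi> ` (space_form \<epsilon> \<inter> Ob) = \<Psi> ` N"
  proof
    show "?\<Psi> ` (space_form \<epsilon> \<inter> Ob) \<subseteq> \<Psi> ` N" by (auto simp: Ob_def)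
    show "\<Psi> ` N \<subseteq> ?\<Psi> ` (space_form \<epsilon> \<inter> Ob)"
    proof
      fix y assume "y \<in> \<Psi> ` N"
      then obtain x where x: "x \<in> N" "y = \<Psi> x" by blast
      then show "y \<in> ?\<Psi> ` (space_form \<epsilon> \<inter> Ob)"
        using ci(2)[OF pos[OF x(1)]] by (intro image_eqI[of _ _ "A p ** hermitian \<epsilon> x ** adjm (A p)"]) (auto simp: Ob_def)
    qed
  qed
  have inv\<theta>: "?\<theta> (?\<Psi> X) = X" if "X \<in> space_form \<epsilon> \<inter> Ob" for X
    using that ci(1)[of X] pos \<theta> by (auto simp: Ob_def)
  have \<theta>N: "\<theta> y \<in> N" if "y \<in> \<Psi> ` N" for y using that \<theta> by auto
  have \<theta>nz: "fst (\<theta> y) \<noteq> 0" if "y \<in> \<Psi> ` N" for y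
    using pos[OF \<theta>N[OF that]] by simp
  have V'_op: "open Z" "open V'" and \<phi>V: "\<phi> w \<in> V'" if "w \<in> Z" for w
    using \<phi>(1) that by (auto simp: diffeo_on_def bij_betw_def)
  have ops: "open Z" "open V'" using V'_op Z by blast+
  have fN: "front \<epsilon> A (\<phi> w) \<in> space_form \<epsilon> \<inter> Ob \<and> ?\<Psi> (front \<epsilon> A (\<phi> w)) = swallowtail_model w" if "w \<in> Z" for w
  proof -
    have "\<phi> w \<in> U" using \<phi>V[OF that] V' VU by blast
    then show ?thesis
      using front_in_space_form[OF det \<epsilon>] nf[OF that] ch by (simp add: Ob_def)
  qed
  show ?thesis
    unfolding germ_A_equiv_def
  proof (intro exI conjI)
    show "open V'" "p \<in> V'" "V' \<subseteq> U" "open Z" "0 \<in> Z" "diffeo_on \<phi> Z V'" "\<phi> 0 = p" "open Ob"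
      using ops V' V(3) Z \<phi> oOb by auto
    show "front \<epsilon> A p \<in> Ob" using fN[OF Z] \<phi>(2) by simp
    show "smooth_on Ob ?\<Psi>"
      by (rule smooth_on_compose[OF s\<Psi> N(1) oOb smooth_on_bounded_linear[OF bounded_linear_frame_chart oOb smooth_on_ident[OF oOb]]])
        (simp add: Ob_def)
    show "inj_on ?\<Psi> (space_form \<epsilon> \<inter> Ob)"
      by (rule inj_on_inverseI[of _ ?\<theta>]) (rule inv\<theta>)
    show "open (?\<Psi> ` (space_form \<epsilon> \<inter> Ob))" unfolding im by (rule oim)
    show "smooth_on (?\<Psi> ` (space_form \<epsilon> \<inter> Ob)) ?\<theta>"
      unfolding im
      by (intro smooth_on_bounded_linear[OF bounded_linear_matrix_conjugation oim] smooth_on_hermitian oim s\<theta>)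
        (rule \<theta>nz)
    show "\<forall>X\<in>space_form \<epsilon> \<inter> Ob. ?\<theta> (?\<Psi> X) = X" using inv\<theta> by blast
    show "?\<Psi> (front \<epsilon> A p) = 0" using \<Psi>0 ch by simp
    show "\<forall>w\<in>Z. front \<epsilon> A (\<phi> w) \<in> space_form \<epsilon> \<inter> Ob \<and> ?\<Psi> (front \<epsilon> A (\<phi> w)) = swallowtail_model w"
      using fN by blast
  qed
qed

theorem swallowtail_iff:
  assumes "\<epsilon> = 1 \<or> \<epsilon> = -1" "open V" "p \<in> V" "V \<subseteq> U" "r holomorphic_on V"
    "\<And>z. z \<in> V \<Longrightarrow> r z ^ 2 = - of_real \<epsilon> * \<alpha> z * \<beta> z" "Xi r p = 0"
  shows "is_swallowtail (space_form \<epsilon>) (front \<epsilon> A) U p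
    \<longleftrightarrow> frechet_derivative (Xi r) (at p) (inverse (r p)) \<noteq> 0"
  unfolding is_swallowtail_def
  using swallowtail_transversal[OF _ assms] swallowtail_sufficient[OF assms] by blast

section \<open>The cuspidal torsion\<close>

lemma dlam_dzbar: "z \<in> U \<Longrightarrow> dlam z v = 2 * Re (dzbar (lam \<alpha> \<beta>) z * cnj v)"
proof -
  assume z: "z \<in> U"
  have "v = Re v *\<^sub>R 1 + Im v *\<^sub>R \<i>" by (simp add: complex_eq_iff)
  then have "dlam z v = dlam z (Re v *\<^sub>R 1 + Im v *\<^sub>R \<i>)" by (rule arg_cong)
  also have "\<dots> = Re v * dlam z 1 + Im v * dlam z \<i>"
    by (simp only: linear_add[OF dlam_linear[OF z]] linear_scale[OF dlam_linear[OF z]] real_scaleR_def)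
  finally show ?thesis by (simp add: dzbar_def field_simps)
qed

lemma Xi_dzbar:
  assumes "z \<in> U"
  shows "Xi r z = 2 * Re (r z * dzbar (lam \<alpha> \<beta>) z) / norm (r z) ^ 2"
proof -
  have "cnj (inverse (r z)) = r z / of_real (norm (r z) ^ 2)"
    by (cases "r z = 0") (simp_all only: complex_norm_square, simp_all add: field_simps)
  then have "Xi r z = 2 * Re (dzbar (lam \<alpha> \<beta>) z * r z / of_real (norm (r z) ^ 2))"
    unfolding Xi_def dlam_dzbar[OF assms] by simp
  then show ?thesis
    by (simp only: Re_divide_of_real) (simp add: mult.commute)
qed

text \<open>\<open>csqrt\<close> differs from the holomorphic branch \<open>r\<close> by a sign that
  may jump from point to point, but the sign cancels in the quotient, and so does
  \<open>|r|^2\<close>. Passing to \<open>\<i> * r\<close> exchanges real and imaginary part up to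
  sign.\<close>

lemma kappa_eq_Xi:
  assumes z: "z \<in> U" and r: "r z ^ 2 = \<alpha> z * \<beta> z" and rnz: "r z \<noteq> 0"
  shows "kappa_h \<alpha> \<beta> z = - Xi r z / Xi (\<lambda>z. \<i> * r z) z"
    and "kappa_d \<alpha> \<beta> z = Xi (\<lambda>z. \<i> * r z) z / Xi r z"
proof -
  have "csqrt (\<alpha> z * \<beta> z) ^ 2 = r z ^ 2" using r by simp
  then have "csqrt (\<alpha> z * \<beta> z) = r z \<or> csqrt (\<alpha> z * \<beta> z) = - r z"
    by (simp only: power2_eq_iff)
  then have k: "kappa_h \<alpha> \<beta> z = Re (r z * dzbar (lam \<alpha> \<beta>) z) / Im (r z * dzbar (lam \<alpha> \<beta>) z)"
    "kappa_d \<alpha> \<beta> z = - Im (r z * dzbar (lam \<alpha> \<beta>) z) / Re (r z * dzbar (lam \<alpha> \<beta>) z)"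
    unfolding kappa_h_def kappa_d_def by (elim disjE; simp del: times_complex.sel)+
  have x: "Xi (\<lambda>z. \<i> * r z) z = - 2 * Im (r z * dzbar (lam \<alpha> \<beta>) z) / norm (r z) ^ 2"
    unfolding Xi_dzbar[OF z] by (simp add: norm_mult)
  show "kappa_h \<alpha> \<beta> z = - Xi r z / Xi (\<lambda>z. \<i> * r z) z" "kappa_d \<alpha> \<beta> z = Xi (\<lambda>z. \<i> * r z) z / Xi r z"
    unfolding k x Xi_dzbar[OF z] using rnz by (simp_all del: times_complex.sel)
qed

text \<open>By \<open>Xi r p = 0\<close> the nonzero differential of \<lambda> has exactly the line
  of \<open>1 / r p\<close> as kernel, and the velocity of a curve in \<lambda> = 0 lies in that
  kernel.\<close>

lemma singular_curve_velocity:
  assumes r: "r p \<noteq> 0" "Xi r p = 0"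
    and \<gamma>: "(\<gamma> has_vector_derivative v) (at 0)" "v \<noteq> 0" "\<gamma> 0 = p"
    and sing: "open T" "0 \<in> T" "\<And>t. t \<in> T \<Longrightarrow> lam \<alpha> \<beta> (\<gamma> t) = 0"
  obtains c where "c \<noteq> 0" "v = c *\<^sub>R inverse (r p)"
proof -
  have "((\<lambda>t. lam \<alpha> \<beta> (\<gamma> t)) has_derivative (\<lambda>t. dlam p (t *\<^sub>R v))) (at 0)"
    using has_derivative_compose[OF \<gamma>(1)[unfolded has_vector_derivative_def]] dlam[OF U(2)] \<gamma>(3) by simp
  then have "((\<lambda>t. 0) has_derivative (\<lambda>t. dlam p (t *\<^sub>R v))) (at 0)"
    by (rule has_derivative_transform_within_open[OF _ sing(1,2)]) (rule sing(3))
  from fun_cong[OF has_derivative_unique[OF this has_derivative_const], of 1]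
  have v0: "dlam p v = 0" by simp
  let ?e = "inverse (r p)"
  define x y where "x = Re (v / ?e)" and "y = Im (v / ?e)"
  have v: "v = x *\<^sub>R ?e + y *\<^sub>R (\<i> * ?e)"
  proof -
    have "v = v / ?e * ?e" using r by simp
    also have "v / ?e = of_real x + \<i> * of_real y"
      unfolding x_def y_def by (rule complex_eq)
    finally show ?thesis by (simp add: scaleR_conv_of_real algebra_simps)
  qed
  have e0: "dlam p ?e = 0" using r(2) by (simp add: Xi_def)
  have ie: "dlam p (\<i> * ?e) \<noteq> 0"
  proof
    assume i0: "dlam p (\<i> * ?e) = 0"
    show False
    proof (rule dlam_basis[of "\<lambda>v. v * ?e"])
      show "linear (\<lambda>v. v * ?e)" by (rule linearI) (simp_all add: algebra_simps)
      show "dlam p (1 * ?e) = 0" using e0 by simp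
      show "dlam p (\<i> * ?e) = 0" by (rule i0)
    qed (use r in auto)
  qed
  have "y * dlam p (\<i> * ?e) = 0"
    using v0 unfolding v
    by (simp only: linear_add[OF dlam_linear[OF U(2)]] linear_scale[OF dlam_linear[OF U(2)]] e0) simp
  then have "y = 0" using ie by simp
  then have "v = x *\<^sub>R ?e" using v by simp
  moreover have "x \<noteq> 0" using calculation \<gamma>(2) by auto
  ultimately show ?thesis using that by blast
qed

text \<open>The numerator vanishes at \<open>p\<close>, so only its own derivative enters that of
  the quotient, and the velocity of \<gamma> is a nonzero multiple of the null vector.\<close>

lemma quotient_deriv_along_curve:
  assumes V: "open V" "p \<in> V" "V \<subseteq> U" and r: "r holomorphic_on V" "\<And>z. z \<in> V \<Longrightarrow> r z \<noteq> 0"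
    and q: "q holomorphic_on V" "\<And>z. z \<in> V \<Longrightarrow> q z \<noteq> 0"
    and Xi: "Xi r p = 0" "Xi q p \<noteq> 0"
    and \<gamma>: "(\<gamma> has_vector_derivative v) (at 0)" "v \<noteq> 0" "\<gamma> 0 = p"
    and sing: "open T" "0 \<in> T" "\<And>t. t \<in> T \<Longrightarrow> \<gamma> t \<in> V \<and> lam \<alpha> \<beta> (\<gamma> t) = 0"
    and \<kappa>: "\<And>z. z \<in> V \<Longrightarrow> \<kappa> z = s * (Xi r z / Xi q z)" "s \<noteq> 0"
  shows "deriv (\<lambda>t. \<kappa> (\<gamma> t)) 0 \<noteq> 0 \<longleftrightarrow> frechet_derivative (Xi r) (at p) (inverse (r p)) \<noteq> 0"
proof -
  obtain c where c: "c \<noteq> 0" "v = c *\<^sub>R inverse (r p)"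
    by (rule singular_curve_velocity[OF r(2)[OF V(2)] Xi(1) \<gamma> sing(1,2)]) (use sing(3) in auto)
  have path: "((\<lambda>t. H (\<gamma> t)) has_real_derivative frechet_derivative H (at p) v) (at 0)" if "smooth_on V H" for H :: "complex \<Rightarrow> real"
  proof -
    have dH: "(H has_derivative frechet_derivative H (at p)) (at (\<gamma> 0))"
      using smooth_on_has_derivative[OF that V(2)] \<gamma>(3) by simp
    have "((\<lambda>t. H (\<gamma> t)) has_derivative (\<lambda>t. frechet_derivative H (at p) (t *\<^sub>R v))) (at 0)"
      by (rule has_derivative_compose[OF \<gamma>(1)[unfolded has_vector_derivative_def] dH])
    then have "((\<lambda>t. H (\<gamma> t)) has_derivative (*) (frechet_derivative H (at p) v)) (at 0)"
      by (rule has_derivative_eq_rhs) (use has_derivative_linear[OF dH] in \<open>auto simp: linear_scale mult.commute\<close>)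
    then show ?thesis by (simp add: has_field_derivative_def)
  qed
  note sr = smooth_Xi[OF V(1,3) r] and sq = smooth_Xi[OF V(1,3) q]
  have "((\<lambda>t. s * (Xi r (\<gamma> t) / Xi q (\<gamma> t))) has_real_derivative
      s * (frechet_derivative (Xi r) (at p) v / Xi q p)) (at 0)"
    using DERIV_cmult[OF DERIV_divide[OF path[OF sr] path[OF sq]], of s] Xi \<gamma>(3)
    by (simp add: field_simps)
  then have "((\<lambda>t. \<kappa> (\<gamma> t)) has_real_derivative s * (frechet_derivative (Xi r) (at p) v / Xi q p)) (at 0)"
    by (rule has_field_derivative_transform_within_open[OF _ sing(1,2)]) (use \<kappa>(1) sing(3) in auto)
  then have "deriv (\<lambda>t. \<kappa> (\<gamma> t)) 0 = s * (frechet_derivative (Xi r) (at p) v / Xi q p)"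
    by (rule DERIV_imp_deriv)
  moreover have "frechet_derivative (Xi r) (at p) v = c * frechet_derivative (Xi r) (at p) (inverse (r p))"
    unfolding c(2) using linear_scale[OF has_derivative_linear[OF smooth_on_has_derivative[OF sr V(2)]]] by simp
  ultimately show ?thesis using c(1) Xi(2) \<kappa>(2) by simp
qed

end

theorem theorem3p9:
  fixes U :: "complex set" and \<alpha> \<beta> :: "complex \<Rightarrow> complex"
    and A :: "complex \<Rightarrow> complex^2^2" and p :: complex
    and \<gamma> :: "real \<Rightarrow> complex" and \<epsilon> :: real
  assumes "open U" and "connected U"
    and "\<alpha> holomorphic_on U" and "\<beta> holomorphic_on U"
    and "\<forall>z\<in>U. \<alpha> z \<noteq> 0 \<and> \<beta> z \<noteq> 0"
    and "\<forall>z\<in>U. det (A z) = 1"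
    and "\<forall>z\<in>U. \<forall>i j. ((\<lambda>w. A w $ i $ j) has_field_derivative
                         (A z ** Dmat (\<alpha> z) (\<beta> z)) $ i $ j) (at z)"
    \<comment> \<open>p is a non-degenerate singular point of f and g\<close>
    and "p \<in> U" and "lam \<alpha> \<beta> p = 0"
    and "\<not> (lam \<alpha> \<beta> has_derivative (\<lambda>_. 0)) (at p)"
    \<comment> \<open>\<gamma> is a (regular, smooth) singular curve through p = \<gamma>(0)\<close>
    and "\<epsilon> > 0" and "smooth_on {-\<epsilon><..<\<epsilon>} \<gamma>" and "\<gamma> 0 = p"
    and "vector_derivative \<gamma> (at 0) \<noteq> 0"
    and "\<forall>t\<in>{-\<epsilon><..<\<epsilon>}. \<gamma> t \<in> U \<and> lam \<alpha> \<beta> (\<gamma> t) = 0"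
  shows "(is_cuspidal_edge hyperbolic3 (hyp_front A) U p \<and> kappa_h \<alpha> \<beta> p = 0 \<longrightarrow>
            (is_swallowtail deSitter3 (dS_front A) U p \<longleftrightarrow> deriv (\<lambda>t. kappa_h \<alpha> \<beta> (\<gamma> t)) 0 \<noteq> 0))
       \<and> (is_cuspidal_edge deSitter3 (dS_front A) U p \<and> kappa_d \<alpha> \<beta> p = 0 \<longrightarrow>
            (is_swallowtail hyperbolic3 (hyp_front A) U p \<longleftrightarrow> deriv (\<lambda>t. kappa_d \<alpha> \<beta> (\<gamma> t)) 0 \<noteq> 0))"
proof -
  interpret flat_surface U p \<alpha> \<beta> A
    by unfold_locales (use assms in blast)+
  \<comment> \<open>On a ball \<open>\<alpha> * \<beta>\<close> has a holomorphic square root,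
    whereas \<open>csqrt\<close> may jump across its branch cut.\<close>
  obtain \<rho> where \<rho>: "\<rho> > 0" "ball p \<rho> \<subseteq> U"
    using U open_contains_ball by blast
  define V where "V = ball p \<rho>"
  have V: "open V" "p \<in> V" "V \<subseteq> U" using \<rho> by (auto simp: V_def)
  have "(\<lambda>z. \<alpha> z * \<beta> z) holomorphic_on V"
    using hol V(3) by (intro holomorphic_on_mult) (auto elim: holomorphic_on_subset)
  moreover have "contractible V" unfolding V_def by (intro convex_imp_contractible convex_ball)
  ultimately obtain r where r: "r holomorphic_on V" "\<And>z. z \<in> V \<Longrightarrow> \<alpha> z * \<beta> z = r z ^ 2"
    using contractible_imp_holomorphic_sqrt[of "\<lambda>z. \<alpha> z * \<beta> z" V] nz V(3) by (metis mult_eq_0_iff subsetD)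
  \<comment> \<open>\<open>r\<close> serves the de Sitter front (sign -1) and \<open>q\<close>,
    whose square is \<open>- \<alpha> * \<beta>\<close>, the hyperbolic one (sign 1). In this
    theorem \<epsilon> is not that sign but half the length of the interval of \<gamma>.\<close>
  define q where "q = (\<lambda>z. \<i> * r z)"
  have q: "q holomorphic_on V" unfolding q_def by (intro holomorphic_intros r)
  have rnz: "r z \<noteq> 0" and qnz: "q z \<noteq> 0" if "z \<in> V" for z
    using r(2)[OF that] nz[of z] V(3) that by (auto simp: q_def)
  have r2: "r z ^ 2 = - of_real (-1) * \<alpha> z * \<beta> z" and q2: "q z ^ 2 = - of_real 1 * \<alpha> z * \<beta> z" if "z \<in> V" for z
    using r(2)[OF that] by (simp_all add: q_def power_mult_distrib)
  have \<kappa>: "kappa_h \<alpha> \<beta> z = - 1 * (Xi r z / Xi q z)" "kappa_d \<alpha> \<beta> z = 1 * (Xi q z / Xi r z)" if "z \<in> V" for z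
    using kappa_eq_Xi[of z r] r(2)[OF that] rnz[OF that] V(3) that by (auto simp: q_def)
  have I: "open {-\<epsilon><..<\<epsilon>}" "0 \<in> {-\<epsilon><..<\<epsilon>}" using assms(11) by auto
  define v where "v = vector_derivative \<gamma> (at 0)"
  have d\<gamma>: "(\<gamma> has_vector_derivative v) (at 0)" "v \<noteq> 0" "\<gamma> 0 = p"
    using smooth_on_has_derivative[OF assms(12) I(2)] assms(13,14)
    by (auto simp: v_def vector_derivative_works[symmetric] differentiable_def)
  define T where "T = \<gamma> -` V \<inter> {-\<epsilon><..<\<epsilon>}"
  have T: "open T" "0 \<in> T"
    using continuous_on_open_vimage[OF I(1), THEN iffD1, rule_format, OF smooth_on_imp_continuous_on[OF assms(12)] V(1)]
      I(2) V(2) assms(13) by (auto simp: T_def)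
  have sing: "\<gamma> t \<in> V \<and> lam \<alpha> \<beta> (\<gamma> t) = 0" if "t \<in> T" for t
    using assms(15) that by (auto simp: T_def)
  have 1: "is_swallowtail deSitter3 (dS_front A) U p \<longleftrightarrow> deriv (\<lambda>t. kappa_h \<alpha> \<beta> (\<gamma> t)) 0 \<noteq> 0"
    if c: "is_cuspidal_edge hyperbolic3 (hyp_front A) U p" and k: "kappa_h \<alpha> \<beta> p = 0"
  proof -
    \<comment> \<open>The cuspidal edge guarantees a nonzero denominator; without it the torsion
      could be 0 merely by the convention for division by zero.\<close>
    have Xq: "Xi q p \<noteq> 0"
      using c cuspidal_edge_transversal[of _ 1 q] q2[OF V(2)] unfolding is_cuspidal_edge_def front_cases by blast
    have Xr: "Xi r p = 0" using k \<kappa>(1)[OF V(2)] Xq by simp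
    have "deriv (\<lambda>t. kappa_h \<alpha> \<beta> (\<gamma> t)) 0 \<noteq> 0 \<longleftrightarrow> frechet_derivative (Xi r) (at p) (inverse (r p)) \<noteq> 0"
      by (rule quotient_deriv_along_curve[OF V r(1) rnz q qnz Xr Xq d\<gamma> T sing \<kappa>(1)]) auto
    moreover have "is_swallowtail deSitter3 (dS_front A) U p \<longleftrightarrow> frechet_derivative (Xi r) (at p) (inverse (r p)) \<noteq> 0"
      unfolding front_cases space_form_cases by (rule swallowtail_iff[OF _ V r(1) r2 Xr]) auto
    ultimately show ?thesis by simp
  qed
  have 2: "is_swallowtail hyperbolic3 (hyp_front A) U p \<longleftrightarrow> deriv (\<lambda>t. kappa_d \<alpha> \<beta> (\<gamma> t)) 0 \<noteq> 0"
    if c: "is_cuspidal_edge deSitter3 (dS_front A) U p" and k: "kappa_d \<alpha> \<beta> p = 0"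
  proof -
    have Xr: "Xi r p \<noteq> 0"
      using c cuspidal_edge_transversal[of _ "-1" r] r2[OF V(2)] unfolding is_cuspidal_edge_def front_cases by blast
    have Xq: "Xi q p = 0" using k \<kappa>(2)[OF V(2)] Xr by simp
    have "deriv (\<lambda>t. kappa_d \<alpha> \<beta> (\<gamma> t)) 0 \<noteq> 0 \<longleftrightarrow> frechet_derivative (Xi q) (at p) (inverse (q p)) \<noteq> 0"
      by (rule quotient_deriv_along_curve[OF V q qnz r(1) rnz Xq Xr d\<gamma> T sing \<kappa>(2)]) auto
    moreover have "is_swallowtail hyperbolic3 (hyp_front A) U p \<longleftrightarrow> frechet_derivative (Xi q) (at p) (inverse (q p)) \<noteq> 0"
      unfolding front_cases space_form_cases by (rule swallowtail_iff[OF _ V q q2 Xq]) auto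
    ultimately show ?thesis by simp
  qed
  show ?thesis using 1 2 by blast
qed

end
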